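(* Let $b$ be a prime, $s,d,m\in\mathbb N$ (positive integers), $N=b^m$, and let $P=\{z_0,\ldots,z_{N-1}\}\subset[0,1)^{ds}$ be a deterministic point set. Let $f\in L_2([0,1]^s)$ and $$\widehat I_N(f)=\frac1N\sum_{n=0}^{N-1}f\bigl(\mathcal D_d(\Pi(z_n))\bigr).$$ Then $\widehat I_N(f)$ is unbiased, i.e. $\mathbb E[\widehat I_N(f)]=\int_{[0,1]^s}f(x)\,\mathrm dx$, and $$\operatorname{Var}[\widehat I_N(f)]=\sum_{\boldsymbol\ell\in\mathbb N_0^{ds}\setminus\{\boldsymbol 0\}}\sigma_{d,\boldsymbol\ell,s}^2(f)\,\Gamma_{d,\boldsymbol\ell}(P).$$
   Context: Base-$b$ expansions of points in $[0,1)$ are chosen to be the ones not eventually equal to $b-1$. Nested uniform (Owen) scrambling $\Pi$: for each coordinate $j\in\{1,\ldots,ds\}$ and each finite digit string $(a_1,\ldots,a_r)$, $r\ge0$, there is a uniformly distributed random permutation $\pi_{j;a_1,\ldots,a_r}$ of $\{0,\ldots,b-1\}$; all of these permutations are mutually independent. If $z_j=\sum_{a\ge1}z_{j,a}b^{-a}$, the $j$-th coordinate of $\Pi(z)$ has digits $\pi_{j;z_{j,1},\ldots,z_{j,r-1}}(z_{j,r})$, $r\ge1$. The same random permutations are applied to all points of $P$. Digit interlacing $\mathcal D_d:[0,1)^{ds}\to[0,1)^s$: with $z_j=\sum_{a\ge1}z_{j,a}b^{-a}$, $$\mathcal D_d(z)_i=\sum_{a=1}^\infty\sum_{r=1}^d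 z_{(i-1)d+r,a}\,b^{-r-(a-1)d},\qquad 1\le i\le s.$$ Walsh functions: for $k=\sum_{r\ge0}\kappa_rb^r\in\mathbb N_0$ and $x=\sum_{r\ge1}x_rb^{-r}\in[0,1)$, $\operatorname{wal}_k(x)=\exp\bigl(\tfrac{2\pi i}{b}\sum_{r\ge1}\kappa_{r-1}x_r\bigr)$; for vectors, $\operatorname{wal}_{\boldsymbol k}(x)=\prod_j\operatorname{wal}_{k_j}(x_j)$. Walsh coefficients: $\widehat f(\boldsymbol h)=\int_{[0,1]^s}f(x)\overline{\operatorname{wal}_{\boldsymbol h}(x)}\,\mathrm dx$. Interlacing of frequencies: $\mathcal E_d:\mathbb N_0^{ds}\to\mathbb N_0^s$ is the bijection given, for $k_j=\sum_{a\ge0}\kappa_{j,a}b^a$, by $\mathcal E_d(\boldsymbol k)_i=\sum_{a\ge0}\sum_{r=1}^d\kappa_{(i-1)d+r,a}b^{r-1+ad}$, $1\le i\le s$. Blocks: $B_0=\{0\}$, $B_\ell=\{k\in\mathbb N_0:b^{\ell-1}\le k<b^\ell\}$ for $\ell\ge1$, $B_{\boldsymbol\ell}=\prod_{j=1}^{ds}B_{\ell_j}$, and $$\sigma_{d,\boldsymbol\ell,s}^2(f)=\sum_{\boldsymbol k\in B_{\boldsymbol\ell}}|\widehat f(\mathcal E_d(\boldsymbol k))|^2.$$ For $x,x'\in[0,1)$: $\chi_0(x,x')=1$ and, for $\ell\ge1$, $$\chi_\ell(x,x')=\frac{b\,\mathbf 1_{\{\lfloor b^\ell x\rfloor=\lfloor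 b^\ell x'\rfloor\}}-\mathbf 1_{\{\lfloor b^{\ell-1}x\rfloor=\lfloor b^{\ell-1}x'\rfloor\}}}{b-1};$$ and, writing $z_n=(z_{n,1},\ldots,z_{n,ds})$, $$\Gamma_{d,\boldsymbol\ell}(P)=\frac1{N^2}\sum_{n,n'=0}^{N-1}\prod_{j=1}^{ds}\chi_{\ell_j}(z_{n,j},z_{n',j}).$$ Variance is $\operatorname{Var}[X]=\mathbb E|X-\mathbb E X|^2$, over the randomness of $\Pi$. *)

theory Defs
  imports "HOL-Probability.Probability" "HOL-Combinatorics.Permutations"
    "HOL-Computational_Algebra.Primes"
begin

text \<open>
  Points of \<open>[0,1]\<^sup>s\<close> are functions \<open>nat \<Rightarrow> real\<close> that are extensional on the index set
  \<open>{1..s}\<close>; digit strings \<open>(a\<^sub>1,\<dots>,a\<^sub>r)\<close> are lists.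
\<close>

text \<open>
  \<open>rdigit b x a\<close> (for \<open>a \<ge> 1\<close>) is the coefficient of \<open>b\<^sup>-\<^sup>a\<close> in the base-\<open>b\<close> expansion of
  \<open>x \<in> [0,1)\<close> that is not eventually equal to \<open>b-1\<close>; see \<open>rdigit_iff_expansion\<close>.
\<close>

definition rdigit :: "nat \<Rightarrow> real \<Rightarrow> nat \<Rightarrow> nat" where
  "rdigit b x a = nat (\<lfloor>real b ^ a * x\<rfloor> mod int b)"

definition ndigit :: "nat \<Rightarrow> nat \<Rightarrow> nat \<Rightarrow> nat" where
  "ndigit b k r = k div b ^ r mod b"

lemma floor_Suc_rdigit:
  assumes "b \<ge> 2"
  shows "\<lfloor>real b ^ Suc n * x\<rfloor> = int b * \<lfloor>real b ^ n * x\<rfloor> + int (rdigit b x (Suc n))"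
proof -
  have "\<lfloor>real b ^ n * x\<rfloor> = \<lfloor>real b ^ Suc n * x\<rfloor> div int b"
    using floor_divide_real_eq_div[of "int b" "real b ^ Suc n * x"] assms by simp
  moreover have "int (rdigit b x (Suc n)) = \<lfloor>real b ^ Suc n * x\<rfloor> mod int b"
    using assms by (simp add: rdigit_def)
  ultimately show ?thesis by (metis mult_div_mod_eq)
qed

lemma rdigit_less: "b \<ge> 2 \<Longrightarrow> rdigit b x a < b"
  by (simp add: rdigit_def nat_less_iff)

lemma rdigit_sums:
  assumes b: "b \<ge> 2" and x: "0 \<le> x" "x < 1"
  shows "(\<lambda>a. real (rdigit b x (Suc a)) / real b ^ Suc a) sums x"
proof -
  define F where "F n = real_of_int \<lfloor>real b ^ n * x\<rfloor> / real b ^ n" for n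
  have "(\<lambda>n. x - (1 / real b) ^ n) \<longlonglongrightarrow> x - 0"
    using b by (intro tendsto_intros LIMSEQ_power_zero) auto
  moreover have "x - (1 / real b) ^ n \<le> F n" "F n \<le> x" for n
  proof -
    have p: "real b ^ n > 0" using b by simp
    have "real b ^ n * x - 1 \<le> real_of_int \<lfloor>real b ^ n * x\<rfloor>"
      "real_of_int \<lfloor>real b ^ n * x\<rfloor> \<le> real b ^ n * x" by linarith+
    then show "x - (1 / real b) ^ n \<le> F n" "F n \<le> x"
      using p b by (simp_all add: F_def power_divide pos_le_divide_eq pos_divide_le_eq
          left_diff_distrib mult.commute[of x])
  qed
  ultimately have "F \<longlonglongrightarrow> x"
    by (intro tendsto_sandwich[of "\<lambda>n. x - (1 / real b) ^ n" F sequentially "\<lambda>_. x"]) auto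
  from telescope_sums[OF this] have "(\<lambda>n. F (Suc n) - F n) sums (x - F 0)" .
  moreover have "F 0 = 0" using x by (simp add: F_def floor_eq_iff)
  moreover have "F (Suc n) - F n = real (rdigit b x (Suc n)) / real b ^ Suc n" for n
    unfolding F_def floor_Suc_rdigit[OF b] using b by (simp add: field_simps)
  ultimately show ?thesis by simp
qed

lemma rdigit_not_eventually:
  assumes b: "b \<ge> 2"
  shows "\<not> (\<forall>a\<ge>A. rdigit b x a = b - 1)"
proof
  assume A: "\<forall>a\<ge>A. rdigit b x a = b - 1"
  define u where "u n = 1 - (real b ^ n * x - real_of_int \<lfloor>real b ^ n * x\<rfloor>)" for n
  have u: "0 < u n" "u n \<le> 1" for n unfolding u_def by linarith+
  have step: "u (Suc n) = real b * u n" if "n \<ge> A" for n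
    unfolding u_def floor_Suc_rdigit[OF b] using A that b
    by (simp add: of_nat_diff algebra_simps)
  have pow: "u (A + n) = real b ^ n * u A" for n
    by (induction n) (auto simp: step)
  obtain n where "1 / u A < real b ^ n"
    using real_arch_pow[of "real b" "1 / u A"] b by auto
  then have "1 < u (A + n)" using u[of A] by (simp add: pow field_simps)
  then show False using u[of "A + n"] by simp
qed

lemma expansion_unique:
  assumes b: "b \<ge> 2" and c: "\<And>a. a \<ge> 1 \<Longrightarrow> c a < b" and ne: "\<not> (\<exists>A. \<forall>a\<ge>A. c a = b - 1)"
    and s: "(\<lambda>a. real (c (Suc a)) / real b ^ Suc a) sums x"
  shows "rdigit b x (Suc n) = c (Suc n)"
proof -
  define g where "g n i = real (c (Suc (i + n))) / real b ^ Suc i" for n i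
  have geo: "(\<lambda>i. real (b - 1) / real b ^ Suc i) sums 1"
  proof -
    have "(\<lambda>i. (real (b - 1) / real b) * (1 / real b) ^ i) sums
        ((real (b - 1) / real b) * (1 / (1 - 1 / real b)))"
      using b by (intro sums_mult geometric_sums) auto
    moreover have one: "(real (b - 1) / real b) * (1 / (1 - 1 / real b)) = 1"
      using b by (simp add: of_nat_diff field_simps)
    ultimately have "(\<lambda>i. (real (b - 1) / real b) * (1 / real b) ^ i) sums 1"
      by (simp only: one)
    then show ?thesis by (simp add: power_divide)
  qed
  have le: "g n i \<le> real (b - 1) / real b ^ Suc i" "0 \<le> g n i" for n i
  proof -
    have "c (Suc (i + n)) \<le> b - 1" using c[of "Suc (i + n)"] by simp
    then show "g n i \<le> real (b - 1) / real b ^ Suc i" unfolding g_def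
      by (intro divide_right_mono) auto
  qed (simp add: g_def)
  have sm: "summable (g n)" for n
    by (rule summable_comparison_test'[OF sums_summable[OF geo], of 0]) (use le in auto)
  define t where "t n = (\<Sum>i. g n i)" for n
  have t0: "0 \<le> t n" for n unfolding t_def by (intro suminf_nonneg sm le)
  have t1: "t n < 1" for n
  proof -
    obtain a where a: "a \<ge> Suc n" "c a \<noteq> b - 1" using ne by blast
    define i where "i = a - Suc n"
    have ai: "a = Suc (i + n)" using a by (simp add: i_def)
    have lt: "c a < b - 1" using a c[of a] by simp
    have "0 < (\<Sum>i. real (b - 1) / real b ^ Suc i - g n i)"
    proof (rule suminf_pos2[of _ i])
      show "summable (\<lambda>i. real (b - 1) / real b ^ Suc i - g n i)"
        by (intro summable_diff sm sums_summable[OF geo])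
      show "0 \<le> real (b - 1) / real b ^ Suc j - g n j" for j using le(1)[of n j] by simp
      have "real (c a) / real b ^ Suc i < real (b - 1) / real b ^ Suc i"
        using lt b by (intro divide_strict_right_mono) auto
      then show "0 < real (b - 1) / real b ^ Suc i - g n i"
        unfolding g_def ai[symmetric] by simp
    qed
    also have "\<dots> = 1 - t n"
      using suminf_diff[OF sums_summable[OF geo] sm[of n]] sums_unique[OF geo]
      by (simp add: t_def)
    finally show ?thesis by simp
  qed
  have trec: "real b * t n = real (c (Suc n)) + t (Suc n)" for n
  proof -
    have "t n = g n 0 + (\<Sum>i. g n (Suc i))"
      unfolding t_def using suminf_split_head[OF sm[of n]] by simp
    moreover have "real b * (\<Sum>i. g n (Suc i)) = (\<Sum>i. real b * g n (Suc i))"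
      using sm[of n] by (intro suminf_mult[symmetric]) (simp add: summable_Suc_iff)
    moreover have "real b * g n (Suc i) = g (Suc n) i" for i
      using b by (simp add: g_def)
    moreover have "real b * g n 0 = real (c (Suc n))" using b by (simp add: g_def)
    ultimately show ?thesis by (simp add: distrib_left t_def)
  qed
  have "\<exists>I::int. real b ^ n * x = real_of_int I + t n" for n
  proof (induction n)
    case 0
    have "x = t 0" using sums_unique[OF s] by (simp add: t_def g_def)
    then show ?case by (intro exI[of _ 0]) simp
  next
    case (Suc n)
    then obtain I :: int where "real b ^ n * x = real_of_int I + t n" by blast
    then have "real b ^ Suc n * x = real b * (real_of_int I + t n)" by (simp add: mult.assoc)
    also have "\<dots> = real_of_int (int b * I + int (c (Suc n))) + t (Suc n)"
      using trec[of n] by (simp add: distrib_left)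
    finally show ?case by blast
  qed
  then obtain I :: int where I: "real b ^ n * x = real_of_int I + t n" by blast
  have f0: "\<lfloor>real b ^ n * x\<rfloor> = I" using I t0[of n] t1[of n] by linarith
  have "real b ^ Suc n * x = real b * (real_of_int I + t n)" using I by (simp add: mult.assoc)
  also have "\<dots> = real_of_int (int b * I + int (c (Suc n))) + t (Suc n)"
    using trec[of n] by (simp add: distrib_left)
  finally have "\<lfloor>real b ^ Suc n * x\<rfloor> = int b * I + int (c (Suc n))"
    using t0[of "Suc n"] t1[of "Suc n"] by linarith
  with floor_Suc_rdigit[OF b, of n x] f0 show ?thesis by simp
qed

theorem rdigit_iff_expansion:
  assumes "b \<ge> 2" and "0 \<le> x" "x < 1"
  shows "(\<forall>a\<ge>1. c a = rdigit b x a) \<longleftrightarrow>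
    (\<forall>a\<ge>1. c a < b) \<and> \<not> (\<exists>A. \<forall>a\<ge>A. c a = b - 1) \<and>
    (\<lambda>a. real (c (Suc a)) / real b ^ Suc a) sums x" (is "?L \<longleftrightarrow> ?R")
proof
  assume L: ?L
  have "\<not> (\<forall>a\<ge>A. c a = b - 1)" for A
  proof
    assume "\<forall>a\<ge>A. c a = b - 1"
    then have "\<forall>a\<ge>max A 1. rdigit b x a = b - 1" using L by auto
    with rdigit_not_eventually[OF assms(1)] show False by blast
  qed
  then show ?R using L rdigit_less rdigit_sums assms by simp
next
  assume R: ?R
  show ?L
  proof (intro allI impI)
    fix a :: nat assume "1 \<le> a"
    then obtain n where "a = Suc n" by (cases a) auto
    then show "c a = rdigit b x a"
      using expansion_unique[OF assms(1), of c x n] R by simp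
  qed
qed

text \<open>
  The permutation attached to coordinate \<open>j\<close> and digit string \<open>as\<close> is \<open>p (j, as)\<close>.
  The resulting digit string may (with probability zero) be eventually \<open>b-1\<close>; the value below
  is then still the real number it represents.
\<close>

definition scramble ::
  "nat \<Rightarrow> nat \<Rightarrow> (nat \<times> nat list \<Rightarrow> nat \<Rightarrow> nat) \<Rightarrow> (nat \<Rightarrow> real) \<Rightarrow> nat \<Rightarrow> real" where
  "scramble b D p z = (\<lambda>j\<in>{1..D}. \<Sum>r.
     real (p (j, map (rdigit b (z j)) [1..<Suc r]) (rdigit b (z j) (Suc r))) / real b ^ Suc r)"

definition uniform_scrambling ::
  "'w measure \<Rightarrow> nat \<Rightarrow> nat \<Rightarrow> (nat \<times> nat list \<Rightarrow> 'w \<Rightarrow> nat \<Rightarrow> nat) \<Rightarrow> bool" where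
  "uniform_scrambling M b D \<pi> \<longleftrightarrow>
     prob_space M \<and>
     prob_space.indep_vars M (\<lambda>_. count_space {p. p permutes {..<b}}) \<pi>
       ({1..D} \<times> lists {..<b}) \<and>
     (\<forall>q\<in>{1..D} \<times> lists {..<b}.
        distr M (count_space {p. p permutes {..<b}}) (\<pi> q) =
        uniform_count_measure {p. p permutes {..<b}})"

definition interlace :: "nat \<Rightarrow> nat \<Rightarrow> nat \<Rightarrow> (nat \<Rightarrow> real) \<Rightarrow> nat \<Rightarrow> real" where
  "interlace b d s z = (\<lambda>i\<in>{1..s}. \<Sum>a. \<Sum>r=1..d.
     real (rdigit b (z ((i - 1) * d + r)) (Suc a)) / real b ^ (r + a * d))"

definition freq_interlace :: "nat \<Rightarrow> nat \<Rightarrow> nat \<Rightarrow> (nat \<Rightarrow> nat) \<Rightarrow> nat \<Rightarrow> nat" where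
  "freq_interlace b d s k = (\<lambda>i\<in>{1..s}. \<Sum>a. \<Sum>r=1..d.
     ndigit b (k ((i - 1) * d + r)) a * b ^ (r - 1 + a * d))"

text \<open>
  The completion admits every Lebesgue measurable representative of a class in \<open>L\<^sub>2\<close>. For such
  a representative \<open>f\<close>, the estimator need only be measurable with respect to the completion of
  the underlying probability space.
\<close>

definition cube :: "nat \<Rightarrow> (nat \<Rightarrow> real) measure" where
  "cube s = completion (\<Pi>\<^sub>M i\<in>{1..s}. restrict_space lborel {0..1})"

definition L2_cube :: "nat \<Rightarrow> ((nat \<Rightarrow> real) \<Rightarrow> complex) \<Rightarrow> bool" where
  "L2_cube s f \<longleftrightarrow>
     f \<in> borel_measurable (cube s) \<and> integrable (cube s) (\<lambda>x. (cmod (f x))\<^sup>2)"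

definition wal :: "nat \<Rightarrow> nat \<Rightarrow> real \<Rightarrow> complex" where
  "wal b k x =
     exp (2 * of_real pi * \<i> / of_nat b * (\<Sum>r. of_nat (ndigit b k r * rdigit b x (Suc r))))"

definition wal_vec :: "nat \<Rightarrow> nat \<Rightarrow> (nat \<Rightarrow> nat) \<Rightarrow> (nat \<Rightarrow> real) \<Rightarrow> complex" where
  "wal_vec b s k x = (\<Prod>j=1..s. wal b (k j) (x j))"

definition walsh_coeff ::
  "nat \<Rightarrow> nat \<Rightarrow> ((nat \<Rightarrow> real) \<Rightarrow> complex) \<Rightarrow> (nat \<Rightarrow> nat) \<Rightarrow> complex" where
  "walsh_coeff b s f h = (\<integral>x. f x * cnj (wal_vec b s h x) \<partial>cube s)"

definition block :: "nat \<Rightarrow> nat \<Rightarrow> nat set" where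
  "block b l = (if l = 0 then {0} else {b ^ (l - 1)..<b ^ l})"

definition sigma2 ::
  "nat \<Rightarrow> nat \<Rightarrow> nat \<Rightarrow> (nat \<Rightarrow> nat) \<Rightarrow> ((nat \<Rightarrow> real) \<Rightarrow> complex) \<Rightarrow> real" where
  "sigma2 b d s l f =
     (\<Sum>k\<in>(\<Pi>\<^sub>E j\<in>{1..d * s}. block b (l j)). (cmod (walsh_coeff b s f (freq_interlace b d s k)))\<^sup>2)"

definition chi :: "nat \<Rightarrow> nat \<Rightarrow> real \<Rightarrow> real \<Rightarrow> real" where
  "chi b l x x' = (if l = 0 then 1 else
     (real b * of_bool (\<lfloor>real b ^ l * x\<rfloor> = \<lfloor>real b ^ l * x'\<rfloor>)
       - of_bool (\<lfloor>real b ^ (l - 1) * x\<rfloor> = \<lfloor>real b ^ (l - 1) * x'\<rfloor>)) / (real b - 1))"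

definition Gam ::
  "nat \<Rightarrow> nat \<Rightarrow> nat \<Rightarrow> nat \<Rightarrow> (nat \<Rightarrow> nat \<Rightarrow> real) \<Rightarrow> (nat \<Rightarrow> nat) \<Rightarrow> real" where
  "Gam b d s N z l =
     (1 / (real N)\<^sup>2) * (\<Sum>n<N. \<Sum>n'<N. \<Prod>j=1..d * s. chi b (l j) (z n j) (z n' j))"

definition estimator ::
  "nat \<Rightarrow> nat \<Rightarrow> nat \<Rightarrow> nat \<Rightarrow> (nat \<Rightarrow> nat \<Rightarrow> real) \<Rightarrow> (nat \<times> nat list \<Rightarrow> 'w \<Rightarrow> nat \<Rightarrow> nat) \<Rightarrow>
   ((nat \<Rightarrow> real) \<Rightarrow> complex) \<Rightarrow> 'w \<Rightarrow> complex" where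
  "estimator b d s N z \<pi> f w =
     (1 / of_nat N) * (\<Sum>n<N. f (interlace b d s (scramble b (d * s) (\<lambda>q. \<pi> q w) (z n))))"

text \<open>The library's \<open>variance\<close> is restricted to real-valued random variables.\<close>

definition cvariance :: "'w measure \<Rightarrow> ('w \<Rightarrow> complex) \<Rightarrow> real" where
  "cvariance M X = (\<integral>w. (cmod (X w - (\<integral>w'. X w' \<partial>M)))\<^sup>2 \<partial>M)"

end

(* The digits of a scrambled point are the values of permutations attached to the digit strings of
   the original point. Two points share a permutation exactly as long as their digits agree, so by
   independence the expectation of a product of two Walsh functions at two scrambled and interlaced
   points is a product over all digits of means over one uniform permutation. It vanishes unless
   the two frequencies coincide, and then it is the product of the chi factors. In particular the
   interlaced scrambling of a single point is uniform on the cube, so f -> I_N(f) is a contraction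
   in mean square. Indicators of b-adic cells are Walsh polynomials, hence Walsh polynomials are
   dense in L2 and the diagonal second moment formula passes from them to every f. *)

theory Submission
  imports Defs
begin

subsection \<open>Base-\<open>b\<close> digits and Walsh functions\<close>

text \<open>Two nuisances shape the argument. A scrambled digit string may end in
  \<open>b - 1\<close> forever, and then the digits of the real number that it represents are not
  the scrambled ones. Independence is therefore exploited for the raw digits
  \<open>scrambled_digit\<close>, and \<open>AE_pt\<close> carries the result to points almost
  surely. Moreover \<open>f\<close> is only Lebesgue measurable, so \<open>f\<close> at a scrambled
  point need not be measurable on \<open>M\<close>. Since a scrambled point has exactly the law of
  the Borel cube, null sets pull back to null sets, and everything can be moved to completions. The
  interlacing disappears early: it moves the digits of points and of frequencies by the same
  bijection of positions, so a Walsh function of frequency \<open>freq_interlace b d s k\<close> is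
  a product over the \<open>d * s\<close> coordinates. The pair formula has two by-products. Equal
  points give orthonormality of the Walsh functions. A single Walsh function as integrand exhibits
  \<open>Gam\<close> as a mean square, hence as nonnegative, and this turns a limit along growing
  boxes of frequencies into an unconditional sum over block indices.\<close>

lemma ndigit_less: "b \<ge> 2 \<Longrightarrow> ndigit b k r < b"
  by (simp add: ndigit_def)

lemma ndigit_eq_0: "k < b ^ r \<Longrightarrow> ndigit b k r = 0"
  by (simp add: ndigit_def)

lemma ndigit_eq_0_ge: "k < b ^ K \<Longrightarrow> b \<ge> 2 \<Longrightarrow> K \<le> r \<Longrightarrow> ndigit b k r = 0"
  by (rule ndigit_eq_0, erule less_le_trans, rule power_increasing) auto

lemma ndigit_zero [simp]: "ndigit b 0 r = 0"
  by (simp add: ndigit_def)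

text \<open>The lower digits are unaffected because \<open>q * b ^ K\<close> contributes a multiple
  of \<open>b\<close> after division by \<open>b ^ r\<close> with \<open>r < K\<close>. This is the
  induction step of every argument that adds one leading digit.\<close>

lemma ndigit_add_mult_power:
  assumes "k < b ^ K" "q < b" "b \<ge> 2" "r \<le> K"
  shows "ndigit b (q * b ^ K + k) r = (if r = K then q else ndigit b k r)"
proof (cases "r = K")
  case True
  then show ?thesis using assms by (simp add: ndigit_def)
next
  case False
  define t where "t = K - Suc r"
  have K: "K = r + Suc t" using False assms by (simp add: t_def)
  have "(q * b ^ K + k) div b ^ r = q * b ^ Suc t + k div b ^ r"
    using assms div_mult_self3[of "b ^ r" "q * b ^ Suc t" k] by (simp add: K power_add mult_ac)
  then have "ndigit b (q * b ^ K + k) r = (q * b ^ t * b + k div b ^ r) mod b"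
    by (simp add: ndigit_def algebra_simps)
  then show ?thesis using False by (simp add: ndigit_def)
qed

lemma sum_digits_less:
  fixes b :: nat
  assumes "b \<ge> 2" "\<And>t. t < n \<Longrightarrow> c t < b"
  shows "(\<Sum>t<n. c t * b ^ t) < b ^ n"
  using assms(2)
proof (induction n)
  case (Suc n)
  have "(\<Sum>t<n. c t * b ^ t) < b ^ n" by (rule Suc.IH) (simp add: Suc.prems)
  moreover have "Suc (c n) * b ^ n \<le> b * b ^ n" using Suc.prems[of n] by (intro mult_right_mono) auto
  ultimately show ?case by simp
qed simp

lemma ndigit_sum:
  assumes b: "b \<ge> 2" and "\<And>t. t < n \<Longrightarrow> c t < b" and "u < n"
  shows "ndigit b (\<Sum>t<n. c t * b ^ t) u = c u"
  using assms(2,3)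
proof (induction n)
  case (Suc n)
  have less: "(\<Sum>t<n. c t * b ^ t) < b ^ n" using b Suc.prems by (intro sum_digits_less) auto
  have "(\<Sum>t<Suc n. c t * b ^ t) = c n * b ^ n + (\<Sum>t<n. c t * b ^ t)" by simp
  then show ?case
    using ndigit_add_mult_power[OF less, of "c n" u] Suc b by (cases "u = n") (auto simp: add.commute)
qed simp

lemma sum_ndigit: "b \<ge> 2 \<Longrightarrow> (\<Sum>r<K. ndigit b k r * b ^ r) = k mod b ^ K"
proof (induction K)
  case (Suc K)
  have "k mod b ^ Suc K = b ^ K * (k div b ^ K mod b) + k mod b ^ K"
    using mod_mult2_eq[of k "b ^ K" b] by (simp add: mult.commute)
  then show ?case using Suc by (simp add: ndigit_def)
qed simp

lemma eq_if_ndigits_eq: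
  assumes "b \<ge> 2" "k < b ^ K" "k' < b ^ K" "\<And>r. r < K \<Longrightarrow> ndigit b k r = ndigit b k' r"
  shows "k = k'"
proof -
  have "k mod b ^ K = k' mod b ^ K"
    unfolding sum_ndigit[OF assms(1), symmetric] using assms(4) by (intro sum.cong) auto
  then show ?thesis using assms by simp
qed

text \<open>Length of the base-\<open>b\<close> expansion without leading zeros, with length 0 for
  the number 0; it is the index of the block containing \<open>k\<close>.\<close>

definition nlen :: "nat \<Rightarrow> nat \<Rightarrow> nat" where
  "nlen b k = (LEAST l. k < b ^ l)"

lemma less_power_nlen: "b \<ge> 2 \<Longrightarrow> k < b ^ nlen b k"
  unfolding nlen_def by (rule LeastI[of _ k]) (simp add: power_gt_expt)

lemma nlen_le_iff: "b \<ge> 2 \<Longrightarrow> nlen b k \<le> l \<longleftrightarrow> k < b ^ l"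
proof
  assume "b \<ge> 2" "nlen b k \<le> l"
  then show "k < b ^ l"
    using less_le_trans[OF less_power_nlen[of b k] power_increasing[of "nlen b k" l b]] by simp
qed (simp add: nlen_def Least_le)

lemma block_iff_nlen: "b \<ge> 2 \<Longrightarrow> k \<in> block b l \<longleftrightarrow> nlen b k = l"
proof -
  assume b: "b \<ge> 2"
  have "nlen b k = l \<longleftrightarrow> nlen b k \<le> l \<and> (l = 0 \<or> \<not> nlen b k \<le> l - 1)" by linarith
  also have "\<dots> \<longleftrightarrow> k \<in> block b l" by (auto simp: nlen_le_iff[OF b] block_def)
  finally show ?thesis by simp
qed

lemma ndigit_top_nonzero:
  assumes "b \<ge> 2" "nlen b k = Suc l"
  shows "ndigit b k l \<noteq> 0"
proof -
  have "k < b ^ Suc l" "b ^ l \<le> k"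
    using assms nlen_le_iff[of b k "Suc l"] nlen_le_iff[of b k l] by auto
  then have "k div b ^ l < b" "k div b ^ l \<noteq> 0"
    using assms(1) by (auto simp: less_mult_imp_div_less mult.commute div_eq_0_iff)
  then show ?thesis by (simp add: ndigit_def)
qed

text \<open>By \<open>floor_Suc_rdigit\<close> each new floor is \<open>b\<close> times the previous
  one plus a digit, and division with remainder by \<open>b\<close> is unique. Points of [0,1) start
  from floor 0. The lemma translates between \<open>chi\<close>, which is stated with floors, and
  scrambling, which acts on digits.\<close>

lemma floor_eq_iff_rdigits:
  assumes b: "b \<ge> 2" and x: "x \<in> {0..<1}" "y \<in> {0..<1}"
  shows "\<lfloor>real b ^ n * x\<rfloor> = \<lfloor>real b ^ n * y\<rfloor> \<longleftrightarrow> (\<forall>r<n. rdigit b x (Suc r) = rdigit b y (Suc r))"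
proof (induction n)
  case 0
  have "\<lfloor>x\<rfloor> = 0" "\<lfloor>y\<rfloor> = 0" using x by (auto simp: floor_eq_iff)
  then show ?case by simp
next
  case (Suc n)
  have "int b * A + int u = int b * B + int v \<longleftrightarrow> A = B \<and> u = v" if "u < b" "v < b" for A B :: int and u v
  proof
    assume *: "int b * A + int u = int b * B + int v"
    from arg_cong[OF *, of "\<lambda>x. x div int b"] arg_cong[OF *, of "\<lambda>x. x mod int b"] that b
    show "A = B \<and> u = v" by simp
  qed simp
  then show ?case
    unfolding floor_Suc_rdigit[OF b] using Suc rdigit_less[OF b] by (auto simp: less_Suc_eq)
qed

lemma rdigit_one: "b \<ge> 2 \<Longrightarrow> rdigit b 1 (Suc n) = 0"
proof -
  have "\<lfloor>real b ^ Suc n\<rfloor> = int b ^ Suc n" by (metis floor_of_nat of_nat_power)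
  then show ?thesis by (simp add: rdigit_def)
qed

text \<open>Comparison with the string of constant digit \<open>b - 1\<close>, whose value is 1.
  That value is attained, so the upper bound cannot be strict for arbitrary strings.\<close>

lemma digit_series_bounds:
  assumes b: "b \<ge> 2" and c: "\<And>a. c a < b"
  shows "summable (\<lambda>a. real (c a) / real b ^ Suc a)"
    and "0 \<le> (\<Sum>a. real (c a) / real b ^ Suc a)" and "(\<Sum>a. real (c a) / real b ^ Suc a) \<le> 1"
proof -
  have geo: "(\<lambda>i. (real b - 1) / real b ^ Suc i) sums 1"
  proof -
    have "(\<lambda>i. ((real b - 1) / real b) * (1 / real b) ^ i) sums
        (((real b - 1) / real b) * (1 / (1 - 1 / real b)))"
      using b by (intro sums_mult geometric_sums) auto
    moreover have "((real b - 1) / real b) * (1 / (1 - 1 / real b)) = 1"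
      using b by (simp add: field_simps)
    ultimately have "(\<lambda>i. ((real b - 1) / real b) * (1 / real b) ^ i) sums 1" by (simp only:)
    then show ?thesis by (simp add: power_divide)
  qed
  have le: "real (c a) / real b ^ Suc a \<le> (real b - 1) / real b ^ Suc a" for a
    using c[of a] by (intro divide_right_mono) auto
  show sm: "summable (\<lambda>a. real (c a) / real b ^ Suc a)"
    by (rule summable_comparison_test'[OF sums_summable[OF geo], of 0]) (use le in auto)
  show "0 \<le> (\<Sum>a. real (c a) / real b ^ Suc a)"
    by (intro suminf_nonneg sm) auto
  show "(\<Sum>a. real (c a) / real b ^ Suc a) \<le> 1"
    using suminf_le[OF le sm sums_summable[OF geo]] sums_unique[OF geo] by simp
qed

lemma digit_series_rdigit:
  assumes b: "b \<ge> 2" and c: "\<And>a. c a < b" and ne: "\<not> (\<exists>A. \<forall>a\<ge>A. c a = b - 1)"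
  shows "rdigit b (\<Sum>a. real (c a) / real b ^ Suc a) (Suc n) = c n"
    and "(\<Sum>a. real (c a) / real b ^ Suc a) < 1"
proof -
  let ?x = "\<Sum>a. real (c a) / real b ^ Suc a"
  have dig: "rdigit b ?x (Suc n) = c n" for n
  proof -
    \<comment> \<open>Digits are counted from 0 here and from 1 in \<open>expansion_unique\<close>,
      hence the shifted string; its value at index 0 is irrelevant to the tail condition.\<close>
    have "\<not> (\<exists>A. \<forall>a\<ge>A. c (a - 1) = b - 1)"
    proof
      assume "\<exists>A. \<forall>a\<ge>A. c (a - 1) = b - 1"
      then obtain A where "\<And>a. a \<ge> A \<Longrightarrow> c (a - 1) = b - 1" by blast
      from this[of "Suc a" for a] ne show False by (metis diff_Suc_1 le_SucI)
    qed
    then show ?thesis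
      using expansion_unique[of b "\<lambda>a. c (a - 1)" ?x n] b c
        summable_sums[OF digit_series_bounds(1)[of b c]] by simp
  qed
  then show "rdigit b ?x (Suc n) = c n" .
  \<comment> \<open>The digit formula assigns only zeros to the number 1. A series with value 1
    would thus have all digits 0 and value 0.\<close>
  have "?x \<noteq> 1"
  proof
    assume *: "?x = 1"
    have "c n = 0" for n using dig[of n] rdigit_one[OF b, of n] * by simp
    then show False using * by simp
  qed
  then show "?x < 1" using digit_series_bounds(3)[of b c] b c by fastforce
qed

section \<open>Additive characters modulo \<open>b\<close>\<close>

definition chr :: "nat \<Rightarrow> nat \<Rightarrow> complex" where
  "chr b n = exp (2 * of_real pi * \<i> / of_nat b * of_nat n)"

lemma chr_0 [simp]: "chr b 0 = 1"
  by (simp add: chr_def)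

lemma chr_add: "chr b (m + n) = chr b m * chr b n"
  by (simp add: chr_def distrib_left exp_add)

lemma chr_sum: "chr b (\<Sum>i\<in>A. f i) = (\<Prod>i\<in>A. chr b (f i))"
  by (induction A rule: infinite_finite_induct) (simp_all add: chr_add)

lemma chr_mult: "chr b (m * n) = chr b n ^ m"
  by (induction m) (simp_all add: chr_add)

lemma norm_chr [simp]: "norm (chr b n) = 1"
  by (simp add: chr_def norm_exp_eq_Re)

lemma chr_mult_cnj: "chr b n * cnj (chr b n) = 1"
  by (metis complex_norm_square norm_chr of_real_1 power_one)

lemma chr_eq_1_iff: "b \<ge> 2 \<Longrightarrow> chr b n = 1 \<longleftrightarrow> b dvd n"
proof -
  assume b: "b \<ge> 2"
  have "chr b n = 1 \<longleftrightarrow> (\<exists>k::int. 2 * pi / real b * real n = of_int (2 * k) * pi)"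
    unfolding chr_def exp_eq_1 by (simp add: mult.assoc[symmetric])
  also have "\<dots> \<longleftrightarrow> (\<exists>k::int. real_of_int (int n) = real_of_int (k * int b))"
    using b by (intro ex_cong1) (simp add: field_simps)
  also have "\<dots> \<longleftrightarrow> (\<exists>k. int n = int b * k)" by (simp only: of_int_eq_iff mult.commute)
  also have "\<dots> \<longleftrightarrow> b dvd n" unfolding dvd_def[symmetric] by simp
  finally show ?thesis .
qed

lemma chr_power_base: "b \<ge> 2 \<Longrightarrow> chr b n ^ b = 1"
  using chr_mult[of b b n] chr_eq_1_iff[of b "b * n"] by simp

lemma chr_mod: "b \<ge> 2 \<Longrightarrow> chr b (n mod b) = chr b n"
  using chr_add[of b "n div b * b" "n mod b"] chr_eq_1_iff[of b "n div b * b"] by simp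

lemma chr_mult_cnj_eq_1_iff:
  assumes "b \<ge> 2" "m < b" "n < b"
  shows "chr b m * cnj (chr b n) = 1 \<longleftrightarrow> m = n"
proof -
  have *: "chr b m * cnj (chr b n) = 1 \<longleftrightarrow> chr b m = chr b n" for m n
    by (metis chr_mult_cnj mult.assoc mult.commute mult.right_neutral)
  have "chr b m = chr b n \<longleftrightarrow> m = n" if "m \<le> n" "n < b" for m n
  proof -
    have "chr b n = chr b m * chr b (n - m)" using that by (simp add: chr_add[symmetric])
    moreover have "chr b m \<noteq> 0" using norm_chr[of b m] norm_zero by (metis zero_neq_one)
    ultimately have "chr b m = chr b n \<longleftrightarrow> b dvd n - m" using chr_eq_1_iff[OF assms(1)] by auto
    then show ?thesis using that by (auto dest: dvd_imp_le)
  qed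
  from this[of m n] this[of n m] assms * show ?thesis by (cases "m \<le> n") auto
qed

text \<open>A geometric sum over powers of a \<open>b\<close>-th root of unity, which equals 1 only
  for \<open>y = c\<close>.\<close>

lemma sum_chr_eq_of_bool:
  assumes "b \<ge> 2" "y < b" "c < b"
  shows "(\<Sum>\<kappa><b. chr b (\<kappa> * y) * cnj (chr b (\<kappa> * c))) = of_nat b * of_bool (y = c)"
proof -
  let ?z = "chr b y * cnj (chr b c)"
  have "?z ^ b = 1"
    using assms chr_power_base[of b] by (simp add: power_mult_distrib complex_cnj_power[symmetric])
  moreover have "(\<Sum>\<kappa><b. chr b (\<kappa> * y) * cnj (chr b (\<kappa> * c))) = (\<Sum>\<kappa><b. ?z ^ \<kappa>)"
    by (simp add: chr_mult power_mult_distrib)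
  ultimately show ?thesis
    using chr_mult_cnj_eq_1_iff[OF assms] by (auto simp: sum_gp_strict)
qed

section \<open>Walsh functions and digit interlacing\<close>

lemma wal_eq_prod:
  assumes "b \<ge> 2" "k < b ^ K"
  shows "wal b k x = (\<Prod>r<K. chr b (ndigit b k r * rdigit b x (Suc r)))"
proof -
  have "(\<Sum>r. of_nat (ndigit b k r * rdigit b x (Suc r)) :: complex) =
      (\<Sum>r<K. of_nat (ndigit b k r * rdigit b x (Suc r)))"
    using assms by (intro suminf_finite) (auto simp: ndigit_eq_0_ge not_less)
  then show ?thesis unfolding wal_def chr_sum[symmetric] by (simp add: chr_def)
qed

text \<open>
  Coordinate \<open>j\<close> of a point of the \<open>ds\<close>-dimensional cube occupies the positions
  \<open>(j - 1) mod d + r * d\<close> (counted from 0) in the digits of coordinate \<open>(j - 1) div d + 1\<close> of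
  its interlacing.
\<close>

definition dgt :: "nat \<Rightarrow> nat \<Rightarrow> (nat \<Rightarrow> real) \<Rightarrow> nat \<Rightarrow> nat \<Rightarrow> nat" where
  "dgt b d x j r = rdigit b (x ((j - 1) div d + 1)) (Suc ((j - 1) mod d + r * d))"

lemma interlaced_index:
  fixes j d s :: nat
  assumes "d \<ge> 1" "j \<in> {1..d * s}"
  shows "(j - 1) div d + 1 \<in> {1..s}" "((j - 1) div d + 1 - 1) * d + ((j - 1) mod d + 1) = j"
proof -
  have "j - 1 < s * d" using assms by (auto simp: mult.commute)
  then have "(j - 1) div d < s" by (simp add: less_mult_imp_div_less)
  then show "(j - 1) div d + 1 \<in> {1..s}" by simp
  show "((j - 1) div d + 1 - 1) * d + ((j - 1) mod d + 1) = j" using assms by simp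
qed

text \<open>Together with \<open>interlaced_index\<close> this says that the position maps are
  mutually inverse: digit \<open>r\<close> of input coordinate \<open>j\<close> corresponds to digit
  \<open>t\<close> of output coordinate \<open>i\<close>, where \<open>t mod d\<close> selects the
  input within its group and \<open>t div d\<close> is its digit. Input coordinates start at 1 and
  digits at 0, which accounts for the shifts by one.\<close>

lemma deinterlaced_index:
  fixes i t d s K :: nat
  assumes d: "d \<ge> 1" and i: "i \<in> {1..s}" and t: "t < d * K"
  defines "j \<equiv> (i - 1) * d + t mod d + 1"
  shows "j \<in> {1..d * s}" "t div d < K" "(j - 1) div d + 1 = i" "(j - 1) mod d + t div d * d = t"
proof -
  have *: "t mod d < d" using d by simp
  have "(i - 1) * d + d = i * d" using i by (cases i) auto
  also have "\<dots> \<le> d * s" using i by (simp add: mult.commute)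
  finally have "(i - 1) * d + d \<le> d * s" .
  with * show "j \<in> {1..d * s}" unfolding j_def by simp
  show "t div d < K" using t by (simp add: less_mult_imp_div_less mult.commute)
  show "(j - 1) div d + 1 = i" "(j - 1) mod d + t div d * d = t"
    unfolding j_def using i * by simp_all
qed

text \<open>Reindexing along the bijection of digit positions that underlies both
  \<open>interlace\<close> and \<open>freq_interlace\<close>. Truncation to \<open>K\<close> digits
  of every input matches truncation to \<open>d * K\<close> digits of every output.\<close>

lemma prod_interlaced:
  fixes F :: "nat \<Rightarrow> nat \<Rightarrow> 'c::comm_monoid_mult"
  assumes d: "d \<ge> 1"
  shows "(\<Prod>i=1..s. \<Prod>t<d * K. F i t) =
    (\<Prod>j=1..d * s. \<Prod>r<K. F ((j - 1) div d + 1) ((j - 1) mod d + r * d))"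
  unfolding prod.cartesian_product
proof (rule prod.reindex_bij_witness[of _ "\<lambda>(j, r). ((j - 1) div d + 1, (j - 1) mod d + r * d)"
      "\<lambda>(i, t). ((i - 1) * d + t mod d + 1, t div d)"], goal_cases)
  case (1 a)
  then show ?case using deinterlaced_index[OF d] by (cases a) auto
next
  case (2 a)
  then show ?case using deinterlaced_index(1,2)[OF d, of "fst a" s "snd a" K] by (cases a) auto
next
  case (3 a)
  then show ?case using interlaced_index[OF d, of "fst a" s] d by (cases a) auto
next
  case (4 a)
  obtain j r where a: "a = (j, r)" by (cases a)
  have "(j - 1) mod d + r * d < Suc r * d" using d by simp
  also have "\<dots> \<le> K * d" using 4 a by (intro mult_right_mono) auto
  finally show ?case using 4 a interlaced_index(1)[OF d, of j s] by (auto simp: mult.commute)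
next
  case (5 a)
  then show ?case using deinterlaced_index(3,4)[OF d] by (cases a) auto
qed

lemma prod_of_bool_eq:
  "finite A \<Longrightarrow> (\<Prod>x\<in>A. of_bool (P x) :: 'a::comm_semiring_1) = of_bool (\<forall>x\<in>A. P x)"
  by (induction A rule: finite_induct) auto

text \<open>A conjunction is a product of 0/1 values, so the reindexing of products applies and need
  not be repeated.\<close>

lemma all_interlaced:
  fixes F :: "nat \<Rightarrow> nat \<Rightarrow> bool"
  assumes d: "d \<ge> 1"
  shows "(\<forall>i\<in>{1..s}. \<forall>t<d * K. F i t) \<longleftrightarrow>
    (\<forall>j\<in>{1..d * s}. \<forall>r<K. F ((j - 1) div d + 1) ((j - 1) mod d + r * d))"
proof -
  have *: "(\<Prod>i\<in>A. \<Prod>t<n. of_bool (G i t) :: nat) = 1 \<longleftrightarrow> (\<forall>i\<in>A. \<forall>t<n. G i t)" if "finite A" for A :: "nat set" and n :: nat and G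
  proof -
    have "(\<Prod>i\<in>A. \<Prod>t<n. of_bool (G i t) :: nat) = of_bool (\<forall>i\<in>A. \<forall>t<n. G i t)"
      by (simp only: prod_of_bool_eq[OF that] prod_of_bool_eq[OF finite_lessThan] Ball_def lessThan_iff)
    then show ?thesis by simp
  qed
  show ?thesis using prod_interlaced[OF d, of "\<lambda>i t. of_bool (F i t) :: nat" K s]
    by (simp only: *[symmetric] finite_atLeastAtMost)
qed

lemma freq_interlace_eq:
  assumes b: "b \<ge> 2" and d: "d \<ge> 1" and k: "\<forall>j\<in>{1..d * s}. k j < b ^ K" and i: "i \<in> {1..s}"
  shows "freq_interlace b d s k i = (\<Sum>t<d * K. ndigit b (k ((i - 1) * d + t mod d + 1)) (t div d) * b ^ t)"
proof -
  have "freq_interlace b d s k i =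
    (\<Sum>a. \<Sum>r=1..d. ndigit b (k ((i - 1) * d + r)) a * b ^ (r - 1 + a * d))"
    using i by (simp add: freq_interlace_def)
  also have "\<dots> = (\<Sum>a<K. \<Sum>r=1..d. ndigit b (k ((i - 1) * d + r)) a * b ^ (r - 1 + a * d))"
  proof (rule suminf_finite)
    fix a assume "a \<notin> {..<K}"
    moreover have "(i - 1) * d + r \<in> {1..d * s}" if "r \<in> {1..d}" for r
      using deinterlaced_index(1)[OF d i, of "r - 1" 1] that d by (cases r) auto
    ultimately show "(\<Sum>r=1..d. ndigit b (k ((i - 1) * d + r)) a * b ^ (r - 1 + a * d)) = 0"
      using ndigit_eq_0_ge[of _ b K a] k b by (intro sum.neutral) auto
  qed simp
  \<comment> \<open>Digit \<open>a\<close> of the \<open>d\<close> inputs fills the consecutive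
    positions from \<open>a * d\<close> to \<open>a * d + d - 1\<close>. The double sum thus becomes
    one base-\<open>b\<close> expansion, from which \<open>ndigit_sum\<close> reads off
    digits.\<close>
  also have "\<dots> = (\<Sum>a<K. \<Sum>t\<in>{a * d..<a * d + d}. ndigit b (k ((i - 1) * d + t mod d + 1)) (t div d) * b ^ t)"
  proof (rule sum.cong[OF refl])
    fix a
    show "(\<Sum>r=1..d. ndigit b (k ((i - 1) * d + r)) a * b ^ (r - 1 + a * d)) =
      (\<Sum>t\<in>{a * d..<a * d + d}. ndigit b (k ((i - 1) * d + t mod d + 1)) (t div d) * b ^ t)"
    proof (rule sum.reindex_bij_witness[of _ "\<lambda>t. t - a * d + 1" "\<lambda>r. r - 1 + a * d"], goal_cases)
      case (5 r)
      then have "r - 1 < d" by auto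
      then have "(r - 1 + a * d) div d = a" "(r - 1 + a * d) mod d = r - 1" by simp_all
      then show ?case using 5 by (simp only:) simp
    qed auto
  qed
  also have "\<dots> = (\<Sum>t<d * K. ndigit b (k ((i - 1) * d + t mod d + 1)) (t div d) * b ^ t)"
    unfolding sum.nat_group by (simp add: mult.commute)
  finally show ?thesis .
qed

text \<open>Points and frequencies are interlaced by the same position map, so every frequency digit
  still meets its own point digit. The Walsh function therefore factors over the coordinates before
  interlacing.\<close>

lemma wal_vec_freq_interlace:
  assumes b: "b \<ge> 2" and d: "d \<ge> 1" and k: "\<forall>j\<in>{1..d * s}. k j < b ^ K"
  shows "wal_vec b s (freq_interlace b d s k) x =
    (\<Prod>j=1..d * s. \<Prod>r<K. chr b (ndigit b (k j) r * dgt b d x j r))"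
proof -
  have less: "freq_interlace b d s k i < b ^ (d * K)" if "i \<in> {1..s}" for i
    unfolding freq_interlace_eq[OF b d k that] by (intro sum_digits_less ndigit_less b)
  have "wal_vec b s (freq_interlace b d s k) x =
    (\<Prod>i=1..s. \<Prod>t<d * K. chr b (ndigit b (freq_interlace b d s k i) t * rdigit b (x i) (Suc t)))"
    unfolding wal_vec_def by (intro prod.cong refl wal_eq_prod b less)
  also have "\<dots> = (\<Prod>i=1..s. \<Prod>t<d * K. chr b (ndigit b (k ((i - 1) * d + t mod d + 1)) (t div d) *
      rdigit b (x i) (Suc t)))"
    by (intro prod.cong refl, subst freq_interlace_eq[OF b d k])
       (simp_all add: ndigit_sum[OF b] ndigit_less[OF b])
  also have "\<dots> = (\<Prod>j=1..d * s. \<Prod>r<K. chr b (ndigit b (k j) r * dgt b d x j r))"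
    unfolding prod_interlaced[OF d] using d by (intro prod.cong refl) (simp add: dgt_def)
  finally show ?thesis .
qed

text \<open>The resolution \<open>b ^ (d * K)\<close> is chosen so that a cell fixes precisely the
  first \<open>K\<close> digits of each of the \<open>d * s\<close> coordinates before
  interlacing.\<close>

lemma floors_eq_iff_dgt:
  assumes b: "b \<ge> 2" and d: "d \<ge> 1"
    and x: "\<And>i. i \<in> {1..s} \<Longrightarrow> x i \<in> {0..<1}" and y: "\<And>i. i \<in> {1..s} \<Longrightarrow> y i \<in> {0..<1}"
  shows "(\<forall>i\<in>{1..s}. \<lfloor>real b ^ (d * K) * x i\<rfloor> = \<lfloor>real b ^ (d * K) * y i\<rfloor>) \<longleftrightarrow>
    (\<forall>j\<in>{1..d * s}. \<forall>r<K. dgt b d x j r = dgt b d y j r)"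
proof -
  have "(\<forall>i\<in>{1..s}. \<lfloor>real b ^ (d * K) * x i\<rfloor> = \<lfloor>real b ^ (d * K) * y i\<rfloor>) \<longleftrightarrow>
    (\<forall>i\<in>{1..s}. \<forall>t<d * K. rdigit b (x i) (Suc t) = rdigit b (y i) (Suc t))"
    using x y floor_eq_iff_rdigits[OF b] by (intro ball_cong refl) blast
  then show ?thesis unfolding all_interlaced[OF d] dgt_def .
qed

text \<open>Orthogonality of characters expands the condition on one digit. Multiplying over digits
  amounts to summing over all frequencies with \<open>K\<close> digits; the induction splits these
  according to their leading digit \<kappa>. This is the source of the Walsh expansion of a
  cell.\<close>

lemma prod_of_bool_eq_sum_chr:
  assumes b: "b \<ge> 2" and x: "\<And>r. x r < b" and c: "\<And>r. c r < b"
  shows "(\<Prod>r<K. of_bool (x r = c r) :: complex) =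
    (\<Sum>k<b ^ K. (1 / of_nat b) ^ K * (\<Prod>r<K. cnj (chr b (ndigit b k r * c r))) *
       (\<Prod>r<K. chr b (ndigit b k r * x r)))"
proof (induction K)
  case (Suc K)
  let ?f = "\<lambda>r \<kappa>. chr b (\<kappa> * x r) * cnj (chr b (\<kappa> * c r))"
  have "(\<Sum>k<b ^ Suc K. (1 / of_nat b) ^ Suc K * (\<Prod>r<Suc K. ?f r (ndigit b k r))) =
    (\<Sum>\<kappa><b. \<Sum>k\<in>{\<kappa> * b ^ K..<\<kappa> * b ^ K + b ^ K}. (1 / of_nat b) ^ Suc K * (\<Prod>r<Suc K. ?f r (ndigit b k r)))"
    unfolding sum.nat_group by simp
  also have "\<dots> = (\<Sum>\<kappa><b. \<Sum>k<b ^ K. (1 / of_nat b * ?f K \<kappa>) * ((1 / of_nat b) ^ K * (\<Prod>r<K. ?f r (ndigit b k r))))"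
  proof (rule sum.cong[OF refl])
    fix \<kappa> assume \<kappa>: "\<kappa> \<in> {..<b}"
    show "(\<Sum>k\<in>{\<kappa> * b ^ K..<\<kappa> * b ^ K + b ^ K}. (1 / of_nat b) ^ Suc K * (\<Prod>r<Suc K. ?f r (ndigit b k r))) =
      (\<Sum>k<b ^ K. (1 / of_nat b * ?f K \<kappa>) * ((1 / of_nat b) ^ K * (\<Prod>r<K. ?f r (ndigit b k r))))"
    proof (rule sum.reindex_bij_witness[of _ "\<lambda>k. \<kappa> * b ^ K + k" "\<lambda>k. k - \<kappa> * b ^ K"], goal_cases)
      case (5 k)
      define k' where "k' = k - \<kappa> * b ^ K"
      have k: "k = \<kappa> * b ^ K + k'" "k' < b ^ K" using 5 by (auto simp: k'_def)
      have "ndigit b k r = (if r = K then \<kappa> else ndigit b k' r)" if "r \<le> K" for r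
        unfolding k(1) using \<kappa> b that by (intro ndigit_add_mult_power k) auto
      then show ?case unfolding k'_def[symmetric] by simp
    qed auto
  qed
  also have "\<dots> = (1 / of_nat b * (\<Sum>\<kappa><b. ?f K \<kappa>)) * (\<Sum>k<b ^ K. (1 / of_nat b) ^ K * (\<Prod>r<K. ?f r (ndigit b k r)))"
    unfolding sum_distrib_left sum_distrib_right by (subst sum.swap) (simp add: mult.assoc)
  also have "\<dots> = of_bool (x K = c K) * (\<Prod>r<K. of_bool (x r = c r))"
    using b by (simp add: Suc sum_chr_eq_of_bool x c prod.distrib mult_ac)
  finally show ?case by (simp add: prod.distrib mult_ac)
qed simp

subsection \<open>Uniform random permutations\<close>

definition perm_mean :: "nat \<Rightarrow> ((nat \<Rightarrow> nat) \<Rightarrow> complex) \<Rightarrow> complex" where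
  "perm_mean b F = (\<Sum>p | p permutes {..<b}. F p) / of_nat (card {p. p permutes {..<b}})"

lemma card_perms_neq_0: "card {p. p permutes {..<b::nat}} \<noteq> 0"
  by (simp add: card_permutations)

lemma perm_mean_const [simp]: "perm_mean b (\<lambda>p. c) = c"
  using card_perms_neq_0[of b] by (simp add: perm_mean_def)

lemma perm_mean_cong: "(\<And>p. p permutes {..<b} \<Longrightarrow> F p = G p) \<Longrightarrow> perm_mean b F = perm_mean b G"
  unfolding perm_mean_def by (intro arg_cong2[of _ _ _ _ "(/)"] sum.cong) auto

lemma perm_mean_mult_left: "perm_mean b (\<lambda>p. c * F p) = c * perm_mean b F"
  by (simp add: perm_mean_def sum_distrib_left)

lemma perm_mean_sum: "perm_mean b (\<lambda>p. \<Sum>i\<in>I. F i p) = (\<Sum>i\<in>I. perm_mean b (F i))"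
  unfolding perm_mean_def by (subst sum.swap) (simp add: sum_divide_distrib)

lemma perm_mean_comp_left: "\<tau> permutes {..<b} \<Longrightarrow> perm_mean b (\<lambda>p. F (\<tau> \<circ> p)) = perm_mean b F"
  unfolding perm_mean_def by (subst setum_permutations_compose_left[of \<tau>]) auto

lemma perm_mean_comp_right: "\<tau> permutes {..<b} \<Longrightarrow> perm_mean b (\<lambda>p. F (p \<circ> \<tau>)) = perm_mean b F"
  unfolding perm_mean_def by (subst (2) sum_permutations_compose_right[of \<tau>]) auto

text \<open>The cyclic shift has to fix everything from \<open>b\<close> on, since
  \<open>permutes\<close> speaks of functions on all natural numbers.\<close>

lemma permutes_shift: "(\<lambda>y. if y < b then (y + 1) mod b else y) permutes {..<b::nat}"
proof (rule bij_imp_permutes)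
  have "inj_on (\<lambda>y. (y + 1) mod b) {..<b}"
  proof (rule inj_onI)
    fix x y assume "x \<in> {..<b}" "y \<in> {..<b}" "(x + 1) mod b = (y + 1) mod b"
    then show "x = y" by (cases "x + 1 = b"; cases "y + 1 = b") auto
  qed
  then have inj: "inj_on (\<lambda>y. if y < b then (y + 1) mod b else y) {..<b}"
    by (rule inj_on_cong[THEN iffD1, rotated]) simp
  then show "bij_betw (\<lambda>y. if y < b then (y + 1) mod b else y) {..<b} {..<b}"
    by (intro bij_betw_imageI endo_inj_surj) auto
qed auto

lemma permutes_less: "p permutes {..<b::nat} \<Longrightarrow> x < b \<Longrightarrow> p x < b"
  using permutes_in_image[of p "{..<b}" x] by simp

text \<open>Post-composing with a cyclic shift multiplies the mean by a root of unity.\<close>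

lemma perm_mean_chr_neq:
  assumes b: "b \<ge> 2" and "x < b" "x' < b" "\<kappa> < b" "\<kappa>' < b" "\<kappa> \<noteq> \<kappa>'"
  shows "perm_mean b (\<lambda>p. chr b (\<kappa> * p x) * cnj (chr b (\<kappa>' * p x'))) = 0"
proof -
  let ?\<tau> = "\<lambda>y. if y < b then (y + 1) mod b else y"
  let ?F = "\<lambda>p :: nat \<Rightarrow> nat. chr b (\<kappa> * p x) * cnj (chr b (\<kappa>' * p x'))"
  let ?c = "chr b \<kappa> * cnj (chr b \<kappa>')"
  have shift: "chr b (q * (Suc y mod b)) = chr b q * chr b (q * y)" for q y
    unfolding chr_mult chr_mod[OF b] using chr_add[of b 1 y]
    by (simp add: power_mult_distrib chr_mult[of b q 1, simplified])
  have "perm_mean b ?F = perm_mean b (\<lambda>p. ?F (?\<tau> \<circ> p))"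
    by (rule perm_mean_comp_left[OF permutes_shift, symmetric])
  also have "\<dots> = perm_mean b (\<lambda>p. ?c * ?F p)"
    using assms by (intro perm_mean_cong) (simp add: permutes_less shift)
  also have "\<dots> = ?c * perm_mean b ?F" by (rule perm_mean_mult_left)
  finally show ?thesis using chr_mult_cnj_eq_1_iff[OF b] assms by simp
qed

lemma perm_mean_chr:
  assumes b: "b \<ge> 2" and x: "x < b" and \<kappa>: "\<kappa> < b"
  shows "perm_mean b (\<lambda>p. chr b (\<kappa> * p x)) = of_bool (\<kappa> = 0)"
    and "perm_mean b (\<lambda>p. cnj (chr b (\<kappa> * p x))) = of_bool (\<kappa> = 0)"
  using perm_mean_chr_neq[OF b x x \<kappa>, of 0] perm_mean_chr_neq[OF b x x _ \<kappa>, of 0] b by auto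

text \<open>For equal nonzero frequencies and \<open>x \<noteq> x'\<close>, composing with a
  transposition shows that the mean \<open>G y\<close> is the same for all
  \<open>y \<noteq> x\<close>. The sum of \<open>G y\<close> over all \<open>y\<close> vanishes
  because a permutation only rearranges a vanishing character sum. As \<open>G x = 1\<close>, the
  other \<open>b - 1\<close> values share the total -1.\<close>

lemma perm_mean_chr_pair:
  assumes b: "b \<ge> 2" and x: "x < b" "x' < b" and \<kappa>: "\<kappa> < b" "\<kappa>' < b"
  shows "perm_mean b (\<lambda>p. chr b (\<kappa> * p x) * cnj (chr b (\<kappa>' * p x'))) =
    (if \<kappa> \<noteq> \<kappa>' then 0 else if \<kappa> = 0 \<or> x = x' then 1 else - 1 / (of_nat b - 1))"
proof -
  define G where "G y = perm_mean b (\<lambda>p. chr b (\<kappa> * p x) * cnj (chr b (\<kappa> * p y)))" for y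
  have "G x' = - 1 / (of_nat b - 1)" if "\<kappa> \<noteq> 0" "x \<noteq> x'"
  proof -
    have G_eq: "G y = G x'" if y: "y < b" "y \<noteq> x" for y
    proof -
      have "Transposition.transpose x' y permutes {..<b}" using x y by (intro permutes_swap_id) auto
      from perm_mean_comp_right[OF this, of "\<lambda>p. chr b (\<kappa> * p x) * cnj (chr b (\<kappa> * p y))"]
      show ?thesis using \<open>x \<noteq> x'\<close> y by (simp add: G_def)
    qed
    have "(\<Sum>y<b. G y) = perm_mean b (\<lambda>p. chr b (\<kappa> * p x) * cnj (\<Sum>y<b. chr b (\<kappa> * p y)))"
      by (simp add: G_def perm_mean_sum sum_distrib_left)
    also have "\<dots> = perm_mean b (\<lambda>p. 0)"
    proof (rule perm_mean_cong)
      fix p assume "p permutes {..<b}"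
      then have "(\<Sum>y<b. chr b (\<kappa> * p y)) = (\<Sum>y<b. chr b (\<kappa> * y))"
        using sum.permute[of p "{..<b}" "\<lambda>y. chr b (\<kappa> * y)"] by simp
      also have "\<dots> = 0"
        using sum_chr_eq_of_bool[OF b \<kappa>(1), of 0] that b by (simp add: mult.commute)
      finally show "chr b (\<kappa> * p x) * cnj (\<Sum>y<b. chr b (\<kappa> * p y)) = 0" by simp
    qed
    finally have "(\<Sum>y<b. G y) = 0" by simp
    also have "(\<Sum>y<b. G y) = G x + (\<Sum>y\<in>{..<b} - {x}. G y)"
      using x by (intro sum.remove) auto
    also have "(\<Sum>y\<in>{..<b} - {x}. G y) = (\<Sum>y\<in>{..<b} - {x}. G x')" using G_eq by (intro sum.cong) auto
    also have "\<dots> = (of_nat b - 1) * G x'" using x b by (simp add: of_nat_diff)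
    also have "G x = 1" by (simp add: G_def chr_mult_cnj)
    finally have "1 + (of_nat b - 1) * G x' = 0" .
    moreover have "of_nat b - (1::complex) \<noteq> 0" using b by auto
    ultimately show ?thesis by (simp add: field_simps add_eq_0_iff)
  qed
  then show ?thesis using perm_mean_chr_neq[OF assms] by (auto simp: G_def chr_mult_cnj)
qed

text \<open>The indicator is expanded into characters, and only the trivial one has nonzero
  mean.\<close>

lemma perm_mean_of_bool:
  assumes b: "b \<ge> 2" and x: "x < b" and c: "c < b"
  shows "perm_mean b (\<lambda>p. of_bool (p x = c)) = 1 / of_nat b"
proof -
  have "perm_mean b (\<lambda>p. of_bool (p x = c)) =
      perm_mean b (\<lambda>p. 1 / of_nat b * (\<Sum>\<kappa><b. cnj (chr b (\<kappa> * c)) * chr b (\<kappa> * p x)))"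
  proof (rule perm_mean_cong)
    fix p assume p: "p permutes {..<b}"
    have "(\<Sum>\<kappa><b. cnj (chr b (\<kappa> * c)) * chr b (\<kappa> * p x)) = of_nat b * of_bool (p x = c)"
      using sum_chr_eq_of_bool[OF b permutes_less[OF p x] c] by (simp only: mult.commute)
    then show "of_bool (p x = c) = 1 / of_nat b * (\<Sum>\<kappa><b. cnj (chr b (\<kappa> * c)) * chr b (\<kappa> * p x))"
      using b by simp
  qed
  also have "\<dots> = 1 / of_nat b * (\<Sum>\<kappa><b. cnj (chr b (\<kappa> * c)) * of_bool (\<kappa> = 0))"
    unfolding perm_mean_mult_left perm_mean_sum using b x by (simp add: perm_mean_chr)
  also have "\<dots> = 1 / of_nat b" using b by (simp add: of_bool_def if_distrib sum.delta cong: if_cong)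
  finally show ?thesis .
qed

text \<open>The first \<open>r\<close> digits: the label of the permutation that acts on digit
  \<open>r + 1\<close>.\<close>

definition digit_prefix :: "nat \<Rightarrow> real \<Rightarrow> nat \<Rightarrow> nat list" where
  "digit_prefix b x r = map (rdigit b x) [1..<Suc r]"

lemma length_prefix [simp]: "length (digit_prefix b x r) = r"
  by (simp add: digit_prefix_def)

lemma set_prefix: "b \<ge> 2 \<Longrightarrow> set (digit_prefix b x r) \<subseteq> {..<b}"
  by (auto simp: digit_prefix_def rdigit_less)

lemma prefix_eq_iff: "digit_prefix b x r = digit_prefix b y r \<longleftrightarrow> (\<forall>t<r. rdigit b x (Suc t) = rdigit b y (Suc t))"
proof -
  have "digit_prefix b x r = digit_prefix b y r \<longleftrightarrow> (\<forall>u\<in>{1..<Suc r}. rdigit b x u = rdigit b y u)"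
    by (simp add: digit_prefix_def del: upt_Suc)
  also have "{1..<Suc r} = Suc ` {..<r}" by (simp add: lessThan_atLeast0)
  finally show ?thesis by auto
qed

text \<open>Frequencies that differ in a digit produce a zero factor, whether or not the permutation
  is shared there. For \<open>k = k'\<close> the leading digit, at position \<open>m\<close>,
  decides: factors above it are 1; if the two points separate before \<open>m\<close> the factor at
  \<open>m\<close> is 0; otherwise all lower factors are 1 and the factor at \<open>m\<close> is 1
  or \<open>- 1 / (b - 1)\<close>. These are the three values of \<open>chi\<close>, so only the
  length of \<open>k\<close> matters.\<close>

lemma prod_perm_mean_eq_chi:
  assumes b: "b \<ge> 2" and x: "x \<in> {0..<1}" "x' \<in> {0..<1}" and k: "k < b ^ K" "k' < b ^ K"
  shows "(\<Prod>r<K. if digit_prefix b x r = digit_prefix b x' r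
      then perm_mean b (\<lambda>p. chr b (ndigit b k r * p (rdigit b x (Suc r))) *
        cnj (chr b (ndigit b k' r * p (rdigit b x' (Suc r)))))
      else perm_mean b (\<lambda>p. chr b (ndigit b k r * p (rdigit b x (Suc r)))) *
        perm_mean b (\<lambda>p. cnj (chr b (ndigit b k' r * p (rdigit b x' (Suc r)))))) =
    of_bool (k = k') * of_real (chi b (nlen b k) x x')" (is "(\<Prod>r<K. ?f r) = _")
proof -
  have f: "?f r = (if ndigit b k r \<noteq> ndigit b k' r then 0 else if ndigit b k r = 0 then 1
      else if digit_prefix b x r \<noteq> digit_prefix b x' r then 0
      else if rdigit b x (Suc r) = rdigit b x' (Suc r) then 1 else - 1 / (of_nat b - 1))" for r
    using b by (auto simp: perm_mean_chr_pair perm_mean_chr rdigit_less ndigit_less)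
  show ?thesis
  proof (cases "k = k'")
    case False
    then obtain r where "r < K" "ndigit b k r \<noteq> ndigit b k' r"
      using eq_if_ndigits_eq[OF b k] by blast
    then have "\<exists>r\<in>{..<K}. ?f r = 0" unfolding f by (intro bexI[of _ r]) auto
    then have "(\<Prod>r<K. ?f r) = 0" by (intro prod_zero) auto
    then show ?thesis using False by simp
  next
    case True
    show ?thesis
    proof (cases "nlen b k")
      case 0
      then have "k = 0" using less_power_nlen[OF b, of k] by simp
      then show ?thesis unfolding f using True 0 by (simp add: chi_def)
    next
      case (Suc m)
      have m: "m < K" using Suc nlen_le_iff[OF b, of k K] k by auto
      have top: "ndigit b k m \<noteq> 0" by (rule ndigit_top_nonzero[OF b Suc])
      have above: "ndigit b k r = 0" if "m < r" for r
        using ndigit_eq_0_ge[OF _ b, of k "Suc m" r] less_power_nlen[OF b, of k] Suc that by simp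
      have floor: "\<lfloor>real b ^ n * x\<rfloor> = \<lfloor>real b ^ n * x'\<rfloor> \<longleftrightarrow> digit_prefix b x n = digit_prefix b x' n" for n
        unfolding prefix_eq_iff using floor_eq_iff_rdigits[OF b x] .
      have Suc_prefix: "digit_prefix b x (Suc m) = digit_prefix b x' (Suc m) \<longleftrightarrow>
          digit_prefix b x m = digit_prefix b x' m \<and> rdigit b x (Suc m) = rdigit b x' (Suc m)"
        by (auto simp: prefix_eq_iff less_Suc_eq)
      \<comment> \<open>The numerator of \<open>chi\<close> is \<open>b - 1\<close>,
        \<open>-1\<close> or \<open>0\<close>, according to whether the points agree in
        \<open>Suc m\<close> digits, in exactly \<open>m\<close>, or separate earlier.\<close>
      have chi: "chi b (nlen b k) x x' = (if digit_prefix b x m \<noteq> digit_prefix b x' m then 0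
          else if rdigit b x (Suc m) = rdigit b x' (Suc m) then 1 else - 1 / (real b - 1))"
        using b unfolding Suc chi_def floor diff_Suc_1 Suc_prefix by auto
      show ?thesis
      proof (cases "digit_prefix b x m = digit_prefix b x' m")
        case False
        then have "?f m = 0" unfolding f using top by simp
        then have "(\<Prod>r<K. ?f r) = 0" using m by (intro prod_zero bexI[of _ m]) auto
        then show ?thesis using False chi by simp
      next
        case eq: True
        have "?f r = (if r = m then ?f m else 1)" for r
        proof (cases "r < m")
          case True
          then have "digit_prefix b x r = digit_prefix b x' r" "rdigit b x (Suc r) = rdigit b x' (Suc r)"
            using eq by (auto simp: prefix_eq_iff)
          then show ?thesis unfolding f using \<open>k = k'\<close> True by simp
        next
          case False
          then show ?thesis using above[of r] \<open>k = k'\<close> unfolding f by (cases "r = m") auto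
        qed
        then have "(\<Prod>r<K. ?f r) = (\<Prod>r<K. if r = m then ?f m else 1)" by (intro prod.cong refl)
        also have "\<dots> = ?f m" using m by (simp add: prod.delta)
        finally show ?thesis unfolding chi using eq top \<open>k = k'\<close> unfolding f by simp
      qed
    qed
  qed
qed

section \<open>Expectations over independent uniform permutations\<close>

locale owen_scrambling = prob_space M
  for M :: "'w measure" and b d s :: nat and \<pi> :: "nat \<times> nat list \<Rightarrow> 'w \<Rightarrow> nat \<Rightarrow> nat" +
  assumes base: "b \<ge> 2" and d_pos: "d \<ge> 1"
    and indep_perms: "indep_vars (\<lambda>_. count_space {p. p permutes {..<b}}) \<pi> ({1..d * s} \<times> lists {..<b})"
    and distr_perm: "\<And>q. q \<in> {1..d * s} \<times> lists {..<b} \<Longrightarrow>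
      distr M (count_space {p. p permutes {..<b}}) (\<pi> q) = uniform_count_measure {p. p permutes {..<b}}"
begin

lemma measurable_perm:
  "q \<in> {1..d * s} \<times> lists {..<b} \<Longrightarrow> \<pi> q \<in> measurable M (count_space {p. p permutes {..<b}})"
  using indep_perms by (auto simp: indep_vars_def)

lemma expectation_perm:
  fixes F :: "(nat \<Rightarrow> nat) \<Rightarrow> complex"
  assumes "q \<in> {1..d * s} \<times> lists {..<b}"
  shows "(\<integral>w. F (\<pi> q w) \<partial>M) = perm_mean b F" "integrable M (\<lambda>w. F (\<pi> q w))"
proof -
  let ?P = "{p. p permutes {..<b}}"
  have fin: "finite ?P" by (simp add: finite_permutations)
  have int: "integrable (uniform_count_measure ?P) F"
    unfolding uniform_count_measure_def using fin by (intro integrable_point_measure_finite) auto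
  have "(\<integral>w. F (\<pi> q w) \<partial>M) = (\<integral>p. F p \<partial>distr M (count_space ?P) (\<pi> q))"
    by (rule integral_distr[symmetric, OF measurable_perm[OF assms]]) simp
  also have "\<dots> = (\<Sum>p\<in>?P. (1 / real (card ?P)) *\<^sub>R F p)"
    unfolding distr_perm[OF assms] uniform_count_measure_def
    using fin by (intro lebesgue_integral_point_measure_finite) auto
  also have "\<dots> = perm_mean b F"
    by (simp add: perm_mean_def sum_divide_distrib scaleR_conv_of_real of_real_divide)
  finally show "(\<integral>w. F (\<pi> q w) \<partial>M) = perm_mean b F" .
  show "integrable M (\<lambda>w. F (\<pi> q w))"
    by (rule integrable_distr[OF measurable_perm[OF assms]]) (use int distr_perm[OF assms] in simp)
qed

text \<open>The raw digit, counted from 0, before the string is read as a real number. It is kept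
  apart from \<open>rdigit\<close> of the scrambled coordinate, since the two can differ for strings
  ending in \<open>b - 1\<close>.\<close>

definition scrambled_digit :: "(nat \<Rightarrow> real) \<Rightarrow> nat \<Rightarrow> nat \<Rightarrow> 'w \<Rightarrow> nat" where
  "scrambled_digit z j r w = \<pi> (j, digit_prefix b (z j) r) w (rdigit b (z j) (Suc r))"

lemma prefix_index: "j \<in> {1..d * s} \<Longrightarrow> (j, digit_prefix b x r) \<in> {1..d * s} \<times> lists {..<b}"
  using set_prefix[OF base, of x r] by (auto simp: lists_eq_set)

lemma scrambled_digit_less:
  assumes "j \<in> {1..d * s}" "w \<in> space M"
  shows "scrambled_digit z j r w < b"
proof -
  have "\<pi> (j, digit_prefix b (z j) r) w permutes {..<b}"
    using measurable_space[OF measurable_perm[OF prefix_index[OF assms(1)]] assms(2)] by simp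
  then show ?thesis unfolding scrambled_digit_def by (simp add: permutes_less rdigit_less base)
qed

lemma measurable_scrambled_digit:
  assumes "j \<in> {1..d * s}"
  shows "scrambled_digit z j r \<in> measurable M (count_space UNIV)"
proof -
  have "(\<lambda>p. p (rdigit b (z j) (Suc r))) \<circ> \<pi> (j, digit_prefix b (z j) r) \<in> measurable M (count_space UNIV)"
    by (rule measurable_comp[OF measurable_perm[OF prefix_index[OF assms]]]) simp
  then show ?thesis by (simp add: scrambled_digit_def[abs_def] comp_def)
qed

text \<open>
  A permutation is attached to a coordinate and a digit string, and two points share it exactly
  when they agree in that string.
\<close>

lemma expectation_prod_digits:
  fixes u v :: "nat \<Rightarrow> nat \<Rightarrow> nat \<Rightarrow> complex"
  shows "(\<integral>w. (\<Prod>j=1..d * s. \<Prod>r<K. u j r (scrambled_digit z j r w) * v j r (scrambled_digit z' j r w)) \<partial>M) =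
    (\<Prod>j=1..d * s. \<Prod>r<K. if digit_prefix b (z j) r = digit_prefix b (z' j) r
      then perm_mean b (\<lambda>p. u j r (p (rdigit b (z j) (Suc r))) * v j r (p (rdigit b (z' j) (Suc r))))
      else perm_mean b (\<lambda>p. u j r (p (rdigit b (z j) (Suc r)))) *
        perm_mean b (\<lambda>p. v j r (p (rdigit b (z' j) (Suc r)))))"
proof -
  define L where "L r = {as. set as \<subseteq> {..<b} \<and> length as = r}" for r
  define Q where "Q = {1..d * s} \<times> (\<Union>r<K. L r)"
  \<comment> \<open>Every label of length below \<open>K\<close> receives a factor, equal to 1
    unless the label belongs to the point. Independence is then applied once over the fixed finite
    set \<open>Q\<close>, without first asking which labels the two points share.\<close>
  define U where "U j r as p = (if as = digit_prefix b (z j) r then u j r (p (rdigit b (z j) (Suc r))) else 1)"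
    for j r as and p :: "nat \<Rightarrow> nat"
  define V where "V j r as p = (if as = digit_prefix b (z' j) r then v j r (p (rdigit b (z' j) (Suc r))) else 1)"
    for j r as and p :: "nat \<Rightarrow> nat"
  define G where "G q p = U (fst q) (length (snd q)) (snd q) p * V (fst q) (length (snd q)) (snd q) p"
    for q and p :: "nat \<Rightarrow> nat"
  have finL: "finite (L r)" for r unfolding L_def by (rule finite_lists_length_eq) simp
  have finQ: "finite Q" unfolding Q_def using finL by auto
  have Q_sub: "Q \<subseteq> {1..d * s} \<times> lists {..<b}" by (auto simp: Q_def L_def lists_eq_set)
  have prefix_in: "digit_prefix b x r \<in> L r" for x r using set_prefix[OF base] by (simp add: L_def)
  have prod_Q: "(\<Prod>q\<in>Q. H q) = (\<Prod>j=1..d * s. \<Prod>r<K. \<Prod>as\<in>L r. H (j, as))" for H :: "_ \<Rightarrow> complex"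
  proof -
    have "(\<Prod>q\<in>Q. H q) = (\<Prod>j=1..d * s. \<Prod>as\<in>(\<Union>r<K. L r). H (j, as))"
      by (simp add: Q_def prod.cartesian_product)
    also have "\<dots> = (\<Prod>j=1..d * s. \<Prod>r<K. \<Prod>as\<in>L r. H (j, as))"
      using finL by (intro prod.cong refl prod.UNION_disjoint) (auto simp: L_def)
    finally show ?thesis .
  qed
  have "(\<Prod>q\<in>Q. G q (\<pi> q w)) =
    (\<Prod>j=1..d * s. \<Prod>r<K. u j r (scrambled_digit z j r w) * v j r (scrambled_digit z' j r w))" for w
  proof -
    have "(\<Prod>as\<in>L r. G (j, as) (\<pi> (j, as) w)) =
      u j r (scrambled_digit z j r w) * v j r (scrambled_digit z' j r w)" for j r
    proof -
      have "(\<Prod>as\<in>L r. G (j, as) (\<pi> (j, as) w)) =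
        (\<Prod>as\<in>L r. U j r as (\<pi> (j, as) w)) * (\<Prod>as\<in>L r. V j r as (\<pi> (j, as) w))"
        unfolding prod.distrib[symmetric] by (intro prod.cong) (auto simp: G_def L_def)
      then show ?thesis using finL prefix_in by (simp add: U_def V_def scrambled_digit_def prod.delta)
    qed
    then show ?thesis unfolding prod_Q by simp
  qed
  then have "(\<integral>w. (\<Prod>j=1..d * s. \<Prod>r<K. u j r (scrambled_digit z j r w) * v j r (scrambled_digit z' j r w)) \<partial>M) =
    (\<integral>w. (\<Prod>q\<in>Q. G q (\<pi> q w)) \<partial>M)" by simp
  also have "\<dots> = (\<Prod>q\<in>Q. \<integral>w. G q (\<pi> q w) \<partial>M)"
  proof (rule indep_vars_lebesgue_integral[OF finQ])
    have "indep_vars (\<lambda>_. borel) (\<lambda>q. (\<lambda>p. G q p) \<circ> \<pi> q) Q"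
      by (rule indep_vars_compose[OF indep_vars_subset[OF indep_perms Q_sub]]) simp
    then show "indep_vars (\<lambda>_. borel) (\<lambda>q w. G q (\<pi> q w)) Q" by (simp add: comp_def)
    show "integrable M (\<lambda>w. G q (\<pi> q w))" if "q \<in> Q" for q
      using expectation_perm(2) Q_sub that by blast
  qed
  also have "\<dots> = (\<Prod>q\<in>Q. perm_mean b (G q))"
    using expectation_perm(1) Q_sub by (intro prod.cong refl) blast
  also have "\<dots> = (\<Prod>j=1..d * s. \<Prod>r<K. if digit_prefix b (z j) r = digit_prefix b (z' j) r
      then perm_mean b (\<lambda>p. u j r (p (rdigit b (z j) (Suc r))) * v j r (p (rdigit b (z' j) (Suc r))))
      else perm_mean b (\<lambda>p. u j r (p (rdigit b (z j) (Suc r)))) *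
        perm_mean b (\<lambda>p. v j r (p (rdigit b (z' j) (Suc r)))))"
    unfolding prod_Q
  proof (intro prod.cong refl)
    fix j r
    show "(\<Prod>as\<in>L r. perm_mean b (G (j, as))) = (if digit_prefix b (z j) r = digit_prefix b (z' j) r
      then perm_mean b (\<lambda>p. u j r (p (rdigit b (z j) (Suc r))) * v j r (p (rdigit b (z' j) (Suc r))))
      else perm_mean b (\<lambda>p. u j r (p (rdigit b (z j) (Suc r)))) *
        perm_mean b (\<lambda>p. v j r (p (rdigit b (z' j) (Suc r)))))"
    proof (cases "digit_prefix b (z j) r = digit_prefix b (z' j) r")
      case True
      have "(\<Prod>as\<in>L r. perm_mean b (G (j, as))) = (\<Prod>as\<in>L r. if as = digit_prefix b (z j) r
        then perm_mean b (\<lambda>p. u j r (p (rdigit b (z j) (Suc r))) * v j r (p (rdigit b (z' j) (Suc r)))) else 1)"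
      proof (intro prod.cong refl)
        fix as assume "as \<in> L r"
        then have "length as = r" by (simp add: L_def)
        then have "G (j, as) = (\<lambda>p. if as = digit_prefix b (z j) r
          then u j r (p (rdigit b (z j) (Suc r))) * v j r (p (rdigit b (z' j) (Suc r))) else 1)"
          using True by (intro ext) (simp add: G_def U_def V_def)
        then show "perm_mean b (G (j, as)) = (if as = digit_prefix b (z j) r
          then perm_mean b (\<lambda>p. u j r (p (rdigit b (z j) (Suc r))) * v j r (p (rdigit b (z' j) (Suc r)))) else 1)"
          by simp
      qed
      then show ?thesis using True finL prefix_in by (simp add: prod.delta)
    next
      case False
      \<comment> \<open>With different prefixes no label carries both a \<open>u\<close> and a
        \<open>v\<close> factor, so each mean involves at most one of them and the product
        splits.\<close>
      have "(\<Prod>as\<in>L r. perm_mean b (G (j, as))) =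
        (\<Prod>as\<in>L r. if as = digit_prefix b (z j) r then perm_mean b (\<lambda>p. u j r (p (rdigit b (z j) (Suc r)))) else 1) *
        (\<Prod>as\<in>L r. if as = digit_prefix b (z' j) r then perm_mean b (\<lambda>p. v j r (p (rdigit b (z' j) (Suc r)))) else 1)"
        unfolding prod.distrib[symmetric] using False
      proof (intro prod.cong refl)
        fix as assume "as \<in> L r"
        then have "length as = r" by (simp add: L_def)
        then have "G (j, as) = (\<lambda>p. if as = digit_prefix b (z j) r then u j r (p (rdigit b (z j) (Suc r)))
          else if as = digit_prefix b (z' j) r then v j r (p (rdigit b (z' j) (Suc r))) else 1)"
          using False by (intro ext) (simp add: G_def U_def V_def)
        then show "perm_mean b (G (j, as)) =
          (if as = digit_prefix b (z j) r then perm_mean b (\<lambda>p. u j r (p (rdigit b (z j) (Suc r)))) else 1) *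
          (if as = digit_prefix b (z' j) r then perm_mean b (\<lambda>p. v j r (p (rdigit b (z' j) (Suc r)))) else 1)"
          using False by simp
      qed
      then show ?thesis using False finL prefix_in by (simp add: prod.delta)
    qed
  qed
  finally show ?thesis .
qed

text \<open>The digits of one point use permutations with distinct labels, and a uniform permutation
  sends a fixed digit to a uniform one. The index set \<open>I\<close> is arbitrary so that both a
  run of digits in one coordinate and a full box of digits are covered.\<close>

lemma prob_digits:
  assumes c: "\<And>j r. c j r < b" and I: "I \<subseteq> {1..d * s} \<times> {..<K}"
  shows "prob {w \<in> space M. \<forall>(j, r)\<in>I. scrambled_digit z j r w = c j r} = (1 / real b) ^ card I"
proof -
  have finI: "finite I" using I finite_subset by blast
  have I': "j \<in> {1..d * s}" if "(j, r) \<in> I" for j r using that I by auto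
  let ?A = "{w \<in> space M. \<forall>(j, r)\<in>I. scrambled_digit z j r w = c j r}"
  define u :: "nat \<Rightarrow> nat \<Rightarrow> nat \<Rightarrow> complex" where
    "u j r x = (if (j, r) \<in> I then of_bool (x = c j r) else 1)" for j r x
  have meas: "?A \<in> sets M"
  proof -
    have "{w \<in> space M. scrambled_digit z j r w = c j r} \<in> sets M" if "(j, r) \<in> I" for j r
      using measurable_sets[OF measurable_scrambled_digit[OF I'[OF that]], of "{c j r}" z r]
      by (simp add: vimage_def Int_def conj_commute)
    then have "{w \<in> space M. \<forall>q\<in>I. scrambled_digit z (fst q) (snd q) w = c (fst q) (snd q)} \<in> sets M"
      by (intro sets.sets_Collect_finite_All finI) auto
    then show ?thesis by (simp add: case_prod_beta)
  qed
  have prod_I: "(\<Prod>j=1..d * s. \<Prod>r<K. if (j, r) \<in> I then g j r else 1) = (\<Prod>(j, r)\<in>I. g j r)"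
    for g :: "nat \<Rightarrow> nat \<Rightarrow> complex"
  proof -
    have "(\<Prod>j=1..d * s. \<Prod>r<K. if (j, r) \<in> I then g j r else 1) =
      (\<Prod>q\<in>{1..d * s} \<times> {..<K}. if q \<in> I then g (fst q) (snd q) else 1)"
      by (simp add: prod.cartesian_product case_prod_beta)
    also have "\<dots> = (\<Prod>q\<in>({1..d * s} \<times> {..<K}) \<inter> I. g (fst q) (snd q))"
      by (rule prod.inter_restrict[symmetric]) simp
    finally show ?thesis using I by (simp add: Int_absorb1 case_prod_beta)
  qed
  have "of_real (prob ?A) = (\<integral>w. indicator ?A w \<partial>M :: complex)"
    using integral_complex_of_real[of M "indicator ?A"] meas
    by (simp add: of_real_indicator Int_absorb1 sets.sets_into_space)
  also have "\<dots> = (\<integral>w. (\<Prod>j=1..d * s. \<Prod>r<K. u j r (scrambled_digit z j r w) * 1) \<partial>M)"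
  proof (rule Bochner_Integration.integral_cong[OF refl])
    fix w assume "w \<in> space M"
    then have "indicator ?A w = (of_bool (\<forall>q\<in>I. case q of (j, r) \<Rightarrow> scrambled_digit z j r w = c j r) :: complex)"
      by (auto simp: indicator_def)
    also have "\<dots> = (\<Prod>(j, r)\<in>I. of_bool (scrambled_digit z j r w = c j r))"
      unfolding prod_of_bool_eq[OF finI, symmetric] by (intro prod.cong) auto
    also have "\<dots> = (\<Prod>j=1..d * s. \<Prod>r<K. u j r (scrambled_digit z j r w) * 1)"
      unfolding prod_I[symmetric] u_def by simp
    finally show "indicator ?A w = (\<Prod>j=1..d * s. \<Prod>r<K. u j r (scrambled_digit z j r w) * 1)" .
  qed
  also have "\<dots> = (\<Prod>j=1..d * s. \<Prod>r<K. perm_mean b (\<lambda>p. u j r (p (rdigit b (z j) (Suc r)))))"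
    unfolding expectation_prod_digits[where u = u and v = "\<lambda>_ _ _. 1" and z = z and z' = z] by simp
  also have "\<dots> = (\<Prod>j=1..d * s. \<Prod>r<K. if (j, r) \<in> I then 1 / of_nat b else 1)"
    using c base by (intro prod.cong refl) (auto simp: u_def perm_mean_of_bool rdigit_less)
  also have "\<dots> = of_real ((1 / real b) ^ card I)"
    unfolding prod_I by (simp add: case_prod_beta of_real_divide)
  finally show ?thesis by (simp only: of_real_eq_iff)
qed

text \<open>A run of \<open>n\<close> digits equal to \<open>b - 1\<close> has probability
  \<open>b\<close> to the power \<open>- n\<close>, so an infinite run from a given start has
  probability 0; there are countably many starts and finitely many coordinates.\<close>

lemma AE_digits_not_eventually:
  "AE w in M. \<forall>j\<in>{1..d * s}. \<not> (\<exists>A. \<forall>r\<ge>A. scrambled_digit z j r w = b - 1)"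
proof -
  have "AE w in M. \<not> (\<forall>r\<ge>A. scrambled_digit z j r w = b - 1)" if j: "j \<in> {1..d * s}" for j A
  proof -
    define E where "E n = {w \<in> space M. \<forall>(j, r)\<in>{j} \<times> {A..<A + n}. scrambled_digit z j r w = b - 1}" for n
    have prob_E: "prob (E n) = (1 / real b) ^ n" for n
    proof -
      have "{j} \<times> {A..<A + n} \<subseteq> {1..d * s} \<times> {..<A + n}" using j by auto
      from prob_digits[of "\<lambda>_ _. b - 1", OF _ this] show ?thesis
        unfolding E_def using base by (simp add: card_cartesian_product_singleton)
    qed
    \<comment> \<open>A nonmeasurable set has measure 0 by convention, so the positive value in
      \<open>prob_E\<close> already forces measurability.\<close>
    have meas: "E n \<in> sets M" for n
    proof (rule ccontr)
      assume "E n \<notin> sets M"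
      then have "prob (E n) = 0" by (rule measure_notin_sets)
      then show False using prob_E base by simp
    qed
    have "(\<Inter>n. E n) \<in> sets M" using meas by auto
    moreover have "prob (\<Inter>n. E n) \<le> (1 / real b) ^ n" for n
      unfolding prob_E[symmetric] using meas by (intro finite_measure_mono) auto
    moreover have "(\<lambda>n. (1 / real b) ^ n) \<longlonglongrightarrow> 0" using base by (intro LIMSEQ_power_zero) auto
    ultimately have "prob (\<Inter>n. E n) \<le> 0" using LIMSEQ_le_const by blast
    then have "(\<Inter>n. E n) \<in> null_sets M"
      using \<open>(\<Inter>n. E n) \<in> sets M\<close> by (simp add: measure_le_0_iff null_setsI emeasure_eq_measure)
    from AE_not_in[OF this] show ?thesis
    proof (rule AE_mp, intro AE_I2 impI notI)
      fix w assume "w \<in> space M" "w \<notin> (\<Inter>n. E n)" "\<forall>r\<ge>A. scrambled_digit z j r w = b - 1"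
      then show False by (auto simp: E_def)
    qed
  qed
  then show ?thesis by (simp add: AE_ball_countable AE_all_countable)
qed

end

subsection \<open>The law of a scrambled and interlaced point\<close>

text \<open>The Borel version of \<open>cube\<close>. Digits and laws are treated here, where the
  product structure is available, and the results are then carried to the completion.\<close>

definition prod_cube :: "nat \<Rightarrow> (nat \<Rightarrow> real) measure" where
  "prod_cube s = (\<Pi>\<^sub>M i\<in>{1..s}. restrict_space lborel {0..1})"

lemma space_prod_cube: "space (prod_cube s) = (\<Pi>\<^sub>E i\<in>{1..s}. {0..1})"
  by (simp add: prod_cube_def space_PiM space_restrict_space)

lemma prob_space_unit_interval: "prob_space (restrict_space lborel {0..1::real})"
  by (rule prob_spaceI) (simp add: space_restrict_space emeasure_restrict_space)

lemma prob_space_prod_cube: "prob_space (prod_cube s)"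
  unfolding prod_cube_def by (intro prob_space_PiM prob_space_unit_interval)

lemma emeasure_prod_cube_PiE:
  assumes "\<And>i. i \<in> {1..s} \<Longrightarrow> A i \<in> sets borel" "\<And>i. i \<in> {1..s} \<Longrightarrow> A i \<subseteq> {0..1}"
  shows "emeasure (prod_cube s) (\<Pi>\<^sub>E i\<in>{1..s}. A i) = (\<Prod>i=1..s. emeasure lborel (A i))"
proof -
  interpret unit: prob_space "restrict_space lborel {0..1::real}" by (rule prob_space_unit_interval)
  interpret product_sigma_finite "\<lambda>_. restrict_space lborel {0..1::real}"
    by unfold_locales
  show ?thesis
    unfolding prod_cube_def using assms by (subst emeasure_PiM) (auto simp: sets_restrict_space_iff emeasure_restrict_space)
qed

text \<open>The index \<open>a\<close> is unrestricted. Values outside the range from 0 to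
  \<open>b ^ (d * K) - 1\<close> give null cells, among them those on the upper faces of the closed
  cube.\<close>

definition cell :: "nat \<Rightarrow> nat \<Rightarrow> nat \<Rightarrow> nat \<Rightarrow> (nat \<Rightarrow> int) \<Rightarrow> (nat \<Rightarrow> real) set" where
  "cell b d s K a = {x \<in> space (prod_cube s). \<forall>i\<in>{1..s}. \<lfloor>real b ^ (d * K) * x i\<rfloor> = a i}"

text \<open>The empty set makes the system closed under intersection. The whole space is added
  because for \<open>s \<ge> 1\<close> even the cells with \<open>K = 0\<close> miss the upper
  faces, while uniqueness of measures needs a covering.\<close>

definition cells :: "nat \<Rightarrow> nat \<Rightarrow> nat \<Rightarrow> (nat \<Rightarrow> real) set set" where
  "cells b d s = {{}, space (prod_cube s)} \<union> (\<Union>K. range (cell b d s K))"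

lemma cell_eq_PiE:
  "cell b d s K a = (\<Pi>\<^sub>E i\<in>{1..s}. {x \<in> {0..1}. \<lfloor>real b ^ (d * K) * x\<rfloor> = a i})"
  unfolding cell_def space_prod_cube by (auto simp: PiE_iff extensional_def)

lemma sets_floor_cell: "{x \<in> {0..1}. \<lfloor>real b ^ T * x\<rfloor> = a} \<in> sets borel"
  by measurable

lemma cell_sets: "cell b d s K a \<in> sets (prod_cube s)"
  unfolding cell_eq_PiE prod_cube_def
  by (rule sets_PiM_I_finite) (use sets_floor_cell in \<open>auto simp: sets_restrict_space_iff\<close>)

lemma emeasure_floor_cell:
  assumes b: "b \<ge> 2"
  shows "emeasure lborel {x \<in> {0..1}. \<lfloor>real b ^ T * x\<rfloor> = a} =
    (if 0 \<le> a \<and> a < int b ^ T then ennreal ((1 / real b) ^ T) else 0)"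
proof -
  have p: "real b ^ T > 0" using b by simp
  show ?thesis
  proof (cases "0 \<le> a \<and> a < int b ^ T")
    case True
    then have "real_of_int (a + 1) \<le> real_of_int (int b ^ T)" unfolding of_int_le_iff by simp
    then have le: "real_of_int a + 1 \<le> real b ^ T" by simp
    have "{x \<in> {0..1}. \<lfloor>real b ^ T * x\<rfloor> = a} = {real_of_int a / real b ^ T..<(real_of_int a + 1) / real b ^ T}"
    proof -
      have eq: "\<lfloor>real b ^ T * x\<rfloor> = a \<longleftrightarrow> a / real b ^ T \<le> x \<and> x < (a + 1) / real b ^ T" for x
        using p by (simp add: floor_eq_iff pos_divide_le_eq pos_less_divide_eq mult.commute)
      have "0 \<le> a / real b ^ T" "(a + 1) / real b ^ T \<le> 1"
        using True p le by (simp_all add: pos_divide_le_eq)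
      then have "0 \<le> x \<and> x \<le> 1" if "a / real b ^ T \<le> x" "x < (a + 1) / real b ^ T" for x
        using that by linarith
      then show ?thesis unfolding eq by auto
    qed
    moreover have "(real_of_int a + 1) / real b ^ T - real_of_int a / real b ^ T = (1 / real b) ^ T"
      using p by (simp add: field_simps power_divide)
    moreover have "real_of_int a / real b ^ T \<le> (real_of_int a + 1) / real b ^ T"
      using p by (simp add: divide_right_mono)
    ultimately show ?thesis using True by simp
  next
    case False
    \<comment> \<open>Among indices out of range only \<open>a = b ^ T\<close> is attained, and only
      at the right end point.\<close>
    have "{x \<in> {0..1}. \<lfloor>real b ^ T * x\<rfloor> = a} \<subseteq> {1}"
    proof
      fix x assume x: "x \<in> {x \<in> {0..1}. \<lfloor>real b ^ T * x\<rfloor> = a}"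
      then have "0 \<le> real b ^ T * x" using p by simp
      then have "0 \<le> a" using x by auto
      then have "real_of_int (int b ^ T) \<le> real_of_int a" using False unfolding of_int_le_iff by simp
      then have "real b ^ T \<le> a" by simp
      also have "a \<le> real b ^ T * x" using x by auto
      finally show "x \<in> {1}" using p x by simp
    qed
    then have "emeasure lborel {x \<in> {0..1}. \<lfloor>real b ^ T * x\<rfloor> = a} \<le> emeasure lborel {1::real}"
      by (intro emeasure_mono) auto
    then show ?thesis unfolding if_not_P[OF False] by simp
  qed
qed

lemma emeasure_cell:
  assumes b: "b \<ge> 2"
  shows "emeasure (prod_cube s) (cell b d s K a) =
    (if \<forall>i\<in>{1..s}. 0 \<le> a i \<and> a i < int b ^ (d * K) then ennreal ((1 / real b) ^ (d * s * K)) else 0)"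
proof -
  have "emeasure (prod_cube s) (cell b d s K a) =
    (\<Prod>i=1..s. if 0 \<le> a i \<and> a i < int b ^ (d * K) then ennreal ((1 / real b) ^ (d * K)) else 0)"
    unfolding cell_eq_PiE emeasure_floor_cell[OF b, symmetric]
    by (intro emeasure_prod_cube_PiE sets_floor_cell) auto
  also have "\<dots> = (if \<forall>i\<in>{1..s}. 0 \<le> a i \<and> a i < int b ^ (d * K)
      then ennreal ((1 / real b) ^ (d * s * K)) else 0)"
  proof (cases "\<forall>i\<in>{1..s}. 0 \<le> a i \<and> a i < int b ^ (d * K)")
    case True
    then have "(\<Prod>i=1..s. if 0 \<le> a i \<and> a i < int b ^ (d * K) then ennreal ((1 / real b) ^ (d * K)) else 0)
      = (\<Prod>i=1..s. ennreal ((1 / real b) ^ (d * K)))" by (intro prod.cong) auto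
    also have "\<dots> = ennreal ((1 / real b) ^ (d * s * K))"
      by (simp add: ennreal_power power_mult[symmetric] mult_ac)
    finally show ?thesis unfolding if_P[OF True] .
  next
    case False
    then show ?thesis by (subst if_not_P) (auto intro!: prod_zero)
  qed
  finally show ?thesis .
qed

lemma AE_prod_cube_less_1: "AE x in prod_cube s. \<forall>i\<in>{1..s}. x i < 1"
proof -
  have "AE x in prod_cube s. x i < 1" if i: "i \<in> {1..s}" for i
  proof -
    let ?N = "\<Pi>\<^sub>E j\<in>{1..s}. if j = i then {1} else {0..1::real}"
    have "?N \<in> sets (prod_cube s)"
      unfolding prod_cube_def by (rule sets_PiM_I_finite) (auto simp: sets_restrict_space_iff)
    moreover have "emeasure (prod_cube s) ?N = 0"
    proof -
      have "emeasure (prod_cube s) ?N = (\<Prod>j=1..s. emeasure lborel (if j = i then {1} else {0..1::real}))"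
        by (rule emeasure_prod_cube_PiE) auto
      also have "\<dots> = 0" using i by (intro prod_zero) (auto intro!: bexI[of _ i])
      finally show ?thesis .
    qed
    ultimately have "?N \<in> null_sets (prod_cube s)" by (intro null_setsI)
    moreover have "{x \<in> space (prod_cube s). \<not> x i < 1} \<subseteq> ?N"
      unfolding space_prod_cube using i by (force simp: PiE_iff)
    ultimately show ?thesis by (rule AE_I')
  qed
  then show ?thesis by (intro AE_ball_countable[THEN iffD2]) auto
qed

lemma cells_subset_Pow: "cells b d s \<subseteq> Pow (space (prod_cube s))"
  by (auto simp: cells_def cell_def)

lemma floor_power_div:
  assumes "b \<ge> 2" "T \<le> T'"
  shows "\<lfloor>real b ^ T * x\<rfloor> = \<lfloor>real b ^ T' * x\<rfloor> div int b ^ (T' - T)"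
proof -
  have "real b ^ T' * x / of_int (int b ^ (T' - T)) = real b ^ T * x"
    using assms power_add[of "real b" T "T' - T"] by simp
  then show ?thesis
    using floor_divide_real_eq_div[of "int b ^ (T' - T)" "real b ^ T' * x"] by simp
qed

text \<open>The partitions are nested: a finer cell lies inside a coarser one or is disjoint from
  it, because the coarse floor is determined by the fine one.\<close>

lemma Int_stable_cells:
  assumes b: "b \<ge> 2"
  shows "Int_stable (cells b d s)"
proof -
  have *: "cell b d s K a \<inter> cell b d s K' a' \<in> cells b d s" if "K \<le> K'" for K K' a a'
  proof -
    have "cell b d s K a \<inter> cell b d s K' a' =
      (if \<forall>i\<in>{1..s}. a' i div int b ^ (d * K' - d * K) = a i then cell b d s K' a' else {})"
      unfolding cell_def using floor_power_div[OF b, of "d * K" "d * K'"] that by auto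
    moreover have "cell b d s K' a' \<in> cells b d s" "{} \<in> cells b d s" unfolding cells_def by blast+
    ultimately show ?thesis by simp
  qed
  have **: "cell b d s K a \<inter> cell b d s K' a' \<in> cells b d s" for K K' a a'
    using *[of K K' a a'] *[of K' K a' a] by (cases "K \<le> K'") (auto simp: Int_commute)
  show ?thesis
  proof (rule Int_stableI)
    fix A B assume AB: "A \<in> cells b d s" "B \<in> cells b d s"
    then have "A \<subseteq> space (prod_cube s)" "B \<subseteq> space (prod_cube s)" using cells_subset_Pow by blast+
    moreover have "{} \<in> cells b d s" by (simp add: cells_def)
    moreover have "X \<in> {{}, space (prod_cube s)} \<or> (\<exists>K a. X = cell b d s K a)" if "X \<in> cells b d s" for X
      using that by (auto simp: cells_def)
    from this[OF AB(1)] this[OF AB(2)] have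
      "A = {} \<or> B = {} \<or> A = space (prod_cube s) \<or> B = space (prod_cube s) \<or> A \<inter> B \<in> cells b d s"
      using ** by blast
    ultimately show "A \<inter> B \<in> cells b d s"
      using AB by (elim disjE) (simp_all add: Int_absorb1 Int_absorb2)
  qed
qed

text \<open>Each coordinate is a limit of its rescaled floors, and a floor is constant on cells. The
  identity from the \<sigma>-algebra of cells to the product \<sigma>-algebra is therefore
  measurable, which is the nontrivial inclusion.\<close>

lemma sets_prod_cube_eq_cells:
  assumes b: "b \<ge> 2" and d: "d \<ge> 1"
  shows "sets (prod_cube s) = sigma_sets (space (prod_cube s)) (cells b d s)"
proof
  show "sigma_sets (space (prod_cube s)) (cells b d s) \<subseteq> sets (prod_cube s)"
    by (rule sets.sigma_sets_subset) (auto simp: cells_def cell_sets)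
next
  define S where "S = sigma (space (prod_cube s)) (cells b d s)"
  have S: "space S = space (prod_cube s)" "sets S = sigma_sets (space (prod_cube s)) (cells b d s)"
    unfolding S_def using cells_subset_Pow by (auto simp: space_measure_of sets_measure_of)
  have floor: "(\<lambda>x. \<lfloor>real b ^ (d * K) * x i\<rfloor>) \<in> measurable S (count_space UNIV)" if i: "i \<in> {1..s}" for i K
  proof -
    have "(\<lambda>x. \<lfloor>real b ^ (d * K) * x i\<rfloor>) -` {m} \<inter> space S \<in> sets S" for m
    proof -
      \<comment> \<open>Finitely many cells suffice. The bound \<open>b ^ (d * K)\<close> is
        included since a coordinate may equal 1.\<close>
      let ?I = "{a \<in> (\<Pi>\<^sub>E i\<in>{1..s}. {0..int b ^ (d * K)}). a i = m}"
      have "(\<lambda>x. \<lfloor>real b ^ (d * K) * x i\<rfloor>) -` {m} \<inter> space S = (\<Union>a\<in>?I. cell b d s K a)"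
      proof (intro set_eqI iffI)
        fix x assume x: "x \<in> (\<lambda>x. \<lfloor>real b ^ (d * K) * x i\<rfloor>) -` {m} \<inter> space S"
        define a where "a = (\<lambda>i\<in>{1..s}. \<lfloor>real b ^ (d * K) * x i\<rfloor>)"
        have "\<lfloor>real b ^ (d * K) * x j\<rfloor> \<in> {0..int b ^ (d * K)}" if "j \<in> {1..s}" for j
        proof -
          have xj: "0 \<le> x j" "x j \<le> 1" using x that by (auto simp: S space_prod_cube PiE_iff)
          then have "real b ^ (d * K) * x j \<le> real b ^ (d * K)" by (simp add: mult_left_le)
          then have "\<lfloor>real b ^ (d * K) * x j\<rfloor> \<le> int b ^ (d * K)"
            using floor_mono[of "real b ^ (d * K) * x j" "real b ^ (d * K)"] floor_of_nat[of "b ^ (d * K)", where 'a = real]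
            by simp
          then show ?thesis using xj by simp
        qed
        then have "a \<in> ?I" using x i by (auto simp: a_def)
        moreover have "x \<in> cell b d s K a" using x by (auto simp: S cell_def a_def)
        ultimately show "x \<in> (\<Union>a\<in>?I. cell b d s K a)" by blast
      qed (use i in \<open>auto simp: cell_def S\<close>)
      moreover have "(\<Union>a\<in>?I. cell b d s K a) \<in> sets S"
      proof (rule sets.countable_UN')
        show "countable ?I" by (intro countable_finite finite_subset[OF _ finite_PiE[of "{1..s}" "\<lambda>_. {0..int b ^ (d * K)}"]]) auto
        show "cell b d s K ` ?I \<subseteq> sets S" unfolding S by (auto simp: cells_def)
      qed
      ultimately show ?thesis by simp
    qed
    then show ?thesis by (subst measurable_count_space_eq2_countable) auto
  qed
  have coord: "(\<lambda>x. x i) \<in> borel_measurable S" if i: "i \<in> {1..s}" for i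
  proof (rule borel_measurable_LIMSEQ_real)
    show "(\<lambda>x. real_of_int \<lfloor>real b ^ (d * K) * x i\<rfloor> / real b ^ (d * K)) \<in> borel_measurable S" for K
    proof -
      have "(\<lambda>x. real_of_int \<lfloor>real b ^ (d * K) * x i\<rfloor>) \<in> borel_measurable S"
        by (rule measurable_compose[OF floor[OF i]]) simp
      then show ?thesis by simp
    qed
    fix x :: "nat \<Rightarrow> real"
    show "(\<lambda>K. real_of_int \<lfloor>real b ^ (d * K) * x i\<rfloor> / real b ^ (d * K)) \<longlonglongrightarrow> x i"
    proof (rule tendsto_sandwich[of "\<lambda>K. x i - (1 / real b ^ d) ^ K" _ _ "\<lambda>_. x i"])
      have "(\<lambda>K. x i - (1 / real b ^ d) ^ K) \<longlonglongrightarrow> x i - 0"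
        using b d by (intro tendsto_intros LIMSEQ_power_zero) auto
      then show "(\<lambda>K. x i - (1 / real b ^ d) ^ K) \<longlonglongrightarrow> x i" by simp
      have "x i - (1 / real b ^ d) ^ K \<le> real_of_int \<lfloor>real b ^ (d * K) * x i\<rfloor> / real b ^ (d * K)"
        "real_of_int \<lfloor>real b ^ (d * K) * x i\<rfloor> / real b ^ (d * K) \<le> x i" for K
      proof -
        have p: "real b ^ (d * K) > 0" using b by simp
        have "real b ^ (d * K) * x i - 1 \<le> real_of_int \<lfloor>real b ^ (d * K) * x i\<rfloor>"
          "real_of_int \<lfloor>real b ^ (d * K) * x i\<rfloor> \<le> real b ^ (d * K) * x i" by linarith+
        then show "x i - (1 / real b ^ d) ^ K \<le> real_of_int \<lfloor>real b ^ (d * K) * x i\<rfloor> / real b ^ (d * K)"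
          "real_of_int \<lfloor>real b ^ (d * K) * x i\<rfloor> / real b ^ (d * K) \<le> x i"
          using p b by (simp_all add: power_divide power_mult[symmetric] pos_le_divide_eq pos_divide_le_eq
            left_diff_distrib mult.commute[of "x i"])
      qed
      then show "\<forall>\<^sub>F K in sequentially. x i - (1 / real b ^ d) ^ K \<le> real_of_int \<lfloor>real b ^ (d * K) * x i\<rfloor> / real b ^ (d * K)"
        "\<forall>\<^sub>F K in sequentially. real_of_int \<lfloor>real b ^ (d * K) * x i\<rfloor> / real b ^ (d * K) \<le> x i"
        by simp_all
    qed simp
  qed
  have "(\<lambda>x i. x i) \<in> measurable S (prod_cube s)"
    unfolding prod_cube_def
  proof (rule measurable_PiM_single')
    show "(\<lambda>x. x i) \<in> measurable S (restrict_space lborel {0..1})" if "i \<in> {1..s}" for i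
      using coord[OF that] that
      by (intro measurable_restrict_space2) (auto simp: S space_prod_cube PiE_iff)
    show "(\<lambda>x i. x i) \<in> space S \<rightarrow> (\<Pi>\<^sub>E i\<in>{1..s}. space (restrict_space lborel {0..1}))"
      by (auto simp: S space_prod_cube space_restrict_space)
  qed
  then have id: "(\<lambda>x. x) \<in> measurable S (prod_cube s)" by simp
  show "sets (prod_cube s) \<subseteq> sigma_sets (space (prod_cube s)) (cells b d s)"
  proof
    fix A assume A: "A \<in> sets (prod_cube s)"
    then have "(\<lambda>x. x) -` A \<inter> space S \<in> sets S" by (rule measurable_sets[OF id])
    moreover have "A \<subseteq> space S" using sets.sets_into_space[OF A] by (simp add: S)
    ultimately show "A \<in> sigma_sets (space (prod_cube s)) (cells b d s)"
      by (simp add: Int_absorb2 S(2)[symmetric])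
  qed
qed

text \<open>The counterpart of \<open>freq_interlace_eq\<close> for points: grouping the single
  digit series into runs of length \<open>d\<close> recovers the double sum, and the single series
  is what \<open>digit_series_rdigit\<close> can handle.\<close>

lemma interlace_eq_suminf:
  assumes b: "b \<ge> 2" and d: "d \<ge> 1" and i: "i \<in> {1..s}"
  shows "interlace b d s y i =
    (\<Sum>t. real (rdigit b (y ((i - 1) * d + t mod d + 1)) (Suc (t div d))) / real b ^ Suc t)"
proof -
  let ?f = "\<lambda>t. real (rdigit b (y ((i - 1) * d + t mod d + 1)) (Suc (t div d))) / real b ^ Suc t"
  have "(\<lambda>a. sum ?f {a * d..<a * d + d}) sums (\<Sum>t. ?f t)"
    using d by (intro sums_group summable_sums digit_series_bounds(1) b rdigit_less) auto
  moreover have "sum ?f {a * d..<a * d + d} =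
    (\<Sum>r=1..d. real (rdigit b (y ((i - 1) * d + r)) (Suc a)) / real b ^ (r + a * d))" for a
  proof (rule sum.reindex_bij_witness[of _ "\<lambda>r. r - 1 + a * d" "\<lambda>t. t - a * d + 1"], goal_cases)
    case (5 t)
    define u where "u = t - a * d"
    have t: "t = u + a * d" "u < d" using 5 by (auto simp: u_def)
    then show ?case by simp
  qed auto
  ultimately show ?thesis using i by (simp add: interlace_def sums_iff)
qed

section \<open>Uniformity of a scrambled and interlaced point\<close>

context owen_scrambling
begin

definition pt :: "(nat \<Rightarrow> real) \<Rightarrow> 'w \<Rightarrow> nat \<Rightarrow> real" where
  "pt z w = interlace b d s (scramble b (d * s) (\<lambda>q. \<pi> q w) z)"

lemma scramble_eq_suminf:
  "j \<in> {1..d * s} \<Longrightarrow> scramble b (d * s) (\<lambda>q. \<pi> q w) z j =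
    (\<Sum>r. real (scrambled_digit z j r w) / real b ^ Suc r)"
  by (simp add: scramble_def scrambled_digit_def digit_prefix_def)

text \<open>True for every \<open>w\<close> without exception: \<open>interlace\<close> reads its
  input through \<open>rdigit\<close>, which stays below \<open>b\<close> for any real
  argument.\<close>

lemma pt_in_prod_cube: "pt z w \<in> space (prod_cube s)"
proof -
  have "pt z w i \<in> {0..1}" if "i \<in> {1..s}" for i
    unfolding pt_def interlace_eq_suminf[OF base d_pos that]
    using digit_series_bounds(2,3)[OF base] rdigit_less[OF base] by simp
  moreover have "pt z w \<in> extensional {1..s}" by (simp add: pt_def interlace_def)
  ultimately show ?thesis by (simp add: space_prod_cube PiE_iff)
qed

lemma measurable_pt: "pt z \<in> measurable M (prod_cube s)"
proof -
  have scr: "(\<lambda>w. scramble b (d * s) (\<lambda>q. \<pi> q w) z j) \<in> borel_measurable M" if "j \<in> {1..d * s}" for j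
  proof -
    have "(\<lambda>w. real (scrambled_digit z j r w)) \<in> borel_measurable M" for r
      by (rule measurable_compose[OF measurable_scrambled_digit[OF that]]) simp
    then have "(\<lambda>w. \<Sum>r. real (scrambled_digit z j r w) / real b ^ Suc r) \<in> borel_measurable M"
      by (intro borel_measurable_suminf borel_measurable_divide) auto
    then show ?thesis using that by (simp add: scramble_eq_suminf)
  qed
  have rd: "(\<lambda>x. real (rdigit b x a)) \<in> borel_measurable borel" for a
    unfolding rdigit_def by measurable
  have comp: "(\<lambda>w. pt z w i) \<in> borel_measurable M" if i: "i \<in> {1..s}" for i
    unfolding pt_def interlace_eq_suminf[OF base d_pos i]
  proof (intro borel_measurable_suminf borel_measurable_divide borel_measurable_const)
    fix t
    have "(i - 1) * d + t mod d + 1 \<in> {1..d * s}"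
      using deinterlaced_index(1)[OF d_pos i, of "t mod d" 1] d_pos by simp
    from measurable_compose[OF scr[OF this] rd]
    show "(\<lambda>w. real (rdigit b (scramble b (d * s) (\<lambda>q. \<pi> q w) z ((i - 1) * d + t mod d + 1))
      (Suc (t div d)))) \<in> borel_measurable M" .
  qed
  have "(\<lambda>w i. pt z w i) \<in> measurable M (prod_cube s)"
    unfolding prod_cube_def
  proof (rule measurable_PiM_single')
    show "(\<lambda>w. pt z w i) \<in> measurable M (restrict_space lborel {0..1})" if "i \<in> {1..s}" for i
      using comp[OF that] pt_in_prod_cube[of z] that
      by (intro measurable_restrict_space2) (auto simp: space_prod_cube PiE_iff)
    show "(\<lambda>w i. pt z w i) \<in> space M \<rightarrow> (\<Pi>\<^sub>E i\<in>{1..s}. space (restrict_space lborel {0..1}))"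
      using pt_in_prod_cube by (auto simp: space_prod_cube space_restrict_space)
  qed
  then show ?thesis by simp
qed

text \<open>Strings ending in \<open>b - 1\<close> have to be excluded twice, for the scrambled
  coordinates and for their interlacings, before \<open>digit_series_rdigit\<close> applies. Both
  exclusions follow from the same almost sure event.\<close>

lemma AE_pt:
  "AE w in M. (\<forall>i\<in>{1..s}. pt z w i \<in> {0..<1}) \<and>
    (\<forall>j\<in>{1..d * s}. \<forall>r. dgt b d (pt z w) j r = scrambled_digit z j r w)"
proof (rule AE_mp[OF AE_digits_not_eventually[of z]], intro AE_I2 impI)
  fix w assume w: "w \<in> space M"
    and ne: "\<forall>j\<in>{1..d * s}. \<not> (\<exists>A. \<forall>r\<ge>A. scrambled_digit z j r w = b - 1)"
  let ?y = "scramble b (d * s) (\<lambda>q. \<pi> q w) z"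
  have y: "rdigit b (?y j) (Suc r) = scrambled_digit z j r w" if j: "j \<in> {1..d * s}" for j r
    unfolding scramble_eq_suminf[OF j]
    by (rule digit_series_rdigit(1)) (use ne j scrambled_digit_less[OF j w] base in auto)
  have main: "rdigit b (pt z w i) (Suc t) = rdigit b (?y ((i - 1) * d + t mod d + 1)) (Suc (t div d))"
    "pt z w i < 1" if i: "i \<in> {1..s}" for i t
  proof -
    let ?c = "\<lambda>t. rdigit b (?y ((i - 1) * d + t mod d + 1)) (Suc (t div d))"
    have ne': "\<not> (\<exists>A. \<forall>t\<ge>A. ?c t = b - 1)"
    proof
      assume "\<exists>A. \<forall>t\<ge>A. ?c t = b - 1"
      then obtain A where A: "\<And>t. t \<ge> A \<Longrightarrow> ?c t = b - 1" by blast
      \<comment> \<open>The positions \<open>r * d\<close> of the interlaced string carry the digits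
        of this one coordinate, so a tail of \<open>b - 1\<close> would be inherited by it.\<close>
      have j: "(i - 1) * d + 1 \<in> {1..d * s}" using deinterlaced_index(1)[OF d_pos i, of 0 1] d_pos by simp
      have "scrambled_digit z ((i - 1) * d + 1) r w = b - 1" if "r \<ge> A" for r
      proof -
        have "r * 1 \<le> r * d" using d_pos by (intro mult_le_mono2)
        then have "A \<le> r * d" using that by linarith
        from A[OF this] show ?thesis using y[OF j, of r] d_pos by simp
      qed
      then show False using ne j by blast
    qed
    show "rdigit b (pt z w i) (Suc t) = ?c t" "pt z w i < 1"
      unfolding pt_def interlace_eq_suminf[OF base d_pos i]
      using digit_series_rdigit[OF base _ ne'] rdigit_less[OF base] by auto
  qed
  have "pt z w i \<in> {0..<1}" if i: "i \<in> {1..s}" for i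
    using main(2)[OF i] pt_in_prod_cube[of z w] i by (auto simp: space_prod_cube PiE_iff)
  moreover have "dgt b d (pt z w) j r = scrambled_digit z j r w" if j: "j \<in> {1..d * s}" for j r
  proof -
    have "((j - 1) mod d + r * d) mod d = (j - 1) mod d" "((j - 1) mod d + r * d) div d = r"
      using d_pos by simp_all
    then show ?thesis
      using interlaced_index[OF d_pos j] y[OF j, of r] main(1)[of "(j - 1) div d + 1" "(j - 1) mod d + r * d"]
      unfolding dgt_def by (simp add: add.assoc)
  qed
  ultimately show "(\<forall>i\<in>{1..s}. pt z w i \<in> {0..<1}) \<and>
    (\<forall>j\<in>{1..d * s}. \<forall>r. dgt b d (pt z w) j r = scrambled_digit z j r w)" by blast
qed

text \<open>Both measures agree on the intersection-stable generator of cells: membership in a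
  nonnull cell prescribes \<open>d * s * K\<close> scrambled digits, whose joint probability is the
  volume of the cell.\<close>

lemma distr_pt: "distr M (prod_cube s) (pt z) = prod_cube s"
proof -
  interpret cube: prob_space "prod_cube s" by (rule prob_space_prod_cube)
  interpret law: prob_space "distr M (prod_cube s) (pt z)" by (rule prob_space_distr[OF measurable_pt])
  have cell_prob: "emeasure (distr M (prod_cube s) (pt z)) (cell b d s K a) =
      emeasure (prod_cube s) (cell b d s K a)" for K a
  proof -
    let ?E = "pt z -` cell b d s K a \<inter> space M"
    have E: "?E \<in> sets M" by (rule measurable_sets[OF measurable_pt cell_sets])
    have "prob ?E = (if \<forall>i\<in>{1..s}. 0 \<le> a i \<and> a i < int b ^ (d * K) then (1 / real b) ^ (d * s * K) else 0)"
    proof (cases "\<forall>i\<in>{1..s}. 0 \<le> a i \<and> a i < int b ^ (d * K)")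
      case True
      \<comment> \<open>The corner of the cell with smallest coordinates; its digits are the
        prescribed ones.\<close>
      define x where "x i = real_of_int (a i) / real b ^ (d * K)" for i
      have p: "real b ^ (d * K) > 0" using base by simp
      have x: "x i \<in> {0..<1}" if "i \<in> {1..s}" for i
      proof -
        have "a i < int b ^ (d * K)" "0 \<le> a i" using True that by auto
        then have "real_of_int (a i) < real b ^ (d * K)"
          by (simp only: of_int_less_iff[symmetric, where 'a = real]) simp
        then show ?thesis using \<open>0 \<le> a i\<close> p by (simp add: x_def)
      qed
      have floor_x: "\<lfloor>real b ^ (d * K) * x i\<rfloor> = a i" for i using p by (simp add: x_def)
      let ?I = "{1..d * s} \<times> {..<K}"
      let ?F = "{w \<in> space M. \<forall>(j, r)\<in>?I. scrambled_digit z j r w = dgt b d x j r}"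
      have F: "prob ?F = (1 / real b) ^ (d * s * K)"
        using prob_digits[of "dgt b d x" ?I K z] rdigit_less[OF base] by (simp add: dgt_def)
      \<comment> \<open>Again positive probability implies measurability.\<close>
      then have "?F \<in> sets M" using base measure_notin_sets[of ?F M] by fastforce
      moreover have "AE w in M. w \<in> ?E \<longleftrightarrow> w \<in> ?F"
      proof (rule AE_mp[OF AE_pt[of z]], intro AE_I2 impI)
        fix w assume w: "w \<in> space M" and Y: "(\<forall>i\<in>{1..s}. pt z w i \<in> {0..<1}) \<and>
          (\<forall>j\<in>{1..d * s}. \<forall>r. dgt b d (pt z w) j r = scrambled_digit z j r w)"
        have "w \<in> ?E \<longleftrightarrow> (\<forall>i\<in>{1..s}. \<lfloor>real b ^ (d * K) * pt z w i\<rfloor> = \<lfloor>real b ^ (d * K) * x i\<rfloor>)"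
          using w pt_in_prod_cube by (simp add: cell_def floor_x)
        also have "\<dots> \<longleftrightarrow> (\<forall>j\<in>{1..d * s}. \<forall>r<K. dgt b d (pt z w) j r = dgt b d x j r)"
          using Y x by (intro floors_eq_iff_dgt base d_pos) auto
        also have "\<dots> \<longleftrightarrow> w \<in> ?F" using w Y by auto
        finally show "w \<in> ?E \<longleftrightarrow> w \<in> ?F" .
      qed
      ultimately have "prob ?E = prob ?F" using E by (intro measure_eq_AE) auto
      then show ?thesis unfolding if_P[OF True] using F by simp
    next
      case False
      have "AE w in M. w \<notin> ?E"
      proof (rule AE_mp[OF AE_pt[of z]], intro AE_I2 impI notI)
        fix w assume Y: "(\<forall>i\<in>{1..s}. pt z w i \<in> {0..<1}) \<and>
          (\<forall>j\<in>{1..d * s}. \<forall>r. dgt b d (pt z w) j r = scrambled_digit z j r w)" and w: "w \<in> ?E"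
        have "0 \<le> a i \<and> a i < int b ^ (d * K)" if i: "i \<in> {1..s}" for i
        proof -
          have a: "\<lfloor>real b ^ (d * K) * pt z w i\<rfloor> = a i" using w i by (auto simp: cell_def)
          have Yi: "0 \<le> pt z w i" "pt z w i < 1" using Y i by auto
          then have "real b ^ (d * K) * pt z w i < real b ^ (d * K) * 1"
            using base by (intro mult_strict_left_mono) auto
          then have "real_of_int (a i) < real_of_int (int b ^ (d * K))"
            using a by (simp add: floor_less_iff[symmetric]) linarith
          then have "a i < int b ^ (d * K)" by (simp only: of_int_less_iff)
          moreover have "0 \<le> \<lfloor>real b ^ (d * K) * pt z w i\<rfloor>" using Yi by simp
          ultimately show ?thesis using a by simp
        qed
        then show False using False by blast
      qed
      then have "prob ?E = prob {}" using E by (intro measure_eq_AE) auto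
      then show ?thesis using False by (simp only: if_False measure_empty)
    qed
    then have "emeasure M ?E = emeasure (prod_cube s) (cell b d s K a)"
      unfolding emeasure_cell[OF base] emeasure_eq_measure by simp
    then show ?thesis by (simp add: emeasure_distr[OF measurable_pt cell_sets])
  qed
  show ?thesis
  proof (rule measure_eqI_generator_eq[where E = "cells b d s" and \<Omega> = "space (prod_cube s)"
        and A = "\<lambda>_. space (prod_cube s)"])
    show "emeasure (distr M (prod_cube s) (pt z)) X = emeasure (prod_cube s) X" if "X \<in> cells b d s" for X
      using that cell_prob law.emeasure_space_1 cube.emeasure_space_1 by (auto simp: cells_def)
  qed (use Int_stable_cells[OF base] cells_subset_Pow sets_prod_cube_eq_cells[OF base d_pos]
         law.emeasure_space_1 in \<open>auto simp: cells_def\<close>)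
qed

end

subsection \<open>Mean-square approximation in an orthonormal system\<close>

definition sq_int :: "'a measure \<Rightarrow> ('a \<Rightarrow> complex) \<Rightarrow> bool" where
  "sq_int M f \<longleftrightarrow> f \<in> borel_measurable M \<and> integrable M (\<lambda>x. (cmod (f x))\<^sup>2)"

definition msq :: "'a measure \<Rightarrow> ('a \<Rightarrow> complex) \<Rightarrow> real" where
  "msq M f = (\<integral>x. (cmod (f x))\<^sup>2 \<partial>M)"

lemma msq_nonneg: "0 \<le> msq M f"
  by (simp add: msq_def)

lemma cmod_add_power2: "(cmod (u + v))\<^sup>2 = (cmod u)\<^sup>2 + (cmod v)\<^sup>2 + 2 * Re (u * cnj v)"
  unfolding cmod_power2 by (simp add: power2_eq_square algebra_simps)

lemma cmod_add_power2_le: "(cmod (u + v))\<^sup>2 \<le> 2 * (cmod u)\<^sup>2 + 2 * (cmod v)\<^sup>2"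
proof -
  have "(cmod (u + v))\<^sup>2 \<le> (cmod u + cmod v)\<^sup>2" by (intro power_mono norm_triangle_ineq) auto
  also have "\<dots> \<le> 2 * (cmod u)\<^sup>2 + 2 * (cmod v)\<^sup>2"
    using zero_le_power2[of "cmod u - cmod v"] by (simp add: power2_eq_square algebra_simps)
  finally show ?thesis .
qed

lemma sq_int_bound:
  assumes "g \<in> borel_measurable M" "integrable M w" "\<And>x. x \<in> space M \<Longrightarrow> (cmod (g x))\<^sup>2 \<le> w x"
  shows "sq_int M g"
  unfolding sq_int_def
proof
  show "integrable M (\<lambda>x. (cmod (g x))\<^sup>2)"
    by (rule Bochner_Integration.integrable_bound[OF assms(2)])
       (use assms in \<open>auto intro!: AE_I2 intro: order_trans[OF assms(3) abs_ge_self]\<close>)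
qed (rule assms)

lemma sq_int_add:
  assumes "sq_int M f" "sq_int M g"
  shows "sq_int M (\<lambda>x. f x + g x)"
  using assms unfolding sq_int_def
  by (intro sq_int_bound[unfolded sq_int_def, where w = "\<lambda>x. 2 * (cmod (f x))\<^sup>2 + 2 * (cmod (g x))\<^sup>2"])
     (auto intro: cmod_add_power2_le)

lemma msq_add_le:
  assumes "sq_int M f" "sq_int M g"
  shows "msq M (\<lambda>x. f x + g x) \<le> 2 * msq M f + 2 * msq M g"
proof -
  have "msq M (\<lambda>x. f x + g x) \<le> (\<integral>x. 2 * (cmod (f x))\<^sup>2 + 2 * (cmod (g x))\<^sup>2 \<partial>M)"
    unfolding msq_def using assms sq_int_add[OF assms]
    by (intro integral_mono) (auto simp: sq_int_def intro: cmod_add_power2_le)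
  then show ?thesis using assms by (simp add: msq_def sq_int_def)
qed

lemma sq_int_cmult: "sq_int M f \<Longrightarrow> sq_int M (\<lambda>x. c * f x)"
  by (auto simp: sq_int_def norm_mult power_mult_distrib)

lemma msq_cmult: "msq M (\<lambda>x. c * f x) = (cmod c)\<^sup>2 * msq M f"
  by (simp add: msq_def norm_mult power_mult_distrib)

lemma sq_int_diff: "sq_int M f \<Longrightarrow> sq_int M g \<Longrightarrow> sq_int M (\<lambda>x. f x - g x)"
  using sq_int_add[of M f "\<lambda>x. - 1 * g x"] sq_int_cmult[of M g "- 1"] by simp

lemma sq_int_zero [simp]: "sq_int M (\<lambda>x. 0)"
  by (simp add: sq_int_def)

lemma sq_int_sum: "(\<And>i. i \<in> I \<Longrightarrow> sq_int M (f i)) \<Longrightarrow> sq_int M (\<lambda>x. \<Sum>i\<in>I. f i x)"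
  by (induction I rule: infinite_finite_induct) (auto intro: sq_int_add)

lemma integrable_mult_cnj:
  assumes "sq_int M f" "sq_int M g"
  shows "integrable M (\<lambda>x. f x * cnj (g x))"
proof (rule Bochner_Integration.integrable_bound)
  show "integrable M (\<lambda>x. (cmod (f x))\<^sup>2 + (cmod (g x))\<^sup>2)" using assms by (auto simp: sq_int_def)
  show "(\<lambda>x. f x * cnj (g x)) \<in> borel_measurable M"
    using assms measurable_compose[OF _ borel_measurable_continuous_onI[OF continuous_on_cnj[OF continuous_on_id]]]
    unfolding sq_int_def by (intro borel_measurable_times) blast+
  have "u * v \<le> u\<^sup>2 + v\<^sup>2" for u v :: real
    using zero_le_power2[of "u - v"] zero_le_power2[of "u + v"] by (simp add: power2_eq_square algebra_simps)
  then show "AE x in M. norm (f x * cnj (g x)) \<le> norm ((cmod (f x))\<^sup>2 + (cmod (g x))\<^sup>2)"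
    by (intro AE_I2) (simp add: norm_mult)
qed

lemma msq_add:
  assumes "sq_int M f" "sq_int M g"
  shows "msq M (\<lambda>x. f x + g x) = msq M f + msq M g + 2 * Re (\<integral>x. f x * cnj (g x) \<partial>M)"
proof -
  define r where "r x = Re (f x * cnj (g x))" for x
  have "integrable M r"
    unfolding r_def[abs_def] using integrable_mult_cnj[OF assms] by (rule integrable_Re)
  moreover have "(\<integral>x. r x \<partial>M) = Re (\<integral>x. f x * cnj (g x) \<partial>M)"
    unfolding r_def[abs_def] using integrable_mult_cnj[OF assms] by (rule integral_Re)
  ultimately show ?thesis
    using assms unfolding msq_def cmod_add_power2 sq_int_def r_def[symmetric] by simp
qed

lemma of_real_msq: "of_real (msq M f) = (\<integral>x. f x * cnj (f x) \<partial>M)"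
  unfolding msq_def integral_complex_of_real[symmetric] complex_norm_square ..

context finite_measure
begin

lemma sq_int_bounded:
  assumes "f \<in> borel_measurable M" "\<And>x. x \<in> space M \<Longrightarrow> cmod (f x) \<le> B"
  shows "sq_int M f"
  by (rule sq_int_bound[where w = "\<lambda>_. B\<^sup>2"]) (use assms in \<open>auto intro: power_mono\<close>)

lemma sq_int_const: "sq_int M (\<lambda>x. c)"
  by (rule sq_int_bounded[where B = "cmod c"]) auto

lemma sq_int_integrable: "sq_int M f \<Longrightarrow> integrable M f"
  using integrable_mult_cnj[of M f "\<lambda>_. 1"] sq_int_const[of 1] by simp

end

text \<open>Pointwise, the difference of the squares is at most \<open>(1 + 1 / \<delta>)\<close>
  times the squared error plus \<delta> times the square of the limit. For fixed \<delta> the first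
  part tends to 0 and the second is small.\<close>

lemma msq_tendsto:
  assumes u: "sq_int M u" and v: "\<And>n. sq_int M (v n)"
    and lim: "(\<lambda>n. msq M (\<lambda>x. v n x - u x)) \<longlonglongrightarrow> 0"
  shows "(\<lambda>n. msq M (v n)) \<longlonglongrightarrow> msq M u"
proof (rule LIMSEQ_I)
  fix \<epsilon> :: real assume "\<epsilon> > 0"
  \<comment> \<open>Chosen to make \<open>\<delta> * msq M u\<close> at most half of \<epsilon>;
    adding 1 covers the case \<open>msq M u = 0\<close>.\<close>
  define \<delta> where "\<delta> = \<epsilon> / (2 * (msq M u + 1))"
  have mu: "msq M u + 1 > 0" using msq_nonneg[of M u] by linarith
  have \<delta>: "\<delta> > 0" using \<open>\<epsilon> > 0\<close> mu by (simp add: \<delta>_def)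
  have est: "\<bar>msq M (v n) - msq M u\<bar> \<le> (1 + 1 / \<delta>) * msq M (\<lambda>x. v n x - u x) + \<delta> * msq M u" for n
  proof -
    have dif: "sq_int M (\<lambda>x. v n x - u x)" by (intro sq_int_diff u v)
    have pt: "\<bar>(cmod (v n x))\<^sup>2 - (cmod (u x))\<^sup>2\<bar> \<le> (1 + 1 / \<delta>) * (cmod (v n x - u x))\<^sup>2 + \<delta> * (cmod (u x))\<^sup>2" for x
    proof -
      define p q where "p = cmod (v n x - u x)" and "q = cmod (u x)"
      have "(cmod (v n x))\<^sup>2 = p\<^sup>2 + q\<^sup>2 + 2 * Re ((v n x - u x) * cnj (u x))"
        using cmod_add_power2[of "v n x - u x" "u x"] by (simp add: p_def q_def)
      moreover have "\<bar>Re ((v n x - u x) * cnj (u x))\<bar> \<le> p * q"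
        using abs_Re_le_cmod[of "(v n x - u x) * cnj (u x)"] by (simp add: norm_mult p_def q_def)
      ultimately have "\<bar>(cmod (v n x))\<^sup>2 - q\<^sup>2\<bar> \<le> p\<^sup>2 + 2 * (p * q)"
        using zero_le_power2[of p] by linarith
      moreover have "2 * (p * q) \<le> 1 / \<delta> * p\<^sup>2 + \<delta> * q\<^sup>2"
      proof -
        have "0 \<le> (p - \<delta> * q)\<^sup>2 / \<delta>" using \<delta> by simp
        also have "\<dots> = 1 / \<delta> * p\<^sup>2 + \<delta> * q\<^sup>2 - 2 * (p * q)"
          using \<delta> by (simp add: power2_eq_square field_simps)
        finally show ?thesis by simp
      qed
      ultimately have "\<bar>(cmod (v n x))\<^sup>2 - q\<^sup>2\<bar> \<le> (1 + 1 / \<delta>) * p\<^sup>2 + \<delta> * q\<^sup>2"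
        by (simp add: distrib_right)
      then show ?thesis by (simp add: p_def q_def)
    qed
    have "\<bar>msq M (v n) - msq M u\<bar> = \<bar>\<integral>x. (cmod (v n x))\<^sup>2 - (cmod (u x))\<^sup>2 \<partial>M\<bar>"
      using u v[of n] by (simp add: msq_def sq_int_def)
    also have "\<dots> \<le> (\<integral>x. \<bar>(cmod (v n x))\<^sup>2 - (cmod (u x))\<^sup>2\<bar> \<partial>M)" by (rule integral_abs_bound)
    also have "\<dots> \<le> (\<integral>x. (1 + 1 / \<delta>) * (cmod (v n x - u x))\<^sup>2 + \<delta> * (cmod (u x))\<^sup>2 \<partial>M)"
      using u v[of n] dif pt by (intro integral_mono) (auto simp: sq_int_def)
    also have "\<dots> = (1 + 1 / \<delta>) * msq M (\<lambda>x. v n x - u x) + \<delta> * msq M u"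
      using u dif by (simp add: msq_def sq_int_def)
    finally show ?thesis .
  qed
  have "(\<lambda>n. (1 + 1 / \<delta>) * msq M (\<lambda>x. v n x - u x)) \<longlonglongrightarrow> (1 + 1 / \<delta>) * 0"
    by (intro tendsto_intros lim)
  then obtain n0 where n0: "\<And>n. n \<ge> n0 \<Longrightarrow> \<bar>(1 + 1 / \<delta>) * msq M (\<lambda>x. v n x - u x)\<bar> < \<epsilon> / 2"
    using LIMSEQ_D[of "\<lambda>n. (1 + 1 / \<delta>) * msq M (\<lambda>x. v n x - u x)" 0 "\<epsilon> / 2"] \<open>\<epsilon> > 0\<close>
    by (simp add: field_simps) blast
  have "\<delta> * msq M u \<le> \<delta> * (msq M u + 1)" using \<delta> by simp
  also have "\<dots> = \<epsilon> / 2" using mu by (simp add: \<delta>_def field_simps)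
  finally have "\<delta> * msq M u \<le> \<epsilon> / 2" .
  then have "norm (msq M (v n) - msq M u) < \<epsilon>" if "n \<ge> n0" for n
    using est[of n] n0[OF that] unfolding real_norm_def by linarith
  then show "\<exists>n0. \<forall>n\<ge>n0. norm (msq M (v n) - msq M u) < \<epsilon>" by blast
qed

section \<open>Expansions in a bounded orthonormal family exhausted by finite index sets\<close>

locale orthonormal_family = prob_space C
  for C :: "'a measure" and e :: "'k \<Rightarrow> 'a \<Rightarrow> complex" and B :: "nat \<Rightarrow> 'k set" +
  assumes finite_B: "finite (B K)" and mono_B: "K \<le> K' \<Longrightarrow> B K \<subseteq> B K'"
    and e_measurable: "k \<in> B K \<Longrightarrow> e k \<in> borel_measurable C"
    and e_bounded: "k \<in> B K \<Longrightarrow> cmod (e k x) \<le> 1"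
    and orthonormal: "k \<in> B K \<Longrightarrow> k' \<in> B K \<Longrightarrow> (\<integral>x. e k x * cnj (e k' x) \<partial>C) = of_bool (k = k')"
begin

definition fcoeff :: "('a \<Rightarrow> complex) \<Rightarrow> 'k \<Rightarrow> complex" where
  "fcoeff f k = (\<integral>x. f x * cnj (e k x) \<partial>C)"

definition combo :: "('k \<Rightarrow> complex) \<Rightarrow> nat \<Rightarrow> 'a \<Rightarrow> complex" where
  "combo c K x = (\<Sum>k\<in>B K. c k * e k x)"

text \<open>Membership in the mean-square closure of the span, stated per function so that density
  can be reached by closure properties.\<close>

definition approximable :: "('a \<Rightarrow> complex) \<Rightarrow> bool" where
  "approximable f \<longleftrightarrow> (\<forall>\<epsilon>>0. \<exists>K c. msq C (\<lambda>x. f x - combo c K x) < \<epsilon>)"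

lemma sq_int_e: "k \<in> B K \<Longrightarrow> sq_int C (e k)"
  by (rule sq_int_bounded) (auto intro: e_measurable e_bounded)

lemma sq_int_combo: "sq_int C (combo c K)"
  unfolding combo_def[abs_def] by (intro sq_int_sum sq_int_cmult sq_int_e)

lemma combo_mono: "K \<le> K' \<Longrightarrow> combo c K = combo (\<lambda>k. if k \<in> B K then c k else 0) K'"
  unfolding combo_def using mono_B finite_B
  by (intro ext sum.mono_neutral_cong_left) auto

lemma fcoeff_diff_combo:
  assumes f: "sq_int C f" and k: "k \<in> B K"
  shows "fcoeff (\<lambda>x. f x - combo c K x) k = fcoeff f k - c k"
proof -
  have int: "integrable C (\<lambda>x. e k' x * cnj (e k x))" if "k' \<in> B K" for k'
    by (rule integrable_mult_cnj) (use sq_int_e that k in auto)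
  have "(\<lambda>x. combo c K x * cnj (e k x)) = (\<lambda>x. \<Sum>k'\<in>B K. c k' * (e k' x * cnj (e k x)))"
    by (simp add: combo_def sum_distrib_right mult.assoc)
  then have "(\<integral>x. combo c K x * cnj (e k x) \<partial>C) = (\<Sum>k'\<in>B K. c k' * (\<integral>x. e k' x * cnj (e k x) \<partial>C))"
    using int by (simp add: Bochner_Integration.integral_sum)
  also have "\<dots> = (\<Sum>k'\<in>B K. if k' = k then c k' else 0)"
    by (intro sum.cong refl) (simp add: orthonormal[OF _ k])
  also have "\<dots> = c k" using finite_B k by simp
  finally show ?thesis
    using integrable_mult_cnj[OF f sq_int_e[OF k]] integrable_mult_cnj[OF sq_int_combo sq_int_e[OF k]]
    by (simp add: fcoeff_def left_diff_distrib)
qed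

text \<open>The remainder \<open>h\<close> has vanishing coefficients on \<open>B K\<close>, hence
  is orthogonal to the span, and the error of any other combination exceeds that of \<open>h\<close>
  by \<open>msq C q\<close> (Pythagoras).\<close>

lemma best_approximation:
  assumes f: "sq_int C f"
  shows "msq C (\<lambda>x. f x - combo (fcoeff f) K x) \<le> msq C (\<lambda>x. f x - combo c K x)"
proof -
  define h where "h x = f x - combo (fcoeff f) K x" for x
  define q where "q = combo (\<lambda>k. fcoeff f k - c k) K"
  have h: "sq_int C h" unfolding h_def by (intro sq_int_diff f sq_int_combo)
  have q: "sq_int C q" unfolding q_def by (rule sq_int_combo)
  have "(\<lambda>x. f x - combo c K x) = (\<lambda>x. h x + q x)"
    by (simp add: h_def q_def combo_def left_diff_distrib sum_subtractf)
  moreover have "(\<integral>x. h x * cnj (q x) \<partial>C) = 0"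
  proof -
    have "(\<lambda>x. h x * cnj (q x)) = (\<lambda>x. \<Sum>k\<in>B K. cnj (fcoeff f k - c k) * (h x * cnj (e k x)))"
      by (simp add: q_def combo_def sum_distrib_left mult_ac)
    then have "(\<integral>x. h x * cnj (q x) \<partial>C) = (\<Sum>k\<in>B K. cnj (fcoeff f k - c k) * fcoeff h k)"
      using integrable_mult_cnj[OF h sq_int_e] unfolding fcoeff_def[of h]
      by (simp add: Bochner_Integration.integral_sum)
    also have "\<dots> = 0"
      unfolding h_def using fcoeff_diff_combo[OF f] by (intro sum.neutral) simp
    finally show ?thesis .
  qed
  ultimately have "msq C (\<lambda>x. f x - combo c K x) = msq C h + msq C q"
    using msq_add[OF h q] by simp
  then show ?thesis using msq_nonneg[of C q] by (simp add: h_def[abs_def])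
qed

text \<open>A good combination at one level remains available at all later levels after padding with
  zeros, and the coefficients of \<open>f\<close> do at least as well there.\<close>

lemma partial_sums_converge:
  assumes f: "sq_int C f" and "approximable f"
  shows "(\<lambda>K. msq C (\<lambda>x. f x - combo (fcoeff f) K x)) \<longlonglongrightarrow> 0"
proof (rule LIMSEQ_I)
  fix \<epsilon> :: real assume "\<epsilon> > 0"
  then obtain K c where Kc: "msq C (\<lambda>x. f x - combo c K x) < \<epsilon>"
    using assms(2) unfolding approximable_def by blast
  have "msq C (\<lambda>x. f x - combo (fcoeff f) K' x) < \<epsilon>" if "K \<le> K'" for K'
    using best_approximation[OF f, of K'] Kc unfolding combo_mono[OF that, of c] by (rule le_less_trans)
  then show "\<exists>n0. \<forall>n\<ge>n0. norm (msq C (\<lambda>x. f x - combo (fcoeff f) n x) - 0) < \<epsilon>"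
    by (intro exI[of _ K]) (simp add: msq_nonneg)
qed

lemma approximable_combo: "approximable (combo c K)"
  unfolding approximable_def by (auto intro!: exI[of _ K] exI[of _ c] simp: msq_def)

lemma approximable_AE_cong:
  assumes "sq_int C f" "sq_int C g" "AE x in C. f x = g x" "approximable f"
  shows "approximable g"
proof -
  have "msq C (\<lambda>x. g x - combo c K x) = msq C (\<lambda>x. f x - combo c K x)" for c K
    unfolding msq_def
  proof (rule integral_cong_AE)
    show "(\<lambda>x. (cmod (g x - combo c K x))\<^sup>2) \<in> borel_measurable C"
      using sq_int_diff[OF assms(2) sq_int_combo] by (simp add: sq_int_def borel_measurable_integrable)
    show "(\<lambda>x. (cmod (f x - combo c K x))\<^sup>2) \<in> borel_measurable C"
      using sq_int_diff[OF assms(1) sq_int_combo] by (simp add: sq_int_def borel_measurable_integrable)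
  qed (use assms(3) in auto)
  then show ?thesis using assms(4) by (simp add: approximable_def)
qed

lemma approximable_limit:
  assumes f: "sq_int C f"
    and g: "\<And>n :: nat. sq_int C (g n)" "\<And>n. approximable (g n)"
    and lim: "(\<lambda>n. msq C (\<lambda>x. f x - g n x)) \<longlonglongrightarrow> 0"
  shows "approximable f"
  unfolding approximable_def
proof (intro allI impI)
  fix \<epsilon> :: real assume "\<epsilon> > 0"
  then obtain n where "norm (msq C (\<lambda>x. f x - g n x) - 0) < \<epsilon> / 4"
    \<comment> \<open>Quarters, because \<open>msq_add_le\<close> doubles each of the two
      errors.\<close>
    using LIMSEQ_D[OF lim, of "\<epsilon> / 4"] by fastforce
  then have n: "msq C (\<lambda>x. f x - g n x) < \<epsilon> / 4" by simp
  have "\<epsilon> / 4 > 0" using \<open>\<epsilon> > 0\<close> by simp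
  then obtain K c where Kc: "msq C (\<lambda>x. g n x - combo c K x) < \<epsilon> / 4"
    using g(2)[of n] unfolding approximable_def by blast
  have "msq C (\<lambda>x. f x - combo c K x) \<le>
      2 * msq C (\<lambda>x. f x - g n x) + 2 * msq C (\<lambda>x. g n x - combo c K x)"
    using msq_add_le[OF sq_int_diff[OF f g(1)] sq_int_diff[OF g(1)[of n] sq_int_combo], of n c K] by simp
  also have "\<dots> < \<epsilon>" using n Kc by simp
  finally show "\<exists>K c. msq C (\<lambda>x. f x - combo c K x) < \<epsilon>" by blast
qed

lemma approximable_add:
  assumes "sq_int C f" "sq_int C g" "approximable f" "approximable g"
  shows "approximable (\<lambda>x. f x + g x)"
  unfolding approximable_def
proof (intro allI impI)
  fix \<epsilon> :: real assume "\<epsilon> > 0"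
  then have "\<epsilon> / 4 > 0" by simp
  obtain K c where fK: "msq C (\<lambda>x. f x - combo c K x) < \<epsilon> / 4"
    using assms(3) \<open>\<epsilon> / 4 > 0\<close> unfolding approximable_def by blast
  obtain K' c' where gK: "msq C (\<lambda>x. g x - combo c' K' x) < \<epsilon> / 4"
    using assms(4) \<open>\<epsilon> / 4 > 0\<close> unfolding approximable_def by blast
  define L where "L = max K K'"
  define u where "u k = (if k \<in> B K then c k else 0) + (if k \<in> B K' then c' k else 0)" for k
  have L: "K \<le> L" "K' \<le> L" by (simp_all add: L_def)
  have "combo u L x = combo c K x + combo c' K' x" for x
    unfolding combo_mono[OF L(1), of c] combo_mono[OF L(2), of c']
    by (simp add: combo_def u_def distrib_right sum.distrib)
  then have "msq C (\<lambda>x. f x + g x - combo u L x) =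
      msq C (\<lambda>x. (f x - combo c K x) + (g x - combo c' K' x))"
    by (simp add: algebra_simps)
  also have "\<dots> \<le> 2 * msq C (\<lambda>x. f x - combo c K x) + 2 * msq C (\<lambda>x. g x - combo c' K' x)"
    by (intro msq_add_le sq_int_diff assms sq_int_combo)
  also have "\<dots> < \<epsilon>" using fK gK by simp
  finally show "\<exists>K c. msq C (\<lambda>x. f x + g x - combo c K x) < \<epsilon>" by blast
qed

lemma approximable_cmult:
  assumes "approximable f"
  shows "approximable (\<lambda>x. a * f x)"
  unfolding approximable_def
proof (intro allI impI)
  fix \<epsilon> :: real assume "\<epsilon> > 0"
  \<comment> \<open>The added 1 permits \<open>a = 0\<close> and leaves room for a strict
    inequality.\<close>
  define \<delta> where "\<delta> = \<epsilon> / ((cmod a)\<^sup>2 + 1)"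
  have p: "(cmod a)\<^sup>2 + 1 > 0" using zero_le_power2[of "cmod a"] by linarith
  then have "\<delta> > 0" using \<open>\<epsilon> > 0\<close> by (simp add: \<delta>_def)
  then obtain K c where Kc: "msq C (\<lambda>x. f x - combo c K x) < \<delta>"
    using assms unfolding approximable_def by blast
  have "msq C (\<lambda>x. a * f x - combo (\<lambda>k. a * c k) K x) = msq C (\<lambda>x. a * (f x - combo c K x))"
    by (simp add: combo_def right_diff_distrib sum_distrib_left mult.assoc)
  also have "\<dots> = (cmod a)\<^sup>2 * msq C (\<lambda>x. f x - combo c K x)" by (rule msq_cmult)
  also have "\<dots> \<le> (cmod a)\<^sup>2 * \<delta>" using Kc by (intro mult_left_mono) auto
  also have "\<dots> < ((cmod a)\<^sup>2 + 1) * \<delta>" using \<open>\<delta> > 0\<close> by simp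
  also have "\<dots> = \<epsilon>" using p by (simp add: \<delta>_def)
  finally show "\<exists>K c. msq C (\<lambda>x. a * f x - combo c K x) < \<epsilon>" by blast
qed

lemma approximable_zero: "approximable (\<lambda>x. 0)"
  using approximable_combo[of "\<lambda>_. 0" 0] by (simp add: combo_def[abs_def])

lemma approximable_sum:
  assumes "\<And>i. i \<in> I \<Longrightarrow> sq_int C (f i)" "\<And>i. i \<in> I \<Longrightarrow> approximable (f i)"
  shows "approximable (\<lambda>x. \<Sum>i\<in>I. f i x)"
  using assms
  by (induction I rule: infinite_finite_induct)
     (auto intro!: approximable_zero approximable_add sq_int_sum)

lemma sq_int_indicator: "A \<in> sets C \<Longrightarrow> sq_int C (indicator A)"
  by (rule sq_int_bounded[where B = 1]) (auto simp: indicator_def)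

lemma msq_tendsto_0:
  assumes "\<And>n. sq_int C (g n)" "integrable C w"
    and "\<And>n x. x \<in> space C \<Longrightarrow> (cmod (g n x))\<^sup>2 \<le> w x"
    and lim: "\<And>x. x \<in> space C \<Longrightarrow> (\<lambda>n. g n x) \<longlonglongrightarrow> 0"
  shows "(\<lambda>n. msq C (g n)) \<longlonglongrightarrow> 0"
proof -
  have "(\<lambda>n. \<integral>x. (cmod (g n x))\<^sup>2 \<partial>C) \<longlonglongrightarrow> (\<integral>x. 0 \<partial>C)"
  proof (rule integral_dominated_convergence[where w = w])
    show "AE x in C. (\<lambda>n. (cmod (g n x))\<^sup>2) \<longlonglongrightarrow> 0"
    proof (rule AE_I2)
      fix x assume "x \<in> space C"
      from tendsto_power[OF tendsto_norm[OF lim[OF this]], of 2]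
      show "(\<lambda>n. (cmod (g n x))\<^sup>2) \<longlonglongrightarrow> 0" by simp
    qed
  qed (use assms in \<open>auto simp: sq_int_def\<close>)
  then show ?thesis by (simp add: msq_def)
qed

text \<open>Dynkin's argument: sets with approximable indicator are closed under complements, since
  constants are approximable, and under countable disjoint unions, by dominated convergence.\<close>

lemma approximable_indicator_sigma_sets:
  assumes E: "Int_stable E" "E \<subseteq> Pow (space C)" and sub: "sigma_sets (space C) E \<subseteq> sets C"
    and one: "approximable (\<lambda>x. 1)" and basic: "\<And>A. A \<in> E \<Longrightarrow> approximable (indicator A)"
    and A: "A \<in> sigma_sets (space C) E"
  shows "approximable (indicator A)"
  using E A
proof (induction rule: sigma_sets_induct_disjoint)
  case (basic A)
  then show ?case by (rule assms(5))
next
  case empty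
  then show ?case using approximable_zero by (simp add: indicator_def[abs_def])
next
  case (compl A)
  then have A: "A \<in> sets C" using sub by blast
  have "approximable (\<lambda>x. 1 + - 1 * indicator A x)"
    by (intro approximable_add approximable_cmult one compl sq_int_const sq_int_cmult sq_int_indicator A)
  moreover have "sq_int C (\<lambda>x. 1 + - 1 * indicator A x)"
    by (intro sq_int_add sq_int_const sq_int_cmult sq_int_indicator A)
  moreover have "AE x in C. 1 + - 1 * indicator A x = (indicator (space C - A) x :: complex)"
    by (intro AE_I2) (auto simp: indicator_def)
  moreover have "sq_int C (indicator (space C - A))" using A by (intro sq_int_indicator) auto
  ultimately show ?case using approximable_AE_cong by blast
next
  case (union A)
  have A: "A i \<in> sets C" for i using union(2) sub by blast
  have U: "(\<Union>i. A i) \<in> sets C" using A by auto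
  let ?g = "\<lambda>n x. \<Sum>i<n. indicator (A i) x :: complex"
  have sum_eq: "?g n x = indicator (\<Union>i<n. A i) x" for n x
    by (rule indicator_UN_disjoint[symmetric]) (use union(1) in \<open>auto simp: disjoint_family_on_def\<close>)
  have "(\<lambda>n. msq C (\<lambda>x. indicator (\<Union>i. A i) x - ?g n x)) \<longlonglongrightarrow> 0"
  proof (rule msq_tendsto_0[where w = "\<lambda>_. 1"])
    show "sq_int C (\<lambda>x. indicator (\<Union>i. A i) x - ?g n x)" for n
      by (intro sq_int_diff sq_int_sum sq_int_indicator A U)
    show "(cmod (indicator (\<Union>i. A i) x - ?g n x))\<^sup>2 \<le> 1" for n x
      unfolding sum_eq by (auto simp: indicator_def)
    show "(\<lambda>n. indicator (\<Union>i. A i) x - ?g n x) \<longlonglongrightarrow> 0" for x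
    proof (cases "x \<in> (\<Union>i. A i)")
      case True
      then obtain j where "x \<in> A j" by blast
      then have "indicator (\<Union>i. A i) x - ?g n x = 0" if "n \<ge> Suc j" for n
        unfolding sum_eq using that by (auto simp: indicator_def)
      then show ?thesis by (intro tendsto_eventually eventually_sequentiallyI[of "Suc j"])
    next
      case False
      then have "indicator (\<Union>i. A i) x - ?g n x = 0" for n unfolding sum_eq by (auto simp: indicator_def)
      then show ?thesis by simp
    qed
  qed simp
  moreover have "sq_int C (?g n)" for n by (intro sq_int_sum sq_int_indicator A)
  moreover have "approximable (?g n)" for n by (intro approximable_sum sq_int_indicator A union(3))
  ultimately show ?case using approximable_limit[OF sq_int_indicator[OF U], of ?g] by blast
qed

text \<open>Simple functions \<open>F i\<close> converge to \<open>f\<close> pointwise and are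
  dominated by \<open>2 * cmod (f x)\<close>, so the squared error is at most 9 times the square of
  \<open>cmod (f x)\<close> and dominated convergence applies.\<close>

lemma approximable_if_indicators:
  assumes ind: "\<And>A. A \<in> sets C \<Longrightarrow> approximable (indicator A)" and f: "sq_int C f"
  shows "approximable f"
proof -
  have "f \<in> borel_measurable C" using f by (simp add: sq_int_def)
  from borel_measurable_implies_sequence_metric[OF this, of 0]
  obtain F where F: "\<And>i. simple_function C (F i)"
    "\<And>x. x \<in> space C \<Longrightarrow> (\<lambda>i. F i x) \<longlonglongrightarrow> f x"
    "\<And>i x. x \<in> space C \<Longrightarrow> cmod (F i x) \<le> 2 * cmod (f x)"
    by (simp add: dist_norm) blast
  let ?A = "\<lambda>i y. F i -` {y} \<inter> space C"
  have A: "?A i y \<in> sets C" for i y using F(1) by (rule simple_functionD(2))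
  \<comment> \<open>\<open>F i\<close> written literally as a combination of indicators, so that the
    closure lemmas apply. The two agree on \<open>space C\<close>; outside it \<open>G i\<close> is
    0.\<close>
  define G where "G i x = (\<Sum>y\<in>F i ` space C. y * indicator (?A i y) x)" for i x
  have GF: "G i x = F i x" if "x \<in> space C" for i x
  proof -
    have "G i x = (\<Sum>y\<in>F i ` space C. if y = F i x then y else 0)"
      unfolding G_def using that by (intro sum.cong) (auto simp: indicator_def)
    then show ?thesis using that simple_functionD(1)[OF F(1)] by simp
  qed
  have sqG: "sq_int C (G i)" for i
    unfolding G_def[abs_def] by (intro sq_int_sum sq_int_cmult sq_int_indicator A)
  have appG: "approximable (G i)" for i
    unfolding G_def[abs_def]
    by (intro approximable_sum approximable_cmult sq_int_cmult sq_int_indicator ind A)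
  have "(\<lambda>i. msq C (\<lambda>x. f x - G i x)) \<longlonglongrightarrow> 0"
  proof (rule msq_tendsto_0[where w = "\<lambda>x. 9 * (cmod (f x))\<^sup>2"])
    show "sq_int C (\<lambda>x. f x - G i x)" for i by (intro sq_int_diff f sqG)
    show "(cmod (f x - G i x))\<^sup>2 \<le> 9 * (cmod (f x))\<^sup>2" if "x \<in> space C" for i x
    proof -
      have "cmod (f x - G i x) \<le> 3 * cmod (f x)"
        using norm_triangle_ineq4[of "f x" "F i x"] F(3)[OF that, of i] GF[OF that] by simp
      then have "(cmod (f x - G i x))\<^sup>2 \<le> (3 * cmod (f x))\<^sup>2" by (intro power_mono) auto
      then show ?thesis by (simp add: power_mult_distrib)
    qed
    show "(\<lambda>i. f x - G i x) \<longlonglongrightarrow> 0" if "x \<in> space C" for x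
      using tendsto_diff[OF tendsto_const[of "f x"] F(2)[OF that]] GF[OF that] by simp
    show "integrable C (\<lambda>x. 9 * (cmod (f x))\<^sup>2)" using f by (simp add: sq_int_def)
  qed
  then show ?thesis by (rule approximable_limit[OF f sqG appG])
qed

text \<open>
  On the span of the \<open>e k\<close> the second moment of the average is diagonal, and the average is a
  contraction in mean square.
\<close>

lemma second_moment_average:
  fixes Q :: "'w measure" and Y :: "nat \<Rightarrow> 'w \<Rightarrow> 'a" and \<rho> :: "nat \<Rightarrow> nat \<Rightarrow> 'k \<Rightarrow> real"
  assumes Y: "\<And>n. Y n \<in> measurable Q C" and law: "\<And>n. distr Q C (Y n) = C"
    and joint: "\<forall>K. \<forall>n<N. \<forall>n'<N. \<forall>k\<in>B K. \<forall>k'\<in>B K.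
      (\<integral>w. e k (Y n w) * cnj (e k' (Y n' w)) \<partial>Q) = of_bool (k = k') * of_real (\<rho> n n' k)"
    and N: "N > 0"
  defines "avg \<equiv> \<lambda>g w. 1 / of_nat N * (\<Sum>n<N. g (Y n w))"
    and "\<Gamma> \<equiv> \<lambda>k. 1 / (real N)\<^sup>2 * (\<Sum>n<N. \<Sum>n'<N. \<rho> n n' k)"
  shows "sq_int C f \<Longrightarrow> sq_int Q (avg f)"
    and "msq Q (avg (combo c K)) = (\<Sum>k\<in>B K. (cmod (c k))\<^sup>2 * \<Gamma> k)"
    and "sq_int C f \<Longrightarrow> approximable f \<Longrightarrow>
      (\<lambda>K. \<Sum>k\<in>B K. (cmod (fcoeff f k))\<^sup>2 * \<Gamma> k) \<longlonglongrightarrow> msq Q (avg f)"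
proof -
  have pull: "sq_int Q (\<lambda>w. g (Y n w))" "msq Q (\<lambda>w. g (Y n w)) = msq C g" if g: "sq_int C g" for g n
  proof -
    have gm: "g \<in> borel_measurable C" and gi: "integrable C (\<lambda>x. (cmod (g x))\<^sup>2)"
      using g by (auto simp: sq_int_def)
    have gi': "integrable (distr Q C (Y n)) (\<lambda>x. (cmod (g x))\<^sup>2)" unfolding law by (rule gi)
    show "sq_int Q (\<lambda>w. g (Y n w))"
      unfolding sq_int_def
      using measurable_compose[OF Y gm] integrable_distr[OF Y gi'] by simp
    show "msq Q (\<lambda>w. g (Y n w)) = msq C g"
      using integral_distr[OF Y, of "\<lambda>x. (cmod (g x))\<^sup>2" n] gm unfolding law by (simp add: msq_def)
  qed
  show sq_avg: "sq_int Q (avg g)" if "sq_int C g" for g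
    unfolding avg_def by (intro sq_int_cmult sq_int_sum pull that)
  \<comment> \<open>The squared mean is at most the mean of the squares, and each \<open>Y n\<close>
    has law \<open>C\<close>. The bound holds for every square integrable \<open>g\<close>, which is
    what lets the formula leave the span.\<close>
  have contr: "msq Q (avg g) \<le> msq C g" if g: "sq_int C g" for g
  proof -
    have "(cmod (avg g w))\<^sup>2 \<le> 1 / N * (\<Sum>n<N. (cmod (g (Y n w)))\<^sup>2)" for w
    proof -
      have "(cmod (\<Sum>n<N. g (Y n w)))\<^sup>2 \<le> (\<Sum>n<N. cmod (g (Y n w)))\<^sup>2"
        by (intro power_mono norm_sum) auto
      also have "\<dots> \<le> (\<Sum>n<N. (cmod (g (Y n w)))\<^sup>2) * N"
        using sum_squared_le_sum_of_squares[of "\<lambda>n. cmod (g (Y n w))" "{..<N}"] by simp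
      finally have "(cmod (avg g w))\<^sup>2 \<le> (1 / N)\<^sup>2 * ((\<Sum>n<N. (cmod (g (Y n w)))\<^sup>2) * N)"
        unfolding avg_def norm_mult power_mult_distrib by (simp add: norm_divide divide_right_mono power_divide)
      then show ?thesis using N by (simp add: power2_eq_square)
    qed
    then have "msq Q (avg g) \<le> (\<integral>w. 1 / N * (\<Sum>n<N. (cmod (g (Y n w)))\<^sup>2) \<partial>Q)"
      unfolding msq_def using sq_avg[OF g] pull(1)[OF g]
      by (intro integral_mono) (auto simp: sq_int_def)
    also have "\<dots> = 1 / N * (\<Sum>n<N. msq Q (\<lambda>w. g (Y n w)))"
      using pull(1)[OF g] by (simp add: msq_def sq_int_def Bochner_Integration.integral_sum)
    also have "\<dots> = msq C g" using pull(2)[OF g] N by simp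
    finally show ?thesis .
  qed
  show diag: "msq Q (avg (combo c K)) = (\<Sum>k\<in>B K. (cmod (c k))\<^sup>2 * \<Gamma> k)" for c K
  proof -
    define t where "t k = 1 / of_nat N * c k" for k
    have t: "t k * e k x * (cnj (t k') * cnj (e k' y)) = (1 / of_nat N)\<^sup>2 * c k * cnj (c k') * (e k x * cnj (e k' y))"
      for k k' x y by (simp add: t_def power2_eq_square)
    have avg_t: "avg (combo c K) w = (\<Sum>n<N. \<Sum>k\<in>B K. t k * e k (Y n w))" for w
      by (simp add: avg_def combo_def t_def sum_divide_distrib)
    have "avg (combo c K) w * cnj (avg (combo c K) w) = (\<Sum>n<N. \<Sum>n'<N. \<Sum>k\<in>B K. \<Sum>k'\<in>B K.
      (1 / of_nat N)\<^sup>2 * c k * cnj (c k') * (e k (Y n w) * cnj (e k' (Y n' w))))" for w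
      unfolding avg_t cnj_sum complex_cnj_mult sum_product t ..
    then have "of_real (msq Q (avg (combo c K))) = (\<integral>w. (\<Sum>n<N. \<Sum>n'<N. \<Sum>k\<in>B K. \<Sum>k'\<in>B K.
      (1 / of_nat N)\<^sup>2 * c k * cnj (c k') * (e k (Y n w) * cnj (e k' (Y n' w)))) \<partial>Q)"
      unfolding of_real_msq by (simp only:)
    also have "\<dots> = (\<Sum>n<N. \<Sum>n'<N. \<Sum>k\<in>B K. \<Sum>k'\<in>B K.
      (1 / of_nat N)\<^sup>2 * c k * cnj (c k') * (\<integral>w. e k (Y n w) * cnj (e k' (Y n' w)) \<partial>Q))"
    proof -
      have int: "integrable Q (\<lambda>w. e k (Y n w) * cnj (e k' (Y n' w)))"
        if "k \<in> B K" "k' \<in> B K" for k k' n n'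
        by (intro integrable_mult_cnj pull(1) sq_int_e[OF that(1)] sq_int_e[OF that(2)])
      show ?thesis
        using int by (simp add: Bochner_Integration.integral_sum Bochner_Integration.integrable_sum)
    qed
    also have "\<dots> = (\<Sum>n<N. \<Sum>n'<N. \<Sum>k\<in>B K. \<Sum>k'\<in>B K.
      if k = k' then (1 / of_nat N)\<^sup>2 * c k * cnj (c k) * of_real (\<rho> n n' k) else 0)"
      by (intro sum.cong refl) (simp add: joint)
    also have "\<dots> = (\<Sum>n<N. \<Sum>n'<N. \<Sum>k\<in>B K. (1 / of_nat N)\<^sup>2 * c k * cnj (c k) * of_real (\<rho> n n' k))"
      by (simp add: sum.delta' finite_B cong: sum.cong)
    also have "\<dots> = (\<Sum>n<N. \<Sum>k\<in>B K. \<Sum>n'<N. (1 / of_nat N)\<^sup>2 * c k * cnj (c k) * of_real (\<rho> n n' k))"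
      by (intro sum.cong refl sum.swap)
    also have "\<dots> = (\<Sum>k\<in>B K. \<Sum>n<N. \<Sum>n'<N. (1 / of_nat N)\<^sup>2 * c k * cnj (c k) * of_real (\<rho> n n' k))"
      by (rule sum.swap)
    also have "\<dots> = (\<Sum>k\<in>B K. of_real ((cmod (c k))\<^sup>2 * \<Gamma> k))"
    proof (intro sum.cong refl)
      fix k
      have "(\<Sum>n<N. \<Sum>n'<N. (1 / of_nat N)\<^sup>2 * c k * cnj (c k) * of_real (\<rho> n n' k)) =
        (1 / of_nat N)\<^sup>2 * (c k * cnj (c k)) * of_real (\<Sum>n<N. \<Sum>n'<N. \<rho> n n' k)"
        by (simp add: sum_distrib_left mult.assoc)
      then show "(\<Sum>n<N. \<Sum>n'<N. (1 / of_nat N)\<^sup>2 * c k * cnj (c k) * of_real (\<rho> n n' k)) =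
        of_real ((cmod (c k))\<^sup>2 * \<Gamma> k)"
        unfolding complex_norm_square[symmetric] \<Gamma>_def by (simp add: power_divide)
    qed
    finally show ?thesis unfolding of_real_sum[symmetric] of_real_eq_iff .
  qed
  show "(\<lambda>K. \<Sum>k\<in>B K. (cmod (fcoeff f k))\<^sup>2 * \<Gamma> k) \<longlonglongrightarrow> msq Q (avg f)"
    if f: "sq_int C f" and app: "approximable f"
  proof -
    have "(\<lambda>K. msq Q (avg (combo (fcoeff f) K))) \<longlonglongrightarrow> msq Q (avg f)"
    proof (rule msq_tendsto[OF sq_avg[OF f] sq_avg[OF sq_int_combo]])
      \<comment> \<open>By linearity the difference of the averages is, up to sign, the average of
        the remainder, so the contraction bounds it.\<close>
      have "msq Q (\<lambda>w. avg (combo (fcoeff f) K) w - avg f w) \<le> msq C (\<lambda>x. f x - combo (fcoeff f) K x)" for K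
      proof -
        have "(\<lambda>w. avg (combo (fcoeff f) K) w - avg f w) = (\<lambda>w. - 1 * avg (\<lambda>x. f x - combo (fcoeff f) K x) w)"
          by (simp add: avg_def sum_subtractf diff_divide_distrib)
        then have "msq Q (\<lambda>w. avg (combo (fcoeff f) K) w - avg f w) = msq Q (avg (\<lambda>x. f x - combo (fcoeff f) K x))"
          using msq_cmult[of Q "- 1" "avg (\<lambda>x. f x - combo (fcoeff f) K x)"] by simp
        then show ?thesis using contr[OF sq_int_diff[OF f sq_int_combo]] by simp
      qed
      then show "(\<lambda>K. msq Q (\<lambda>w. avg (combo (fcoeff f) K) w - avg f w)) \<longlonglongrightarrow> 0"
        by (intro tendsto_sandwich[OF _ _ tendsto_const partial_sums_converge[OF f app]])
           (auto simp: msq_nonneg)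
    qed
    then show ?thesis by (simp add: diag)
  qed
qed

end

subsection \<open>The variance formula\<close>

lemma cube_eq: "cube s = completion (prod_cube s)"
  by (simp add: cube_def prod_cube_def)

lemma prob_space_cube: "prob_space (cube s)"
  unfolding cube_eq by (rule prob_space.prob_space_completion[OF prob_space_prod_cube])

definition walsh_box :: "nat \<Rightarrow> nat \<Rightarrow> nat \<Rightarrow> nat \<Rightarrow> (nat \<Rightarrow> nat) set" where
  "walsh_box b d s K = (\<Pi>\<^sub>E j\<in>{1..d * s}. {..<b ^ K})"

text \<open>Walsh functions are indexed by the frequency before interlacing, because there both the
  blocks and the second moments factor over coordinates.\<close>

definition walsh_fun :: "nat \<Rightarrow> nat \<Rightarrow> nat \<Rightarrow> (nat \<Rightarrow> nat) \<Rightarrow> (nat \<Rightarrow> real) \<Rightarrow> complex" where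
  "walsh_fun b d s k = wal_vec b s (freq_interlace b d s k)"

lemma walsh_fun_eq:
  assumes "b \<ge> 2" "d \<ge> 1" "k \<in> walsh_box b d s K"
  shows "walsh_fun b d s k x = (\<Prod>j=1..d * s. \<Prod>r<K. chr b (ndigit b (k j) r * dgt b d x j r))"
  unfolding walsh_fun_def using assms
  by (intro wal_vec_freq_interlace) (auto simp: walsh_box_def PiE_iff)

lemma walsh_box_digit_less: "k \<in> walsh_box b d s K \<Longrightarrow> j \<in> {1..d * s} \<Longrightarrow> k j < b ^ K"
  by (auto simp: walsh_box_def PiE_iff)

lemma norm_walsh_fun:
  assumes "b \<ge> 2" "d \<ge> 1" "k \<in> walsh_box b d s K"
  shows "cmod (walsh_fun b d s k x) = 1"
  by (simp add: walsh_fun_eq[OF assms] prod_norm[symmetric])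

lemma finite_walsh_box: "finite (walsh_box b d s K)"
  unfolding walsh_box_def by (intro finite_PiE) auto

lemma walsh_box_mono: "b \<ge> 2 \<Longrightarrow> K \<le> K' \<Longrightarrow> walsh_box b d s K \<subseteq> walsh_box b d s K'"
  unfolding walsh_box_def using power_increasing[of K K' b] by (intro PiE_mono) auto

lemma measurable_chr: "g \<in> measurable M (count_space UNIV) \<Longrightarrow> (\<lambda>x. chr b (n * g x)) \<in> borel_measurable M"
  by (rule measurable_compose[where N = "count_space UNIV" and g = "\<lambda>y. chr b (n * y)"]) auto

lemma measurable_cnj: "g \<in> borel_measurable M \<Longrightarrow> (\<lambda>x. cnj (g x)) \<in> borel_measurable M"
  by (rule measurable_compose[OF _ borel_measurable_continuous_onI[OF continuous_on_cnj[OF continuous_on_id]]])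

lemma measurable_dgt:
  assumes d: "d \<ge> 1" and j: "j \<in> {1..d * s}"
  shows "(\<lambda>x. dgt b d x j r) \<in> measurable (prod_cube s) (count_space UNIV)"
proof -
  let ?i = "(j - 1) div d + 1"
  have "(\<lambda>x. x ?i) \<in> measurable (prod_cube s) (restrict_space lborel {0..1})"
    unfolding prod_cube_def by (rule measurable_component_singleton[OF interlaced_index(1)[OF d j]])
  moreover have "(\<lambda>y. rdigit b y (Suc ((j - 1) mod d + r * d))) \<in>
      measurable (restrict_space lborel {0..1}) (count_space UNIV)"
  proof (rule measurable_restrict_space1)
    show "(\<lambda>y. rdigit b y (Suc ((j - 1) mod d + r * d))) \<in> measurable lborel (count_space UNIV)"
      unfolding rdigit_def by measurable
  qed
  ultimately show ?thesis unfolding dgt_def by (rule measurable_compose)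
qed

lemma measurable_walsh_fun:
  assumes "b \<ge> 2" "d \<ge> 1" "k \<in> walsh_box b d s K"
  shows "walsh_fun b d s k \<in> borel_measurable (prod_cube s)"
proof -
  have "(\<lambda>x. \<Prod>j=1..d * s. \<Prod>r<K. chr b (ndigit b (k j) r * dgt b d x j r)) \<in> borel_measurable (prod_cube s)"
    by (intro borel_measurable_prod measurable_chr measurable_dgt assms)
  then show ?thesis using walsh_fun_eq[OF assms] by (simp cong: measurable_cong)
qed

lemma chi_self: "b \<ge> 2 \<Longrightarrow> chi b l x x = 1"
  by (simp add: chi_def)

section \<open>The Walsh system along scrambled points\<close>

context owen_scrambling
begin

lemma expectation_walsh_pair:
  assumes z: "\<forall>j\<in>{1..d * s}. z j \<in> {0..<1}" "\<forall>j\<in>{1..d * s}. z' j \<in> {0..<1}"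
    and k: "k \<in> walsh_box b d s K" "k' \<in> walsh_box b d s K"
  shows "(\<integral>w. walsh_fun b d s k (pt z w) * cnj (walsh_fun b d s k' (pt z' w)) \<partial>M) =
    of_bool (k = k') * of_real (\<Prod>j=1..d * s. chi b (nlen b (k j)) (z j) (z' j))"
proof -
  let ?u = "\<lambda>j r x. chr b (ndigit b (k j) r * x)"
  let ?v = "\<lambda>j r x. cnj (chr b (ndigit b (k' j) r * x))"
  have "(\<integral>w. walsh_fun b d s k (pt z w) * cnj (walsh_fun b d s k' (pt z' w)) \<partial>M) =
    (\<integral>w. (\<Prod>j=1..d * s. \<Prod>r<K. ?u j r (scrambled_digit z j r w) * ?v j r (scrambled_digit z' j r w)) \<partial>M)"
  proof (rule integral_cong_AE)
    show "(\<lambda>w. walsh_fun b d s k (pt z w) * cnj (walsh_fun b d s k' (pt z' w))) \<in> borel_measurable M"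
      using measurable_compose[OF measurable_pt measurable_walsh_fun[OF base d_pos k(1)]]
        measurable_cnj[OF measurable_compose[OF measurable_pt measurable_walsh_fun[OF base d_pos k(2)]]]
      by (intro borel_measurable_times)
    show "(\<lambda>w. \<Prod>j=1..d * s. \<Prod>r<K. ?u j r (scrambled_digit z j r w) * ?v j r (scrambled_digit z' j r w))
        \<in> borel_measurable M"
      by (intro borel_measurable_prod borel_measurable_times measurable_cnj measurable_chr
          measurable_scrambled_digit)
    show "AE w in M. walsh_fun b d s k (pt z w) * cnj (walsh_fun b d s k' (pt z' w)) =
      (\<Prod>j=1..d * s. \<Prod>r<K. ?u j r (scrambled_digit z j r w) * ?v j r (scrambled_digit z' j r w))"
      using AE_pt[of z] AE_pt[of z']
      by eventually_elim
        (simp add: walsh_fun_eq[OF base d_pos k(1)] walsh_fun_eq[OF base d_pos k(2)] prod.distrib)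
  qed
  also have "\<dots> = (\<Prod>j=1..d * s. of_bool (k j = k' j) * of_real (chi b (nlen b (k j)) (z j) (z' j)))"
    unfolding expectation_prod_digits[where u = ?u and v = ?v and z = z and z' = z']
    using z by (intro prod.cong refl prod_perm_mean_eq_chi base walsh_box_digit_less[OF k(1)]
      walsh_box_digit_less[OF k(2)]) auto
  also have "\<dots> = of_bool (\<forall>j\<in>{1..d * s}. k j = k' j) * of_real (\<Prod>j=1..d * s. chi b (nlen b (k j)) (z j) (z' j))"
    unfolding prod.distrib prod_of_bool_eq[OF finite_atLeastAtMost] of_real_prod ..
  also have "(\<forall>j\<in>{1..d * s}. k j = k' j) \<longleftrightarrow> k = k'"
    \<comment> \<open>Frequencies in a box are extensional, so agreement on the index set is
      equality.\<close>
    using k unfolding walsh_box_def by (auto intro: PiE_ext)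
  finally show ?thesis .
qed

text \<open>Completing the target is harmless once the source is complete: as \<open>pt\<close>
  transports \<open>M\<close> to \<open>prod_cube\<close>, preimages of null sets are null. This
  gives meaning to the expectation of a Lebesgue measurable integrand.\<close>

lemma measurable_pt_cube: "pt z \<in> measurable (completion M) (cube s)"
  and distr_pt_cube: "distr (completion M) (cube s) (pt z) = cube s"
proof -
  have meas: "pt z \<in> measurable (completion M) (prod_cube s)"
    by (rule measurable_completion[OF measurable_pt])
  have law: "distr (completion M) (prod_cube s) (pt z) = prod_cube s"
    by (simp add: distr_completion measurable_pt distr_pt)
  show "pt z \<in> measurable (completion M) (cube s)"
    unfolding cube_eq by (rule completion.measurable_completion2[OF meas]) (simp add: law)
  show "distr (completion M) (cube s) (pt z) = cube s"
    unfolding cube_eq using completion.completion_distr_eq[OF meas] by (simp add: law)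
qed

lemma expectation_walsh_pair_completion:
  assumes z: "\<forall>j\<in>{1..d * s}. z j \<in> {0..<1}" "\<forall>j\<in>{1..d * s}. z' j \<in> {0..<1}"
    and k: "k \<in> walsh_box b d s K" "k' \<in> walsh_box b d s K"
  shows "(\<integral>w. walsh_fun b d s k (pt z w) * cnj (walsh_fun b d s k' (pt z' w)) \<partial>completion M) =
    of_bool (k = k') * of_real (\<Prod>j=1..d * s. chi b (nlen b (k j)) (z j) (z' j))"
proof -
  have "(\<lambda>w. walsh_fun b d s k (pt z w) * cnj (walsh_fun b d s k' (pt z' w))) \<in> borel_measurable M"
    using measurable_compose[OF measurable_pt measurable_walsh_fun[OF base d_pos k(1)]]
      measurable_cnj[OF measurable_compose[OF measurable_pt measurable_walsh_fun[OF base d_pos k(2)]]]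
    by (intro borel_measurable_times)
  from integral_completion[OF this] show ?thesis unfolding expectation_walsh_pair[OF assms] .
qed

text \<open>Orthonormality is not computed by integrating Walsh functions. A scrambled point has the
  law of the cube, so the integral is the pair expectation for two equal points, here the origin,
  where every \<open>chi\<close> is 1.\<close>

sublocale walsh: orthonormal_family "cube s" "walsh_fun b d s" "walsh_box b d s"
proof -
  interpret cube: prob_space "cube s" by (rule prob_space_cube)
  show "orthonormal_family (cube s) (walsh_fun b d s) (walsh_box b d s)"
  proof unfold_locales
    show meas: "walsh_fun b d s k \<in> borel_measurable (cube s)" if "k \<in> walsh_box b d s K" for k K
      unfolding cube_eq by (rule measurable_completion[OF measurable_walsh_fun[OF base d_pos that]])
    show "(\<integral>x. walsh_fun b d s k x * cnj (walsh_fun b d s k' x) \<partial>cube s) = of_bool (k = k')"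
      if k: "k \<in> walsh_box b d s K" "k' \<in> walsh_box b d s K" for k k' K
    proof -
      let ?g = "\<lambda>x. walsh_fun b d s k x * cnj (walsh_fun b d s k' x)"
      have "?g \<in> borel_measurable (cube s)"
        by (intro borel_measurable_times measurable_cnj meas[OF k(1)] meas[OF k(2)])
      from integral_distr[OF measurable_pt_cube[of "\<lambda>_. 0"] this]
      have "(\<integral>x. ?g x \<partial>cube s) = (\<integral>w. ?g (pt (\<lambda>_. 0) w) \<partial>completion M)"
        unfolding distr_pt_cube .
      also have "\<dots> = of_bool (k = k')"
        using k by (subst expectation_walsh_pair_completion) (auto simp: chi_self base)
      finally show ?thesis .
    qed
  qed (use finite_walsh_box walsh_box_mono[OF base] norm_walsh_fun[OF base d_pos] in auto)
qed

lemma walsh_box_0: "walsh_box b d s 0 = {\<lambda>j\<in>{1..d * s}. 0}"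
  unfolding walsh_box_def by (simp add: PiE_eq_singleton lessThan_Suc)

lemma walsh_fun_zero: "walsh_fun b d s (\<lambda>j\<in>{1..d * s}. 0) x = 1"
  using walsh_fun_eq[OF base d_pos, of "\<lambda>j\<in>{1..d * s}. 0" s 0 x] walsh_box_0 by simp

lemma approximable_one: "walsh.approximable (\<lambda>x. 1)"
proof -
  have "walsh.combo (\<lambda>_. 1) 0 = (\<lambda>x. 1)"
    unfolding walsh.combo_def walsh_box_0 by (simp add: walsh_fun_zero del: One_nat_def)
  then show ?thesis using walsh.approximable_combo[of "\<lambda>_. 1" 0] by simp
qed

text \<open>A cell of positive volume is, up to a null set, the set where finitely many digits have
  prescribed values, and its indicator is a Walsh polynomial. All other cells are null and are
  compared with the zero function.\<close>

lemma approximable_cell: "walsh.approximable (indicator (cell b d s K a))"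
proof (cases "\<forall>i\<in>{1..s}. 0 \<le> a i \<and> a i < int b ^ (d * K)")
  case True
  define x0 where "x0 i = real_of_int (a i) / real b ^ (d * K)" for i
  have p: "real b ^ (d * K) > 0" using base by simp
  have x0: "x0 i \<in> {0..<1}" if "i \<in> {1..s}" for i
  proof -
    have "a i < int b ^ (d * K)" "0 \<le> a i" using True that by auto
    then have "real_of_int (a i) < real b ^ (d * K)"
      by (simp only: of_int_less_iff[symmetric, where 'a = real]) simp
    then show ?thesis using \<open>0 \<le> a i\<close> p by (simp add: x0_def)
  qed
  have floor_x0: "\<lfloor>real b ^ (d * K) * x0 i\<rfloor> = a i" for i using p by (simp add: x0_def)
  \<comment> \<open>The coefficients of \<open>prod_of_bool_eq_sum_chr\<close>, multiplied over
    coordinates; they appear when the product of one-dimensional sums is expanded over the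
    box.\<close>
  define c where "c k = (\<Prod>j=1..d * s. (1 / of_nat b) ^ K * (\<Prod>r<K. cnj (chr b (ndigit b (k j) r * dgt b d x0 j r))))"
    for k :: "nat \<Rightarrow> nat"
  have combo: "walsh.combo c K x = of_bool (\<forall>j\<in>{1..d * s}. \<forall>r\<in>{..<K}. dgt b d x j r = dgt b d x0 j r)" for x
  proof -
    have "of_bool (\<forall>j\<in>{1..d * s}. \<forall>r\<in>{..<K}. dgt b d x j r = dgt b d x0 j r) =
      (\<Prod>j=1..d * s. \<Prod>r<K. of_bool (dgt b d x j r = dgt b d x0 j r) :: complex)"
      by (simp only: prod_of_bool_eq finite_atLeastAtMost finite_lessThan)
    also have "\<dots> = (\<Prod>j=1..d * s. \<Sum>k<b ^ K. (1 / of_nat b) ^ K *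
        (\<Prod>r<K. cnj (chr b (ndigit b k r * dgt b d x0 j r))) * (\<Prod>r<K. chr b (ndigit b k r * dgt b d x j r)))"
      by (intro prod.cong refl prod_of_bool_eq_sum_chr base) (simp_all add: dgt_def rdigit_less base)
    also have "\<dots> = (\<Sum>k\<in>walsh_box b d s K. \<Prod>j=1..d * s. (1 / of_nat b) ^ K *
        (\<Prod>r<K. cnj (chr b (ndigit b (k j) r * dgt b d x0 j r))) * (\<Prod>r<K. chr b (ndigit b (k j) r * dgt b d x j r)))"
      unfolding walsh_box_def by (intro prod_sum_PiE) auto
    also have "\<dots> = walsh.combo c K x"
      unfolding walsh.combo_def c_def
      by (intro sum.cong refl, subst walsh_fun_eq[OF base d_pos]) (auto simp only: prod.distrib)
    finally show ?thesis by simp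
  qed
  have AE1: "AE x in cube s. \<forall>i\<in>{1..s}. x i < 1"
    unfolding cube_eq by (rule AE_completion[OF AE_prod_cube_less_1])
  \<comment> \<open>Only almost everywhere: a coordinate equal to 1 has all digits 0, so on the
    upper faces the digits do not determine the cell.\<close>
  have "AE x in cube s. walsh.combo c K x = indicator (cell b d s K a) x"
  proof (rule AE_mp[OF AE1], intro AE_I2 impI)
    fix x assume "x \<in> space (cube s)" and less: "\<forall>i\<in>{1..s}. x i < 1"
    then have x: "x \<in> space (prod_cube s)" by (simp add: cube_eq)
    have "x \<in> cell b d s K a \<longleftrightarrow> (\<forall>i\<in>{1..s}. \<lfloor>real b ^ (d * K) * x i\<rfloor> = \<lfloor>real b ^ (d * K) * x0 i\<rfloor>)"
      using x by (simp add: cell_def floor_x0)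
    also have "\<dots> \<longleftrightarrow> (\<forall>j\<in>{1..d * s}. \<forall>r<K. dgt b d x j r = dgt b d x0 j r)"
    proof (rule floors_eq_iff_dgt[OF base d_pos _ x0])
      show "x i \<in> {0..<1}" if "i \<in> {1..s}" for i
        using x less that by (auto simp: space_prod_cube PiE_iff)
    qed
    finally have "x \<in> cell b d s K a \<longleftrightarrow> (\<forall>j\<in>{1..d * s}. \<forall>r\<in>{..<K}. dgt b d x j r = dgt b d x0 j r)"
      unfolding Ball_def lessThan_iff .
    then show "walsh.combo c K x = indicator (cell b d s K a) x"
      by (simp only: combo indicator_def)
  qed
  moreover have "cell b d s K a \<in> sets (cube s)" by (simp add: cube_eq sets_completionI_sets cell_sets)
  ultimately show ?thesis
    using walsh.approximable_AE_cong walsh.sq_int_combo walsh.sq_int_indicator walsh.approximable_combo by blast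
next
  case False
  then have "emeasure (prod_cube s) (cell b d s K a) = 0"
    unfolding emeasure_cell[OF base] if_not_P[OF False] by simp
  then have "cell b d s K a \<in> null_sets (prod_cube s)" by (intro null_setsI cell_sets)
  from AE_not_in[OF this] have "AE x in cube s. x \<notin> cell b d s K a"
    unfolding cube_eq by (rule AE_completion)
  then have "AE x in cube s. 0 = (indicator (cell b d s K a) x :: complex)"
    by eventually_elim simp
  moreover have "cell b d s K a \<in> sets (cube s)" by (simp add: cube_eq sets_completionI_sets cell_sets)
  ultimately show ?thesis
    using walsh.approximable_AE_cong[of "\<lambda>_. 0"] walsh.sq_int_indicator walsh.approximable_zero sq_int_zero by blast
qed

lemma approximable_sq_int:
  assumes "sq_int (cube s) f"
  shows "walsh.approximable f"
proof (rule walsh.approximable_if_indicators[OF _ assms])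
  fix A assume A: "A \<in> sets (cube s)"
  have space: "space (cube s) = space (prod_cube s)" by (simp add: cube_eq)
  have prod_sets: "walsh.approximable (indicator A')" if "A' \<in> sets (prod_cube s)" for A'
  proof (rule walsh.approximable_indicator_sigma_sets[OF Int_stable_cells[OF base, of d s]])
    show "cells b d s \<subseteq> Pow (space (cube s))" unfolding space by (rule cells_subset_Pow)
    show "sigma_sets (space (cube s)) (cells b d s) \<subseteq> sets (cube s)"
      unfolding space sets_prod_cube_eq_cells[OF base d_pos, symmetric] by (auto simp: cube_eq)
    show "walsh.approximable (\<lambda>x. 1)" by (rule approximable_one)
    show "A' \<in> sigma_sets (space (cube s)) (cells b d s)"
      using that unfolding space sets_prod_cube_eq_cells[OF base d_pos] .
    fix X assume "X \<in> cells b d s"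
    then consider "X = {}" | "X = space (cube s)" | K a where "X = cell b d s K a"
      unfolding space cells_def by blast
    then show "walsh.approximable (indicator X)"
    proof cases
      case 1
      then show ?thesis using walsh.approximable_zero by (simp add: indicator_def[abs_def])
    next
      case 2
      have "AE x in cube s. 1 = (indicator X x :: complex)" using 2 by (intro AE_I2) auto
      moreover have "X \<in> sets (cube s)" using 2 by simp
      ultimately show ?thesis
        using walsh.approximable_AE_cong[of "\<lambda>_. 1"] walsh.sq_int_const walsh.sq_int_indicator approximable_one
        by blast
    next
      case 3
      then show ?thesis using approximable_cell by simp
    qed
  qed
  have A': "A \<in> sets (completion (prod_cube s))" using A by (simp add: cube_eq)
  \<comment> \<open>A set of the completion differs from its Borel main part by a null set, so its
    indicator inherits approximability.\<close>
  let ?A = "main_part (prod_cube s) A"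
  have main: "?A \<in> sets (prod_cube s)" by (rule main_part_sets[OF A'])
  have "AE x in cube s. indicator ?A x = (indicator A x :: complex)"
    unfolding cube_eq
  proof (rule AE_completion)
    show "AE x in prod_cube s. indicator ?A x = (indicator A x :: complex)"
      using AE_in_main_part[OF A'] by eventually_elim (simp add: indicator_def)
  qed
  moreover have "?A \<in> sets (cube s)" using main by (simp add: cube_eq sets_completionI_sets)
  ultimately show "walsh.approximable (indicator A)"
    using walsh.approximable_AE_cong walsh.sq_int_indicator A prod_sets[OF main] by blast
qed

end

text \<open>With nonnegative terms the sums over an exhausting sequence increase to their limit, and
  every finite subset lies in some \<open>T n\<close>. The limit is thus the supremum of all finite
  sums.\<close>

lemma has_sum_exhausting:
  fixes g :: "'a \<Rightarrow> real"
  assumes nonneg: "\<And>x. x \<in> L \<Longrightarrow> 0 \<le> g x"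
    and T: "\<And>n. finite (T n)" "\<And>n. T n \<subseteq> L" "incseq T" "L \<subseteq> (\<Union>n. T n)"
    and lim: "(\<lambda>n. sum g (T n)) \<longlonglongrightarrow> V"
  shows "(g has_sum V) L"
proof -
  have mono: "incseq (\<lambda>n. sum g (T n))"
  proof (intro incseq_SucI sum_mono2 T(1))
    show "T n \<subseteq> T (Suc n)" for n using T(3) by (rule incseq_SucD)
    show "0 \<le> g x" if "x \<in> T (Suc n) - T n" for n x using that nonneg T(2) by blast
  qed
  have le: "sum g F \<le> V" if "finite F" "F \<subseteq> L" for F
  proof -
    have "\<exists>n. F \<subseteq> T n" using that
    proof (induction F rule: finite_induct)
      case (insert x F)
      then obtain n where n: "F \<subseteq> T n" by blast
      have "x \<in> L" using insert.prems by blast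
      then obtain m where m: "x \<in> T m" using T(4) by blast
      have "T n \<subseteq> T (max n m)" "T m \<subseteq> T (max n m)" using T(3) by (simp_all add: incseqD)
      then show ?case using n m by (intro exI[of _ "max n m"]) blast
    qed simp
    then obtain n where "F \<subseteq> T n" by blast
    have "sum g F \<le> sum g (T n)"
    proof (rule sum_mono2[OF T(1) \<open>F \<subseteq> T n\<close>])
      show "0 \<le> g x" if "x \<in> T n - F" for x using that nonneg T(2) by blast
    qed
    also have "\<dots> \<le> V" by (rule incseq_le[OF mono lim])
    finally show ?thesis .
  qed
  show ?thesis
    unfolding has_sum_def
  proof (rule order_tendstoI)
    fix y assume "y < V"
    then obtain n where n: "y < sum g (T n)"
      using order_tendstoD(1)[OF lim] unfolding eventually_sequentially by blast
    have "y < sum g F" if F: "finite F" "T n \<subseteq> F" "F \<subseteq> L" for F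
    proof -
      have "sum g (T n) \<le> sum g F" by (rule sum_mono2[OF F(1,2)]) (use nonneg F(3) in blast)
      then show ?thesis using n by linarith
    qed
    then show "\<forall>\<^sub>F F in finite_subsets_at_top L. y < sum g F"
      unfolding eventually_finite_subsets_at_top using T(1)[of n] T(2)[of n] by (intro exI[of _ "T n"]) simp
  next
    fix y assume "V < y"
    then show "\<forall>\<^sub>F F in finite_subsets_at_top L. sum g F < y"
      by (intro eventually_finite_subsets_at_top_weakI le_less_trans[OF le])
  qed
qed

text \<open>The box of frequencies with at most \<open>K\<close> digits per coordinate is the
  disjoint union of the blocks with all indices at most \<open>K\<close>. The weight depends only on
  digit lengths and can be taken out of each block.\<close>

lemma sum_walsh_box_blocks:
  assumes b: "b \<ge> 2"
  shows "(\<Sum>k\<in>walsh_box b d s K. (cmod (walsh_coeff b s f (freq_interlace b d s k)))\<^sup>2 * G (\<lambda>j\<in>{1..d * s}. nlen b (k j))) =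
    (\<Sum>l\<in>(\<Pi>\<^sub>E j\<in>{1..d * s}. {..K}). sigma2 b d s l f * G l)"
proof -
  let ?g = "\<lambda>k. \<lambda>j\<in>{1..d * s}. nlen b (k j)"
  let ?T = "\<Pi>\<^sub>E j\<in>{1..d * s}. {..K}"
  let ?h = "\<lambda>k. (cmod (walsh_coeff b s f (freq_interlace b d s k)))\<^sup>2"
  have fT: "finite ?T" by (intro finite_PiE) auto
  have img: "?g ` walsh_box b d s K \<subseteq> ?T"
    by (auto simp: walsh_box_def PiE_iff nlen_le_iff[OF b])
  have "(\<Sum>k\<in>walsh_box b d s K. ?h k * G (?g k)) =
    (\<Sum>l\<in>?T. \<Sum>k\<in>{k \<in> walsh_box b d s K. ?g k = l}. ?h k * G (?g k))"
    by (rule sum.group[OF finite_walsh_box fT img, symmetric])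
  also have "\<dots> = (\<Sum>l\<in>?T. sigma2 b d s l f * G l)"
  proof (rule sum.cong[OF refl])
    fix l assume l: "l \<in> ?T"
    have "{k \<in> walsh_box b d s K. ?g k = l} = (\<Pi>\<^sub>E j\<in>{1..d * s}. block b (l j))"
    proof (intro set_eqI iffI)
      fix k assume k: "k \<in> {k \<in> walsh_box b d s K. ?g k = l}"
      then have "k j \<in> block b (l j)" if "j \<in> {1..d * s}" for j
        using that by (auto simp: block_iff_nlen[OF b])
      then show "k \<in> (\<Pi>\<^sub>E j\<in>{1..d * s}. block b (l j))"
        using k by (auto simp: walsh_box_def PiE_iff)
    next
      fix k assume k: "k \<in> (\<Pi>\<^sub>E j\<in>{1..d * s}. block b (l j))"
      then have nlen: "nlen b (k j) = l j" if "j \<in> {1..d * s}" for j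
        using that by (auto simp: block_iff_nlen[OF b] PiE_iff)
      have "k j < b ^ K" if "j \<in> {1..d * s}" for j
        using nlen[OF that] l that nlen_le_iff[OF b, of "k j" K] by (auto simp: PiE_iff)
      then have "k \<in> walsh_box b d s K" using k by (auto simp: walsh_box_def PiE_iff)
      moreover have "?g k = l" using nlen l by (intro ext) (auto simp: PiE_iff extensional_def)
      ultimately show "k \<in> {k \<in> walsh_box b d s K. ?g k = l}" by simp
    qed
    moreover have "(\<Sum>k\<in>{k \<in> walsh_box b d s K. ?g k = l}. ?h k * G (?g k)) =
        (\<Sum>k\<in>{k \<in> walsh_box b d s K. ?g k = l}. ?h k) * G l"
      unfolding sum_distrib_right by (intro sum.cong) auto
    ultimately show "(\<Sum>k\<in>{k \<in> walsh_box b d s K. ?g k = l}. ?h k * G (?g k)) = sigma2 b d s l f * G l"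
      by (simp add: sigma2_def)
  qed
  finally show ?thesis .
qed

text \<open>Using \<open>has_sum\<close> makes the series unconditionally convergent, so no order of
  the block indices has to be chosen. Integrability is part of the conclusion, since an integral of
  a nonintegrable function would be 0 by convention.\<close>

theorem lemma3p1:
  fixes b s d m N :: nat
    and z :: "nat \<Rightarrow> nat \<Rightarrow> real"
    and f :: "(nat \<Rightarrow> real) \<Rightarrow> complex"
    and M :: "'w measure"
    and \<pi> :: "nat \<times> nat list \<Rightarrow> 'w \<Rightarrow> nat \<Rightarrow> nat"
  assumes "prime b" and "s \<ge> 1" and "d \<ge> 1" and "m \<ge> 1" and "N = b ^ m"
    and "\<And>n j. n < N \<Longrightarrow> j \<in> {1..d * s} \<Longrightarrow> z n j \<in> {0..<1}"
    and "L2_cube s f"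
    and "uniform_scrambling M b (d * s) \<pi>"
  shows "let Q = completion M; X = estimator b d s N z \<pi> f in
    integrable Q X \<and>
    (\<integral>w. X w \<partial>Q) = (\<integral>x. f x \<partial>cube s) \<and>
    integrable Q (\<lambda>w. (cmod (X w))\<^sup>2) \<and>
    ((\<lambda>l. sigma2 b d s l f * Gam b d s N z l) has_sum cvariance Q X)
      ((\<Pi>\<^sub>E j\<in>{1..d * s}. UNIV) - {\<lambda>j\<in>{1..d * s}. 0})"
proof -
  have b: "b \<ge> 2" using assms(1) by (rule prime_ge_2_nat)
  then have N: "N > 0" using assms(5) by simp
  interpret prob_space M using assms(8) by (simp add: uniform_scrambling_def)
  interpret owen_scrambling M b d s \<pi>
    using assms(3,8) b by unfold_locales (auto simp: uniform_scrambling_def)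
  define Q where "Q = completion M"
  define X where "X = estimator b d s N z \<pi> f"
  interpret Q: prob_space Q unfolding Q_def by (rule prob_space_completion)
  have f: "sq_int (cube s) f" using assms(7) by (simp add: L2_cube_def sq_int_def)
  have X_eq: "X = (\<lambda>w. 1 / of_nat N * (\<Sum>n<N. f (pt (z n) w)))"
    by (simp add: X_def estimator_def[abs_def] pt_def)
  have Y: "pt y \<in> measurable Q (cube s)" "distr Q (cube s) (pt y) = cube s" for y
    unfolding Q_def by (rule measurable_pt_cube distr_pt_cube)+
  let ?\<rho> = "\<lambda>n n' k. \<Prod>j=1..d * s. chi b (nlen b (k j)) (z n j) (z n' j)"
  have joint: "\<forall>K. \<forall>n<N. \<forall>n'<N. \<forall>k\<in>walsh_box b d s K. \<forall>k'\<in>walsh_box b d s K.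
      (\<integral>w. walsh_fun b d s k (pt (z n) w) * cnj (walsh_fun b d s k' (pt (z n') w)) \<partial>Q) =
      of_bool (k = k') * of_real (?\<rho> n n' k)"
    unfolding Q_def using assms(6) by (intro allI impI ballI expectation_walsh_pair_completion) auto
  note second = walsh.second_moment_average[where Y = "\<lambda>n. pt (z n)" and \<rho> = ?\<rho> and Q = Q and N = N,
    OF Y joint N]
  let ?G = "Gam b d s N z"
  have \<Gamma>: "1 / (real N)\<^sup>2 * (\<Sum>n<N. \<Sum>n'<N. ?\<rho> n n' k) = ?G (\<lambda>j\<in>{1..d * s}. nlen b (k j))" for k
    by (simp add: Gam_def)
  have sqX: "sq_int Q X" unfolding X_eq by (rule second(1)[OF f])
  have intX: "integrable Q X" by (rule Q.sq_int_integrable[OF sqX])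
  have fm: "f \<in> borel_measurable (cube s)" using f by (simp add: sq_int_def)
  have mean_f: "integrable Q (\<lambda>w. f (pt y w))" "(\<integral>w. f (pt y w) \<partial>Q) = (\<integral>x. f x \<partial>cube s)" for y
  proof -
    have "integrable (distr Q (cube s) (pt y)) f" unfolding Y(2) by (rule walsh.sq_int_integrable[OF f])
    then show "integrable Q (\<lambda>w. f (pt y w))" by (rule integrable_distr[OF Y(1)])
    show "(\<integral>w. f (pt y w) \<partial>Q) = (\<integral>x. f x \<partial>cube s)"
      using integral_distr[OF Y(1) fm, of y] unfolding Y(2) by simp
  qed
  have mean: "(\<integral>w. X w \<partial>Q) = (\<integral>x. f x \<partial>cube s)"
    unfolding X_eq using mean_f N by (simp add: Bochner_Integration.integral_sum)
  let ?L = "\<Pi>\<^sub>E j\<in>{1..d * s}. (UNIV :: nat set)"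
  let ?T = "\<lambda>K. \<Pi>\<^sub>E j\<in>{1..d * s}. {..K :: nat}"
  let ?l0 = "\<lambda>j\<in>{1..d * s}. 0 :: nat"
  let ?g = "\<lambda>l. sigma2 b d s l f * ?G l"
  have coeff: "walsh.fcoeff f k = walsh_coeff b s f (freq_interlace b d s k)" for k
    by (simp add: walsh.fcoeff_def walsh_coeff_def walsh_fun_def)
  have lim: "(\<lambda>K. sum ?g (?T K)) \<longlonglongrightarrow> msq Q X"
    using second(3)[OF f approximable_sq_int[OF f]]
    unfolding X_eq[symmetric] \<Gamma> coeff sum_walsh_box_blocks[OF b] .
  \<comment> \<open>\<open>?G l\<close> is the mean square of the average of a single Walsh
    function. Any frequency in the block \<open>l\<close> serves; \<open>k\<close> takes the least
    element in each coordinate, and \<open>K\<close> merely bounds all entries of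
    \<open>l\<close>.\<close>
  have G_nonneg: "0 \<le> ?G l" if l: "l \<in> ?L" for l
  proof -
    define k where "k = (\<lambda>j\<in>{1..d * s}. if l j = 0 then 0 else b ^ (l j - 1))"
    have "k j \<in> block b (l j)" if "j \<in> {1..d * s}" for j
      using that b by (simp add: k_def block_def)
    then have nlen: "nlen b (k j) = l j" if "j \<in> {1..d * s}" for j
      using that by (simp add: block_iff_nlen[OF b])
    define K where "K = (\<Sum>j=1..d * s. l j)"
    have "l j \<le> K" if "j \<in> {1..d * s}" for j
      unfolding K_def using that by (intro member_le_sum) auto
    then have "k j < b ^ K" if "j \<in> {1..d * s}" for j
      using nlen[OF that] that nlen_le_iff[OF b, of "k j" K] by simp
    then have k: "k \<in> walsh_box b d s K" by (auto simp: walsh_box_def k_def)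
    have "(\<lambda>j\<in>{1..d * s}. nlen b (k j)) = l"
      using nlen l by (intro ext) (auto simp: PiE_iff extensional_def)
    then have "?G l = (\<Sum>k'\<in>walsh_box b d s K. if k' = k then ?G (\<lambda>j\<in>{1..d * s}. nlen b (k' j)) else 0)"
      using k finite_walsh_box by simp
    also have "\<dots> = (\<Sum>k'\<in>walsh_box b d s K. (cmod (of_bool (k' = k)))\<^sup>2 * ?G (\<lambda>j\<in>{1..d * s}. nlen b (k' j)))"
      by (intro sum.cong) auto
    also have "\<dots> = msq Q (\<lambda>w. 1 / of_nat N * (\<Sum>n<N. walsh.combo (\<lambda>k'. of_bool (k' = k)) K (pt (z n) w)))"
      unfolding second(2) \<Gamma> ..
    finally show ?thesis using msq_nonneg by simp
  qed
  \<comment> \<open>The limit \<open>lim\<close> runs over boxes only; nonnegativity of the terms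
    upgrades it to a sum over all index vectors.\<close>
  have "(?g has_sum msq Q X) ?L"
  proof (rule has_sum_exhausting[OF _ _ _ _ _ lim])
    show "0 \<le> ?g l" if "l \<in> ?L" for l
      using G_nonneg[OF that] by (intro mult_nonneg_nonneg) (auto simp: sigma2_def intro!: sum_nonneg)
    show "finite (?T K)" for K by (intro finite_PiE) auto
    show "?T K \<subseteq> ?L" for K by (intro PiE_mono) auto
    show "incseq ?T" unfolding incseq_def by (intro allI impI PiE_mono) auto
    show "?L \<subseteq> (\<Union>K. ?T K)"
    proof
      fix l assume l: "l \<in> ?L"
      have "l j \<le> (\<Sum>j=1..d * s. l j)" if "j \<in> {1..d * s}" for j
        using that by (intro member_le_sum) auto
      then have "l \<in> ?T (\<Sum>j=1..d * s. l j)" using l by (auto simp: PiE_iff)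
      then show "l \<in> (\<Union>K. ?T K)" by blast
    qed
  qed
  then have "(?g has_sum (msq Q X - sum ?g {?l0})) (?L - {?l0})"
  proof (rule has_sum_Diff)
    show "(?g has_sum sum ?g {?l0}) {?l0}" by (rule has_sum_finite) simp
    show "{?l0} \<subseteq> ?L" by auto
  qed
  \<comment> \<open>The zero block contains only the zero frequency, whose Walsh function is the
    constant 1. Its term is the squared modulus of the mean, which is exactly what separates second
    moment and variance.\<close>
  moreover have "sum ?g {?l0} = (cmod (\<integral>x. f x \<partial>cube s))\<^sup>2"
  proof -
    have "?G ?l0 = 1" using N by (simp add: Gam_def chi_def power2_eq_square)
    moreover have "(\<Pi>\<^sub>E j\<in>{1..d * s}. block b (?l0 j)) = {?l0}"
      unfolding PiE_eq_singleton by (simp add: block_def)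
    moreover have "walsh_coeff b s f (freq_interlace b d s ?l0) = (\<integral>x. f x \<partial>cube s)"
      unfolding coeff[symmetric] walsh.fcoeff_def walsh_fun_zero by simp
    ultimately show ?thesis by (simp add: sigma2_def)
  qed
  \<comment> \<open>Expansion of the square around the mean \<mu>: the cross term contributes minus
    twice the squared modulus of \<mu>.\<close>
  moreover have "cvariance Q X = msq Q X - (cmod (\<integral>x. f x \<partial>cube s))\<^sup>2"
  proof -
    define \<mu> where "\<mu> = (\<integral>x. f x \<partial>cube s)"
    have "cvariance Q X = msq Q (\<lambda>w. X w + - \<mu>)" by (simp add: cvariance_def msq_def mean \<mu>_def)
    also have "\<dots> = msq Q X + (cmod \<mu>)\<^sup>2 + 2 * Re (- (\<mu> * cnj \<mu>))"
    proof -
      have "(\<integral>w. X w * cnj (- \<mu>) \<partial>Q) = \<mu> * cnj (- \<mu>)"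
        unfolding \<mu>_def mean[symmetric] by (rule integral_mult_left_zero)
      moreover have "msq Q (\<lambda>_. - \<mu>) = (cmod \<mu>)\<^sup>2" by (simp add: msq_def Q.prob_space)
      ultimately show ?thesis
        unfolding msq_add[OF sqX Q.sq_int_const[of "- \<mu>"]] by (simp only: complex_cnj_minus mult_minus_right)
    qed
    also have "Re (- (\<mu> * cnj \<mu>)) = - (cmod \<mu>)\<^sup>2"
      unfolding complex_norm_square[symmetric] by simp
    finally have "cvariance Q X = msq Q X - (cmod \<mu>)\<^sup>2" by linarith
    then show ?thesis unfolding \<mu>_def .
  qed
  ultimately have "(?g has_sum cvariance Q X) (?L - {?l0})" by (simp only:)
  moreover have "integrable Q (\<lambda>w. (cmod (X w))\<^sup>2)" using sqX by (simp add: sq_int_def)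
  ultimately show ?thesis
    unfolding Let_def Q_def[symmetric] X_def[symmetric] using intX mean by blast
qed

end
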